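(* Let $d\ge 1$, $1\le p,q\le\infty$ and $\alpha,\beta>0$. The inequality $$\|f\|_q\lesssim \big\|f\,|x|^{\alpha}\big\|_q+\big\|\widehat f\,|\xi|^{\beta}\big\|_p ,$$ (for all $f\in L^1(\mathbb R^d)$, with a constant independent of $f$) holds if and only if one of the following conditions holds: \begin{itemize} \item $1\le p\le q<\infty$ and $\beta=d\big(1-\frac1q-\frac1p\big)$; \item $\beta>d\big(1-\frac1q-\frac1p\big)$; \end{itemize} and, in addition, one of the following conditions holds: \begin{itemize} \item $q\ge 2$; \item $p,q\le 2$; \item $q<2<p$ and $\beta>d\big(\frac12-\frac1p\big)$. \end{itemize}
   Context: For integrable $f:\mathbb R^d\to\mathbb C$, $\widehat f(\xi)=\int_{\mathbb R^d}f(x)e^{-2\pi i\langle x,\xi\rangle}\,dx$. $\|\cdot\|_q$ is the norm of $L^q(\mathbb R^d)$ with respect to Lebesgue measure; norms may take the value $+\infty$. $F\lesssim G$ means $F\le C\,G$ with a constant $C$ depending only on the parameters ($d,p,q,\alpha,\beta$) and not on $f$. *)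

theory Defs
  imports "HOL-Analysis.Analysis" "HOL-Probability.Essential_Supremum"
begin

text \<open>The reciprocal \<open>1/p\<close> of a Lebesgue exponent \<open>p \<in> [1,\<infinity>]\<close> as a real number, with the
  convention \<open>1/\<infinity> = 0\<close>.\<close>

definition recip :: "ennreal \<Rightarrow> real" where
  "recip p = enn2real (inverse p)"

text \<open>The (possibly infinite) norm of \<open>L\<^sup>p\<close> with respect to Lebesgue measure. The root of an
  infinite integral is \<open>\<infinity>\<close>; this needs its own clause because \<open>powr\<close> is only available on the
  reals.\<close>

definition Lp_norm :: "ennreal \<Rightarrow> ('a::euclidean_space \<Rightarrow> complex) \<Rightarrow> ennreal" where
  "Lp_norm p f =
    (if p = \<infinity> then esssup lebesgue (\<lambda>x. ennreal (norm (f x)))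
     else (let I = (\<integral>\<^sup>+ x. ennreal (norm (f x) powr enn2real p) \<partial>lebesgue)
           in if I = \<infinity> then \<infinity> else ennreal (enn2real I powr recip p)))"

definition fourier :: "('a::euclidean_space \<Rightarrow> complex) \<Rightarrow> 'a \<Rightarrow> complex" where
  "fourier f \<xi> = (LINT x|lebesgue. f x * exp (- 2 * complex_of_real pi * \<i> * complex_of_real (x \<bullet> \<xi>)))"

end

theory Submission
  imports Defs "HOL-Probability.Characteristic_Functions"
begin

text \<open>
  Sufficiency. By duality and Parseval's formula, regularised by Gaussians, bounds for \<open>f\<close> in terms of
  its transform reduce to bounds for the transform of a test function. Splitting test functions by
  height, Bessel's inequality and the trivial bound from \<open>L\<^sup>1\<close> to \<open>L\<^sup>\<infinity>\<close> give the inequalities of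
  Hausdorff--Young and Paley, and by interpolation those of Pitt. The limiting case
  \<open>\<beta> = d (1 - 1/q - 1/p)\<close> is Pitt's inequality itself. In the strict case one localises to the unit ball
  and splits \<open>f\<close> into low and high frequencies. The high frequencies are controlled by Hausdorff--Young
  for an exponent \<open>s\<close> with \<open>1/s = min (1/2) (min (1/q) (1 - 1/p))\<close> and Hoelder's inequality, while the low
  frequencies contribute only a small multiple of the norm of \<open>f\<close>, which is absorbed, and a multiple of
  \<open>\<parallel>f |x|\<^sup>\<alpha>\<parallel>\<^sub>q\<close>.

  Necessity. Dilates of a Gaussian show \<open>\<beta> \<ge> d (1 - 1/q - 1/p)\<close>. In case of equality, the lacunary sum
  \<open>\<Sum>j\<le>N. 2 powr (j d / q) * g (2 ^ j x)\<close> of dilates of a Gaussian \<open>g\<close> has norm at least of order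
  \<open>N powr (1/q)\<close> (of order \<open>N\<close> if \<open>q = \<infinity>\<close>), whereas the right-hand side is of order \<open>N powr (1/p)\<close>. For \<open>q < 2 < p\<close> and
  \<open>\<beta> \<le> d (1/2 - 1/p)\<close>, a sum of \<open>N\<close> Gaussian chirps with lacunary rates and random signs has norm of order
  \<open>N powr (1/2)\<close> by Khinchine's inequality; the frequency term is again of order \<open>N powr (1/p)\<close>, and the
  spatial term is made small by a fixed dilation.
\<close>

section \<open>Lebesgue norms\<close>

text \<open>The transform of an L^1 function need not be integrable, so Fourier inversion is never
  at hand: the Parseval identities carry a factor \<open>gauss \<epsilon>\<close>, and \<epsilon>
  tends to 0 only in the resulting bounds. In the strict case write t = 1/s. The bound t \<le> 1/2
  allows Hausdorff--Young, t \<le> 1/q allows passing from L^s to L^q on the unit ball, and t \<le>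
  1 - 1/p allows Hoelder's inequality in frequency; for the largest such t the two groups of
  conditions together give \<beta> > d (1 - t - 1/p). The weight |\<xi>|^(-\<beta>) is singular at
  0, hence a multiplier that vanishes there to high order. In the counterexamples the dilates live
  at separate scales and add up in the l^q sense, whereas the chirps share a single modulus and
  differ in phase only. The transform of the j-th chirp has height about 2^(-j d/2) at scale 2^j,
  which is what brings the number 1/2 into the last condition.\<close>

lemma ennreal_le_by_real:
  assumes "\<And>c. 0 < c \<Longrightarrow> b \<le> ennreal c \<Longrightarrow> a \<le> ennreal c"
  shows "a \<le> b"
proof (cases b)
  case (real r)
  have "a \<le> ennreal (r + e)" if "e > 0" for e
    using assms[of "r + e"] that real by (auto intro: ennreal_leI add_nonneg_pos)
  then have "a \<le> b + ennreal e" if "e > 0" for e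
    using real that by (simp add: ennreal_plus)
  then show ?thesis
    by (meson ennreal_le_epsilon)
qed simp

lemma exponent_cases:
  assumes "1 \<le> p"
  obtains (inf) "p = top" "recip p = 0"
    | (fin) P where "1 \<le> P" "p = ennreal P" "recip p = 1 / P"
proof (cases p)
  case (real r)
  then have "1 \<le> r"
    using assms by simp
  then show ?thesis
    using real fin[of r] by (simp add: recip_def inverse_ennreal divide_inverse)
qed (use inf in \<open>auto simp: recip_def\<close>)

lemma recip_ennreal: "0 < P \<Longrightarrow> recip (ennreal P) = 1 / P"
  by (simp add: recip_def inverse_ennreal divide_inverse)

lemma recip_top [simp]: "recip top = 0"
  by (simp add: recip_def)

lemma recip_inj:
  assumes "1 \<le> p" "1 \<le> r" "recip p = recip r"
  shows "p = r"
  by (rule exponent_cases[OF \<open>1 \<le> p\<close>]; rule exponent_cases[OF \<open>1 \<le> r\<close>]) (use assms(3) in auto)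

text \<open>Comparing P-th powers with a real bound avoids roots of possibly infinite integrals, and
  it replaces \<open>lebesgue\<close> by \<open>lborel\<close>. Arguments with a finite exponent go
  through this form, with \<open>ennreal_le_by_real\<close> supplying the real bound.\<close>

lemma Lp_norm_le_iff:
  assumes "1 \<le> P" "0 \<le> c"
  shows "Lp_norm (ennreal P) f \<le> ennreal c
    \<longleftrightarrow> (\<integral>\<^sup>+x. ennreal (norm (f x) powr P) \<partial>lborel) \<le> ennreal (c powr P)"
proof -
  define I where "I = (\<integral>\<^sup>+x. ennreal (norm (f x) powr P) \<partial>lborel)"
  have r: "recip (ennreal P) = 1 / P" "enn2real (ennreal P) = P" "ennreal P \<noteq> \<infinity>"
    using assms by (auto simp: recip_ennreal)
  have eq: "Lp_norm (ennreal P) f = (if I = \<infinity> then \<infinity> else ennreal (enn2real I powr (1 / P)))"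
    unfolding Lp_norm_def r I_def by (simp add: nn_integral_completion Let_def)
  show ?thesis
  proof (cases I)
    case (real i)
    have "i powr (1 / P) \<le> c \<longleftrightarrow> i \<le> c powr P"
    proof
      assume "i powr (1 / P) \<le> c"
      then have "(i powr (1 / P)) powr P \<le> c powr P"
        using assms by (intro powr_mono2) auto
      then show "i \<le> c powr P"
        using real assms by (simp add: powr_powr)
    next
      assume "i \<le> c powr P"
      then have "i powr (1 / P) \<le> (c powr P) powr (1 / P)"
        using real assms by (intro powr_mono2) auto
      then show "i powr (1 / P) \<le> c"
        using assms by (simp add: powr_powr)
    qed
    then show ?thesis
      using real assms unfolding eq I_def[symmetric] by simp
  qed (simp_all add: eq I_def[symmetric] top_unique)
qed

lemma Lp_norm_inf_le_iff:
  fixes f :: "'a::euclidean_space \<Rightarrow> complex"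
  assumes [measurable]: "f \<in> borel_measurable borel"
  shows "Lp_norm top f \<le> C \<longleftrightarrow> (AE x in lborel. ennreal (norm (f x)) \<le> C)"
proof -
  have m: "(\<lambda>x. ennreal (norm (f x))) \<in> borel_measurable lebesgue"
    by (intro measurable_completion) simp
  show ?thesis
  proof
    assume "Lp_norm top f \<le> C"
    then show "AE x in lborel. ennreal (norm (f x)) \<le> C"
      using esssup_AE[of "\<lambda>x. ennreal (norm (f x))" lebesgue]
      by (simp add: Lp_norm_def AE_completion_iff) (erule eventually_mono, rule order_trans)
  next
    assume "AE x in lborel. ennreal (norm (f x)) \<le> C"
    then show "Lp_norm top f \<le> C"
      using m by (auto simp: Lp_norm_def AE_completion_iff)
  qed
qed

lemma Lp_norm_AE_mono:
  fixes f g :: "'a::euclidean_space \<Rightarrow> complex"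
  assumes p: "1 \<le> p" and f: "f \<in> borel_measurable borel" and g: "g \<in> borel_measurable borel"
    and le: "AE x in lborel. norm (f x) \<le> norm (g x)"
  shows "Lp_norm p f \<le> Lp_norm p g"
  using p
proof (cases rule: exponent_cases)
  case inf
  have "AE x in lborel. ennreal (norm (f x)) \<le> Lp_norm top g"
  proof -
    have "AE x in lborel. ennreal (norm (g x)) \<le> Lp_norm top g"
      using Lp_norm_inf_le_iff[OF g, of "Lp_norm top g"] by simp
    with le show ?thesis
      by eventually_elim (meson ennreal_leI order_trans)
  qed
  then show ?thesis
    unfolding inf(1) Lp_norm_inf_le_iff[OF f] .
next
  case (fin P)
  have "(\<integral>\<^sup>+x. ennreal (norm (f x) powr P) \<partial>lborel) \<le> (\<integral>\<^sup>+x. ennreal (norm (g x) powr P) \<partial>lborel)"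
    by (rule nn_integral_mono_AE, use le in eventually_elim)
      (use fin in \<open>auto intro!: ennreal_leI powr_mono2\<close>)
  then show ?thesis
    unfolding fin(2) using fin(1)
    by - (rule ennreal_le_by_real, simp add: Lp_norm_le_iff)
qed

lemma Lp_norm_mono:
  fixes f g :: "'a::euclidean_space \<Rightarrow> complex"
  assumes "1 \<le> p" "f \<in> borel_measurable borel" "g \<in> borel_measurable borel"
    and "\<And>x. norm (f x) \<le> norm (g x)"
  shows "Lp_norm p f \<le> Lp_norm p g"
  using assms by (intro Lp_norm_AE_mono) auto

lemma Lp_norm_cong_norm:
  fixes f g :: "'a::euclidean_space \<Rightarrow> complex"
  assumes "\<And>x. norm (f x) = norm (g x)"
  shows "Lp_norm p f = Lp_norm p g"
  by (simp add: Lp_norm_def assms)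

lemma Lp_norm_AE_cong_lebesgue:
  fixes f g :: "'a::euclidean_space \<Rightarrow> complex"
  assumes "AE x in lebesgue. f x = g x"
    and "f \<in> borel_measurable lebesgue" "g \<in> borel_measurable lebesgue"
  shows "Lp_norm p f = Lp_norm p g"
proof -
  have "esssup lebesgue (\<lambda>x. ennreal (norm (f x))) = esssup lebesgue (\<lambda>x. ennreal (norm (g x)))"
    using assms by (intro esssup_AE_cong) (auto elim!: eventually_mono)
  moreover have "(\<integral>\<^sup>+ x. ennreal (norm (f x) powr enn2real p) \<partial>lebesgue) =
      (\<integral>\<^sup>+ x. ennreal (norm (g x) powr enn2real p) \<partial>lebesgue)"
    using assms by (intro nn_integral_cong_AE) (auto elim!: eventually_mono)
  ultimately show ?thesis
    by (simp add: Lp_norm_def)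
qed

lemma Young_powr:
  fixes x y :: real
  assumes "0 \<le> x" "0 \<le> y" "0 < \<theta>" "\<theta> < 1"
  shows "x powr \<theta> * y powr (1 - \<theta>) \<le> \<theta> * x + (1 - \<theta>) * y"
proof (cases "x = 0 \<or> y = 0")
  case False
  then show ?thesis
    using Youngs_inequality_0[of \<theta> "1 - \<theta>" x y] assms by auto
qed (use assms in auto)

lemma Lp_norm_scale_aux:
  fixes f :: "'a::euclidean_space \<Rightarrow> complex"
  assumes [measurable]: "f \<in> borel_measurable borel" and "1 \<le> P" "0 < a" "0 < b" "Lp_norm (ennreal P) f \<le> ennreal b"
  shows "Lp_norm (ennreal P) (\<lambda>x. complex_of_real a * f x) \<le> ennreal (a * b)"
proof -
  have "(\<integral>\<^sup>+x. ennreal (norm (complex_of_real a * f x) powr P) \<partial>lborel)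
      = ennreal (a powr P) * (\<integral>\<^sup>+x. ennreal (norm (f x) powr P) \<partial>lborel)"
    using assms by (simp add: norm_mult powr_mult ennreal_mult nn_integral_cmult)
  also have "\<dots> \<le> ennreal (a powr P) * ennreal (b powr P)"
    using assms by (intro mult_left_mono) (auto simp: Lp_norm_le_iff)
  also have "\<dots> = ennreal ((a * b) powr P)"
    using assms by (simp add: ennreal_mult powr_mult)
  finally show ?thesis
    using assms by (subst Lp_norm_le_iff) auto
qed

text \<open>Divide f by a and g by b and apply Young's inequality pointwise with weights T/P and
  T/R, which sum to 1 by the relation between the exponents; integrating then gives at most 1. An
  infinite exponent means multiplication by an essentially bounded function and is settled by
  monotonicity.\<close>

lemma Lp_norm_mult_le_aux:
  fixes f g :: "'a::euclidean_space \<Rightarrow> complex"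
  assumes t: "1 \<le> t" "1 \<le> p" "1 \<le> r" and rec: "recip t = recip p + recip r"
    and f[measurable]: "f \<in> borel_measurable borel" and g[measurable]: "g \<in> borel_measurable borel"
    and ab: "0 < a" "0 < b" "Lp_norm p f \<le> ennreal a" "Lp_norm r g \<le> ennreal b"
  shows "Lp_norm t (\<lambda>x. f x * g x) \<le> ennreal (a * b)"
  using \<open>1 \<le> p\<close>
proof (cases rule: exponent_cases)
  case inf
  then have tr: "recip t = recip r"
    using rec by simp
  have f_le: "AE x in lborel. norm (f x) \<le> a"
    using ab inf Lp_norm_inf_le_iff[OF f] by (auto elim!: eventually_mono)
  from \<open>1 \<le> r\<close> show ?thesis
  proof (cases rule: exponent_cases)
    case inf2: inf
    then have "t = top"
      using recip_inj[of t r] tr t inf2 by simp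
    moreover have "AE x in lborel. norm (g x) \<le> b"
      using ab inf2 Lp_norm_inf_le_iff[OF g] by (auto elim!: eventually_mono)
    ultimately show ?thesis
      using f_le ab by (auto simp: Lp_norm_inf_le_iff norm_mult elim!: eventually_elim2
        intro!: ennreal_leI mult_mono)
  next
    case (fin R)
    have tt: "t = ennreal R"
      using recip_inj[of t r] fin tr t by simp
    have "Lp_norm t (\<lambda>x. f x * g x) \<le> Lp_norm t (\<lambda>x. complex_of_real a * g x)"
      using t f_le ab by (intro Lp_norm_AE_mono)
        (auto simp: norm_mult elim!: eventually_mono intro!: mult_right_mono)
    also have "\<dots> \<le> ennreal (a * b)"
      using fin ab unfolding tt by (intro Lp_norm_scale_aux) auto
    finally show ?thesis .
  qed
next
  case (fin P)
  from \<open>1 \<le> r\<close> show ?thesis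
  proof (cases rule: exponent_cases)
    case inf
    then have tr: "recip t = recip p"
      using rec by simp
    have g_le: "AE x in lborel. norm (g x) \<le> b"
      using ab inf Lp_norm_inf_le_iff[OF g] by (auto elim!: eventually_mono)
    have tt: "t = ennreal P"
      using recip_inj[of t p] fin tr t by simp
    have "Lp_norm t (\<lambda>x. f x * g x) \<le> Lp_norm t (\<lambda>x. complex_of_real b * f x)"
      using t g_le ab by (intro Lp_norm_AE_mono)
        (auto simp: norm_mult mult.commute[of _ "norm (f _)"] elim!: eventually_mono intro!: mult_left_mono)
    also have "\<dots> \<le> ennreal (a * b)"
      using fin ab unfolding tt mult.commute[of a b] by (intro Lp_norm_scale_aux) auto
    finally show ?thesis .
  next
    case fin2: (fin R)
    from \<open>1 \<le> t\<close> show ?thesis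
    proof (cases rule: exponent_cases)
      case inf
      have "0 < 1 / P + 1 / R" using fin fin2 by (intro add_pos_pos) auto
      then show ?thesis
        using rec fin fin2 inf by auto
    next
      case fin3: (fin T)
      have e: "1 / T = 1 / P + 1 / R"
        using rec fin fin2 fin3 by simp
      have "0 < T / R" "0 < T / P"
        using fin fin2 fin3 by auto
      moreover have "T / R = 1 - T / P"
        using arg_cong[OF e, of "\<lambda>u. T * u"] fin3 by (simp add: distrib_left)
      ultimately have e1: "T / R = 1 - T / P" and "T / P < 1" "0 < T / P"
        by auto
      have "T / P + T / R = 1"
        using e1 by simp
      have pw: "norm (f x * g x) powr T \<le>
        (a * b) powr T * (T / P * (norm (f x) / a) powr P + T / R * (norm (g x) / b) powr R)" for x
      proof -
        define u v where "u = norm (f x) / a" and "v = norm (g x) / b"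
        have uv: "0 \<le> u" "0 \<le> v"
          using ab by (auto simp: u_def v_def)
        have "norm (f x * g x) = (a * b) * (u * v)"
          using ab by (simp add: u_def v_def norm_mult)
        then have "norm (f x * g x) powr T = (a * b) powr T * (u powr T * v powr T)"
          using ab uv by (simp add: powr_mult)
        moreover have "u powr T * v powr T \<le> T / P * u powr P + T / R * v powr R"
          using Young_powr[of "u powr P" "v powr R" "T / P"] uv fin fin2 fin3 \<open>T / P < 1\<close> \<open>0 < T / P\<close>
          unfolding e1[symmetric] powr_powr by simp
        ultimately show ?thesis
          using ab by (simp add: u_def v_def)
      qed
      have "(\<integral>\<^sup>+x. ennreal (norm (f x * g x) powr T) \<partial>lborel) \<le>
        (\<integral>\<^sup>+x. ennreal ((a * b) powr T) * (ennreal (T / P * (1 / a) powr P) * ennreal (norm (f x) powr P)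
          + ennreal (T / R * (1 / b) powr R) * ennreal (norm (g x) powr R)) \<partial>lborel)"
        using fin fin2 fin3 ab
        by (intro nn_integral_mono order_trans[OF ennreal_leI[OF pw]])
          (auto simp: ennreal_mult[symmetric] ennreal_plus[symmetric] powr_divide simp del: ennreal_plus)
      also have "\<dots> = ennreal ((a * b) powr T) * (ennreal (T / P * (1 / a) powr P) * (\<integral>\<^sup>+x. ennreal (norm (f x) powr P) \<partial>lborel)
          + ennreal (T / R * (1 / b) powr R) * (\<integral>\<^sup>+x. ennreal (norm (g x) powr R) \<partial>lborel))"
        by (simp add: nn_integral_cmult nn_integral_add)
      also have "\<dots> \<le> ennreal ((a * b) powr T) * (ennreal (T / P * (1 / a) powr P) * ennreal (a powr P)
          + ennreal (T / R * (1 / b) powr R) * ennreal (b powr R))"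
        using ab fin fin2 by (intro mult_left_mono add_mono) (auto simp: Lp_norm_le_iff)
      also have "\<dots> = ennreal ((a * b) powr T)"
        using ab fin fin2 fin3 \<open>T / P + T / R = 1\<close>
        by (simp add: ennreal_mult[symmetric] ennreal_plus[symmetric] powr_divide mult.assoc del: ennreal_plus)
      finally show ?thesis
        using fin3 ab Lp_norm_le_iff[of T "a * b" "\<lambda>x. f x * g x"] by simp
    qed
  qed
qed

lemma Lp_norm_eq_0_AE:
  fixes f :: "'a::euclidean_space \<Rightarrow> complex"
  assumes "1 \<le> p" and f[measurable]: "f \<in> borel_measurable borel" and "Lp_norm p f = 0"
  shows "AE x in lborel. f x = 0"
  using \<open>1 \<le> p\<close>
proof (cases rule: exponent_cases)
  case inf
  then show ?thesis
    using Lp_norm_inf_le_iff[OF f, of 0] assms by auto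
next
  case (fin P)
  then have "(\<integral>\<^sup>+x. ennreal (norm (f x) powr P) \<partial>lborel) = 0"
    using Lp_norm_le_iff[of P 0 f] assms by simp
  then have "AE x in lborel. ennreal (norm (f x) powr P) = 0"
    by (subst (asm) nn_integral_0_iff_AE) auto
  then show ?thesis
    by (auto elim!: eventually_mono)
qed

lemma Lp_norm_AE_0:
  fixes f :: "'a::euclidean_space \<Rightarrow> complex"
  assumes "1 \<le> p" "f \<in> borel_measurable borel" "AE x in lborel. f x = 0"
  shows "Lp_norm p f = 0"
  using \<open>1 \<le> p\<close>
proof (cases rule: exponent_cases)
  case inf
  then show ?thesis
    using Lp_norm_inf_le_iff[of f 0] assms by auto
next
  case (fin P)
  have "(\<integral>\<^sup>+x. ennreal (norm (f x) powr P) \<partial>lborel) = (\<integral>\<^sup>+x. 0 \<partial>(lborel::'a measure))"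
    using assms fin by (intro nn_integral_cong_AE) (auto elim!: eventually_mono)
  then show ?thesis
    using Lp_norm_le_iff[of P 0 f] fin by simp
qed

lemma Lp_norm_Holder:
  fixes f g :: "'a::euclidean_space \<Rightarrow> complex"
  assumes t: "1 \<le> t" "1 \<le> p" "1 \<le> r" and rec: "recip t = recip p + recip r"
    and f[measurable]: "f \<in> borel_measurable borel" and g[measurable]: "g \<in> borel_measurable borel"
  shows "Lp_norm t (\<lambda>x. f x * g x) \<le> Lp_norm p f * Lp_norm r g"
proof (cases "Lp_norm p f = 0 \<or> Lp_norm r g = 0")
  case True
  then have "AE x in lborel. f x * g x = 0"
    using Lp_norm_eq_0_AE[of p f] Lp_norm_eq_0_AE[of r g] t by auto
  then show ?thesis
    using Lp_norm_AE_0[of t "\<lambda>x. f x * g x"] t by simp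
next
  case False
  show ?thesis
  proof (cases "Lp_norm p f = \<infinity> \<or> Lp_norm r g = \<infinity>")
    case True
    then show ?thesis
      using False by (auto simp: ennreal_top_mult ennreal_mult_top)
  next
    case fin: False
    obtain a b where "0 \<le> a" "0 \<le> b" "Lp_norm p f = ennreal a" "Lp_norm r g = ennreal b"
      using fin by (cases "Lp_norm p f"; cases "Lp_norm r g") auto
    moreover from this have "0 < a" "0 < b"
      using False by (auto simp: less_le)
    ultimately show ?thesis
      using Lp_norm_mult_le_aux[OF t rec f g, of a b] by (simp add: ennreal_mult)
  qed
qed

text \<open>The upper bound is Hoelder's inequality with the constant as a factor in L^\<infinity>;
  the lower bound is the upper bound for the constant \<open>inverse c\<close>.\<close>

lemma Lp_norm_scale:
  fixes f :: "'a::euclidean_space \<Rightarrow> complex"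
  assumes p: "1 \<le> p" and f[measurable]: "f \<in> borel_measurable borel"
  shows "Lp_norm p (\<lambda>x. c * f x) = ennreal (norm c) * Lp_norm p f"
proof -
  have le: "Lp_norm p (\<lambda>x. c * f x) \<le> ennreal (norm c) * Lp_norm p f"
    if [measurable]: "f \<in> borel_measurable borel" for c and f :: "'a \<Rightarrow> complex"
  proof -
    have "Lp_norm top (\<lambda>x::'a. c) \<le> ennreal (norm c)"
      by (subst Lp_norm_inf_le_iff) auto
    moreover have "Lp_norm p (\<lambda>x. c * f x) \<le> Lp_norm top (\<lambda>x::'a. c) * Lp_norm p f"
      using p by (intro Lp_norm_Holder) auto
    ultimately show ?thesis
      by (meson mult_right_mono order_trans zero_le)
  qed
  show ?thesis
  proof (cases "c = 0")
    case True
    then show ?thesis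
      using Lp_norm_AE_0[of p "\<lambda>x. c * f x"] p by simp
  next
    case False
    have "ennreal (norm c) * Lp_norm p f = ennreal (norm c) * Lp_norm p (\<lambda>x. inverse c * (c * f x))"
      using False by (simp add: mult.assoc[symmetric])
    also have "\<dots> \<le> ennreal (norm c) * (ennreal (norm (inverse c)) * Lp_norm p (\<lambda>x. c * f x))"
      by (intro mult_left_mono le) auto
    also have "\<dots> = Lp_norm p (\<lambda>x. c * f x)"
      using False by (simp add: ennreal_mult[symmetric] mult.assoc[symmetric] norm_inverse)
    finally show ?thesis
      using le[OF f, of c] by (intro antisym)
  qed
qed

text \<open>If x or y is 0, the claim reduces to \<open>s powr P \<le> s\<close> for weights s in
  [0, 1]; otherwise it is the convexity of the power on the open half line.\<close>

lemma convex_powr_nonneg: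
  fixes x y :: real
  assumes "0 \<le> x" "0 \<le> y" "0 \<le> s" "0 \<le> t" "s + t = 1" "1 \<le> P"
  shows "(s * x + t * y) powr P \<le> s * x powr P + t * y powr P"
proof -
  have *: "(s * x) powr P \<le> s * x powr P" if "0 \<le> x" "0 \<le> s" "s \<le> 1" for s x
    using that assms powr_mono'[of 1 P s] by (auto simp: powr_mult intro!: mult_right_mono)
  show ?thesis
  proof (cases "x = 0 \<or> y = 0")
    case True
    then show ?thesis
      using assms *[of x s] *[of y t] by auto
  next
    case False
    then show ?thesis
      using convex_onD[OF powr_convex[OF \<open>1 \<le> P\<close>], of t x y] assms
      by (auto simp: eq_diff_eq[symmetric])
  qed
qed

text \<open>After division by a + b, the sum f + g is a convex combination of f/a and g/b with
  weights a/(a+b) and b/(a+b), so convexity of the P-th power bounds its integral by 1.\<close>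

lemma Lp_norm_triangle:
  fixes f g :: "'a::euclidean_space \<Rightarrow> complex"
  assumes p: "1 \<le> p" and f[measurable]: "f \<in> borel_measurable borel" and g[measurable]: "g \<in> borel_measurable borel"
  shows "Lp_norm p (\<lambda>x. f x + g x) \<le> Lp_norm p f + Lp_norm p g"
proof -
  have main: "Lp_norm p (\<lambda>x. f x + g x) \<le> ennreal (a + b)"
    if ab: "0 < a" "0 < b" "Lp_norm p f \<le> ennreal a" "Lp_norm p g \<le> ennreal b" for a b
    using p
  proof (cases rule: exponent_cases)
    case inf
    then have "AE x in lborel. norm (f x) \<le> a" "AE x in lborel. norm (g x) \<le> b"
      using ab Lp_norm_inf_le_iff[OF f] Lp_norm_inf_le_iff[OF g] by auto
    then have "AE x in lborel. norm (f x + g x) \<le> a + b"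
      by eventually_elim (meson norm_triangle_mono)
    then show ?thesis
      using inf by (auto simp: Lp_norm_inf_le_iff elim!: eventually_mono intro!: ennreal_leI)
  next
    case (fin P)
    define s t where "s = a / (a + b)" and "t = b / (a + b)"
    have st: "0 < s" "0 < t" "s + t = 1"
      using ab by (auto simp: s_def t_def add_divide_distrib[symmetric])
    have pw: "norm (f x + g x) powr P \<le>
      (a + b) powr P * (s * (norm (f x) / a) powr P + t * (norm (g x) / b) powr P)" for x
    proof -
      have "norm (f x + g x) powr P \<le> (norm (f x) + norm (g x)) powr P"
        using fin by (intro powr_mono2) (auto simp: norm_triangle_ineq)
      also have "norm (f x) + norm (g x) = (a + b) * (s * (norm (f x) / a) + t * (norm (g x) / b))"
        using ab by (simp add: s_def t_def add_divide_distrib[symmetric])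
      also have "\<dots> powr P = (a + b) powr P * (s * (norm (f x) / a) + t * (norm (g x) / b)) powr P"
        by (rule powr_mult)
      also have "\<dots> \<le> (a + b) powr P * (s * (norm (f x) / a) powr P + t * (norm (g x) / b) powr P)"
        using ab st fin by (intro mult_left_mono convex_powr_nonneg) auto
      finally show ?thesis .
    qed
    have "(\<integral>\<^sup>+x. ennreal (norm (f x + g x) powr P) \<partial>lborel) \<le>
      (\<integral>\<^sup>+x. ennreal ((a + b) powr P) * (ennreal (s * (1 / a) powr P) * ennreal (norm (f x) powr P)
        + ennreal (t * (1 / b) powr P) * ennreal (norm (g x) powr P)) \<partial>lborel)"
      using st ab
      by (intro nn_integral_mono order_trans[OF ennreal_leI[OF pw]])
        (auto simp: ennreal_mult[symmetric] ennreal_plus[symmetric] powr_divide simp del: ennreal_plus)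
    also have "\<dots> = ennreal ((a + b) powr P) * (ennreal (s * (1 / a) powr P) * (\<integral>\<^sup>+x. ennreal (norm (f x) powr P) \<partial>lborel)
        + ennreal (t * (1 / b) powr P) * (\<integral>\<^sup>+x. ennreal (norm (g x) powr P) \<partial>lborel))"
      by (simp add: nn_integral_cmult nn_integral_add)
    also have "\<dots> \<le> ennreal ((a + b) powr P) * (ennreal (s * (1 / a) powr P) * ennreal (a powr P)
        + ennreal (t * (1 / b) powr P) * ennreal (b powr P))"
      using ab fin by (intro mult_left_mono add_mono) (auto simp: Lp_norm_le_iff)
    also have "\<dots> = ennreal ((a + b) powr P)"
      using ab fin st
      by (simp add: ennreal_mult[symmetric] ennreal_plus[symmetric] powr_divide mult.assoc del: ennreal_plus)
    finally show ?thesis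
      using fin ab Lp_norm_le_iff[of P "a + b" "\<lambda>x. f x + g x"] by simp
  qed
  show ?thesis
  proof (cases "Lp_norm p f = \<infinity> \<or> Lp_norm p g = \<infinity>")
    case False
    obtain a b where ab: "0 \<le> a" "0 \<le> b" "Lp_norm p f = ennreal a" "Lp_norm p g = ennreal b"
      using False by (cases "Lp_norm p f"; cases "Lp_norm p g") auto
    \<comment> \<open>\<open>main\<close> asks for strictly positive bounds while a or b may be 0;
      hence the slack e.\<close>
    have "Lp_norm p (\<lambda>x. f x + g x) \<le> ennreal (a + b) + ennreal e" if "0 < e" for e
      using main[of "a + e/2" "b + e/2"] ab that
      by (auto simp: ennreal_plus[symmetric] simp: add_ac simp del: ennreal_plus intro: ennreal_leI)
    then have "Lp_norm p (\<lambda>x. f x + g x) \<le> ennreal (a + b)"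
      by (meson ennreal_le_epsilon)
    then show ?thesis
      using ab by simp
  qed auto
qed

lemma Lp_norm_sum:
  fixes f :: "'i \<Rightarrow> 'a::euclidean_space \<Rightarrow> complex"
  assumes p: "1 \<le> p" and "finite I" and f[measurable]: "\<And>i. i \<in> I \<Longrightarrow> f i \<in> borel_measurable borel"
  shows "Lp_norm p (\<lambda>x. \<Sum>i\<in>I. f i x) \<le> (\<Sum>i\<in>I. Lp_norm p (f i))"
  using \<open>finite I\<close> f
proof (induction I rule: finite_induct)
  case empty
  then show ?case
    using Lp_norm_AE_0[of p "\<lambda>x::'a. 0"] p by simp
next
  case (insert i I)
  have [measurable]: "f i \<in> borel_measurable borel" "\<And>j. j \<in> I \<Longrightarrow> f j \<in> borel_measurable borel"
    using insert.prems by auto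
  have "Lp_norm p (\<lambda>x. f i x + (\<Sum>i\<in>I. f i x)) \<le> Lp_norm p (f i) + Lp_norm p (\<lambda>x. \<Sum>i\<in>I. f i x)"
    by (intro Lp_norm_triangle p) measurable
  then show ?case
    using insert by (auto intro: order_trans add_left_mono)
qed

section \<open>Integrability of radial functions\<close>

lemma nn_integral_powr_tail:
  fixes a T :: real
  assumes "0 < a" "0 < T"
  shows "(\<integral>\<^sup>+s. (if T \<le> s then ennreal (s powr (- a - 1)) else 0) \<partial>lborel) = ennreal (T powr (- a) / a)"
proof -
  have "((\<lambda>x. x powr (- a - 1)) has_integral -(T powr (- a - 1 + 1)) / (- a - 1 + 1)) {T..}"
    using assms by (intro has_integral_powr_to_inf) auto
  then have "((\<lambda>x. x powr (- a - 1)) has_integral T powr (- a) / a) {T..}"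
    by simp
  then have "(\<integral>\<^sup>+s. ennreal (s powr (- a - 1)) * indicator {T..} s \<partial>lborel) = ennreal (T powr (- a) / a)"
    by (intro nn_integral_has_integral_lebesgue') auto
  then show ?thesis
    by (simp add: indicator_def of_bool_def if_distrib[of "\<lambda>u. _ * u"] cong: if_cong)
qed

lemma nn_integral_powr_head:
  fixes a T :: real
  assumes "0 < a" "0 \<le> T"
  shows "(\<integral>\<^sup>+s. (if 0 \<le> s \<and> s \<le> T then ennreal (s powr (a - 1)) else 0) \<partial>lborel) = ennreal (T powr a / a)"
proof -
  have "((\<lambda>x. x powr (a - 1)) has_integral (T powr (a - 1 + 1) / (a - 1 + 1))) {0..T}"
    using assms by (intro has_integral_powr_from_0) auto
  then have "(\<integral>\<^sup>+s. ennreal (s powr (a - 1)) * indicator {0..T} s \<partial>lborel) = ennreal (T powr a / a)"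
    using nn_integral_has_integral_lebesgue'[of "{0..T}" "\<lambda>x. x powr (a - 1)"] by simp
  then show ?thesis
    by (simp add: indicator_def of_bool_def if_distrib[of "\<lambda>u. _ * u"] cong: if_cong)
qed

lemma emeasure_ball_le_powr:
  fixes A :: "'a::euclidean_space set"
  assumes "A \<subseteq> cball 0 s" "0 \<le> s"
  shows "emeasure lborel A \<le> ennreal (unit_ball_vol (DIM('a)) * s powr DIM('a))"
proof (cases "A \<in> sets lborel")
  case True
  have "emeasure lborel A \<le> emeasure lborel (cball (0::'a) s)"
    using assms by (intro emeasure_mono) auto
  also have "\<dots> = ennreal (unit_ball_vol (DIM('a)) * s powr DIM('a))"
    using assms by (cases "s = 0") (auto simp: emeasure_cball powr_realpow)
  finally show ?thesis .
qed (simp add: emeasure_notin_sets)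

text \<open>Write |\<xi>|^(-\<gamma>) as the integral of \<gamma> s^(-\<gamma>-1) over s \<ge>
  |\<xi>| and exchange the integrals: only volumes of balls are needed, no polar coordinates. The
  explicit power of t is what Paley's inequality uses, with \<gamma> = 2d.\<close>

lemma nn_integral_norm_powr_outside:
  fixes t \<gamma> :: real
  assumes t: "0 < t" and \<gamma>: "DIM('a) < \<gamma>"
  shows "(\<integral>\<^sup>+\<xi>. (if t \<le> norm \<xi> then ennreal (norm \<xi> powr (- \<gamma>)) else 0) \<partial>(lborel::'a::euclidean_space measure))
    \<le> ennreal (\<gamma> * unit_ball_vol (DIM('a)) / (\<gamma> - DIM('a)) * t powr (DIM('a) - \<gamma>))"
proof -
  let ?V = "unit_ball_vol (DIM('a))"
  define h where "h \<xi> s = (if t \<le> norm \<xi> \<and> norm \<xi> \<le> s then ennreal (\<gamma> * s powr (- \<gamma> - 1)) else 0)"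
    for \<xi> :: 'a and s :: real
  have [measurable]: "case_prod h \<in> borel_measurable (borel \<Otimes>\<^sub>M borel)"
    unfolding h_def by measurable
  have \<gamma>0: "0 < \<gamma>"
    using \<gamma> by (meson of_nat_0_le_iff order_le_less_trans)
  have eq: "(if t \<le> norm \<xi> then ennreal (norm \<xi> powr (- \<gamma>)) else 0) = (\<integral>\<^sup>+s. h \<xi> s \<partial>lborel)" for \<xi> :: 'a
  proof (cases "t \<le> norm \<xi>")
    case True
    have "(\<integral>\<^sup>+s. h \<xi> s \<partial>lborel) = (\<integral>\<^sup>+s. ennreal \<gamma> * (if norm \<xi> \<le> s then ennreal (s powr (- \<gamma> - 1)) else 0) \<partial>lborel)"
      using True \<gamma>0 by (intro nn_integral_cong) (auto simp: h_def ennreal_mult)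
    also have "\<dots> = ennreal \<gamma> * ennreal (norm \<xi> powr (- \<gamma>) / \<gamma>)"
      using nn_integral_powr_tail[of \<gamma> "norm \<xi>"] True t \<gamma>0
      by (subst nn_integral_cmult) (auto simp del: zero_less_norm_iff)
    also have "\<dots> = ennreal (norm \<xi> powr (- \<gamma>))"
      using \<gamma>0 by (simp add: ennreal_mult[symmetric])
    finally show ?thesis
      using True by simp
  qed (simp add: h_def)
  have le: "(\<integral>\<^sup>+\<xi>. h \<xi> s \<partial>lborel) \<le> ennreal (\<gamma> * ?V) * (if t \<le> s then ennreal (s powr (- (\<gamma> - DIM('a)) - 1)) else 0)" for s
  proof (cases "t \<le> s")
    case True
    then have s: "0 < s"
      using t by simp
    have "(\<integral>\<^sup>+\<xi>. h \<xi> s \<partial>lborel) = (\<integral>\<^sup>+\<xi>. ennreal (\<gamma> * s powr (- \<gamma> - 1)) * indicator {\<xi>::'a. t \<le> norm \<xi> \<and> norm \<xi> \<le> s} \<xi> \<partial>lborel)"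
      by (intro nn_integral_cong) (auto simp: h_def)
    also have "\<dots> = ennreal (\<gamma> * s powr (- \<gamma> - 1)) * emeasure lborel {\<xi>::'a. t \<le> norm \<xi> \<and> norm \<xi> \<le> s}"
      by (subst nn_integral_cmult_indicator) auto
    also have "\<dots> \<le> ennreal (\<gamma> * s powr (- \<gamma> - 1)) * ennreal (?V * s powr DIM('a))"
      using s by (intro mult_left_mono emeasure_ball_le_powr) auto
    also have "\<dots> = ennreal (\<gamma> * ?V) * ennreal (s powr (- (\<gamma> - DIM('a)) - 1))"
      using \<gamma>0 s by (simp add: ennreal_mult[symmetric] mult_ac powr_add[symmetric] unit_ball_vol_nonneg)
        (simp add: powr_add[symmetric] algebra_simps)
    finally show ?thesis
      using True by simp
  next
    case False
    then have "h \<xi> s = 0" for \<xi>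
      by (auto simp: h_def)
    then show ?thesis
      by simp
  qed
  have "(\<integral>\<^sup>+\<xi>. (if t \<le> norm \<xi> then ennreal (norm \<xi> powr (- \<gamma>)) else 0) \<partial>(lborel::'a measure))
      = (\<integral>\<^sup>+s. (\<integral>\<^sup>+\<xi>. h \<xi> s \<partial>lborel) \<partial>lborel)"
    unfolding eq by (rule lborel_pair.Fubini'[symmetric]) simp
  also have "\<dots> \<le> (\<integral>\<^sup>+s. ennreal (\<gamma> * ?V) * (if t \<le> s then ennreal (s powr (- (\<gamma> - DIM('a)) - 1)) else 0) \<partial>lborel)"
    by (intro nn_integral_mono le)
  also have "\<dots> = ennreal (\<gamma> * ?V) * ennreal (t powr (- (\<gamma> - DIM('a))) / (\<gamma> - DIM('a)))"
    using t \<gamma> by (subst nn_integral_cmult) (simp_all add: nn_integral_powr_tail)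
  also have "\<dots> = ennreal (\<gamma> * ?V / (\<gamma> - DIM('a)) * t powr (DIM('a) - \<gamma>))"
    using \<gamma>0 \<gamma> by (simp add: ennreal_mult[symmetric] unit_ball_vol_nonneg)
  finally show ?thesis .
qed

text \<open>For a negative power b = -a the same layer integral is used, with balls of radius min 1
  s: the part s \<le> 1 converges because a < d, the part s \<ge> 1 because a > 0.\<close>

lemma nn_integral_norm_powr_inside:
  fixes b :: real
  assumes b: "- real DIM('a) < b"
  shows "(\<integral>\<^sup>+\<xi>. (if norm \<xi> \<le> 1 then ennreal (norm \<xi> powr b) else 0) \<partial>(lborel::'a::euclidean_space measure)) < \<infinity>"
proof (cases "0 \<le> b")
  case True
  have "(\<integral>\<^sup>+\<xi>. (if norm \<xi> \<le> 1 then ennreal (norm \<xi> powr b) else 0) \<partial>(lborel::'a measure))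
    \<le> (\<integral>\<^sup>+\<xi>. indicator (cball 0 1) \<xi> \<partial>(lborel::'a measure))"
    using True by (intro nn_integral_mono) (auto intro!: powr_le1)
  also have "\<dots> < \<infinity>"
    by (simp add: emeasure_cball)
  finally show ?thesis .
next
  case False
  let ?V = "unit_ball_vol (DIM('a))"
  define a where "a = - b"
  have a: "0 < a" "a < DIM('a)" "b = - a"
    using False b by (auto simp: a_def)
  define h where "h \<xi> s = (if norm \<xi> \<le> 1 \<and> norm \<xi> \<le> s then ennreal (a * s powr (- a - 1)) else 0)"
    for \<xi> :: 'a and s :: real
  have [measurable]: "case_prod h \<in> borel_measurable (borel \<Otimes>\<^sub>M borel)"
    unfolding h_def by measurable
  \<comment> \<open>Only an inequality: at \<xi> = 0 the left side vanishes because
    \<open>0 powr x = 0\<close>, while the right side is infinite.\<close>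
  have eq: "(if norm \<xi> \<le> 1 then ennreal (norm \<xi> powr (- a)) else 0) \<le> (\<integral>\<^sup>+s. h \<xi> s \<partial>lborel)" for \<xi> :: 'a
  proof (cases "norm \<xi> \<le> 1 \<and> \<xi> \<noteq> 0")
    case True
    have "(\<integral>\<^sup>+s. h \<xi> s \<partial>lborel) = (\<integral>\<^sup>+s. ennreal a * (if norm \<xi> \<le> s then ennreal (s powr (- a - 1)) else 0) \<partial>lborel)"
      using True a by (intro nn_integral_cong) (auto simp: h_def ennreal_mult)
    also have "\<dots> = ennreal a * ennreal (norm \<xi> powr (- a) / a)"
      using True a by (subst nn_integral_cmult) (auto simp: nn_integral_powr_tail)
    also have "\<dots> = ennreal (norm \<xi> powr (- a))"
      using a by (simp add: ennreal_mult[symmetric])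
    finally show ?thesis
      using True by simp
  qed auto
  have le: "(\<integral>\<^sup>+\<xi>. h \<xi> s \<partial>lborel) \<le> ennreal (a * ?V) * (if 0 \<le> s \<and> s \<le> 1 then ennreal (s powr ((DIM('a) - a) - 1)) else 0)
    + ennreal (a * ?V) * (if 1 \<le> s then ennreal (s powr (- a - 1)) else 0)" for s
  proof (cases "0 < s")
    case True
    have "(\<integral>\<^sup>+\<xi>. h \<xi> s \<partial>lborel) = (\<integral>\<^sup>+\<xi>. ennreal (a * s powr (- a - 1)) * indicator (cball (0::'a) (min 1 s)) \<xi> \<partial>lborel)"
      by (intro nn_integral_cong) (auto simp: h_def)
    also have "\<dots> = ennreal (a * s powr (- a - 1)) * emeasure lborel (cball (0::'a) (min 1 s))"
      by (subst nn_integral_cmult_indicator) auto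
    also have "\<dots> \<le> ennreal (a * s powr (- a - 1)) * ennreal (?V * (min 1 s) powr DIM('a))"
      using True by (intro mult_left_mono emeasure_ball_le_powr) auto
    also have "\<dots> = ennreal (a * ?V) * ennreal (s powr (- a - 1) * (min 1 s) powr DIM('a))"
      using a True by (simp add: ennreal_mult[symmetric] mult_ac unit_ball_vol_nonneg)
    also have "\<dots> \<le> ennreal (a * ?V) * (if 0 \<le> s \<and> s \<le> 1 then ennreal (s powr ((DIM('a) - a) - 1)) else 0)
    + ennreal (a * ?V) * (if 1 \<le> s then ennreal (s powr (- a - 1)) else 0)"
    proof (cases "s \<le> 1")
      case s1: True
      have "s powr (- a - 1) * (min 1 s) powr DIM('a) = s powr ((DIM('a) - a) - 1)"
        using s1 True by (simp add: powr_add[symmetric] min_def algebra_simps)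
      then show ?thesis
        using s1 True by simp
    qed (simp add: min_def)
    finally show ?thesis .
  next
    case False
    have "h \<xi> s = 0" if "\<xi> \<noteq> 0" for \<xi>
      using False that unfolding h_def by (smt (verit) norm_eq_zero norm_ge_zero zero_less_norm_iff)
    then have "AE \<xi> in lborel. h \<xi> s = 0"
      using AE_lborel_singleton[of "0::'a"] by auto
    then have "(\<integral>\<^sup>+\<xi>. h \<xi> s \<partial>lborel) = (\<integral>\<^sup>+\<xi>. 0 \<partial>(lborel::'a measure))"
      by (intro nn_integral_cong_AE) auto
    then show ?thesis
      by simp
  qed
  have "(\<integral>\<^sup>+\<xi>. (if norm \<xi> \<le> 1 then ennreal (norm \<xi> powr b) else 0) \<partial>(lborel::'a measure))
      \<le> (\<integral>\<^sup>+\<xi>. (\<integral>\<^sup>+s. h \<xi> s \<partial>lborel) \<partial>lborel)"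
    unfolding a by (intro nn_integral_mono eq)
  also have "\<dots> = (\<integral>\<^sup>+s. (\<integral>\<^sup>+\<xi>. h \<xi> s \<partial>lborel) \<partial>lborel)"
    by (rule lborel_pair.Fubini'[symmetric]) simp
  also have "\<dots> \<le> (\<integral>\<^sup>+s. ennreal (a * ?V) * (if 0 \<le> s \<and> s \<le> 1 then ennreal (s powr ((DIM('a) - a) - 1)) else 0)
    + ennreal (a * ?V) * (if 1 \<le> s then ennreal (s powr (- a - 1)) else 0) \<partial>lborel)"
    by (intro nn_integral_mono le)
  also have "\<dots> = ennreal (a * ?V) * ennreal (1 powr (DIM('a) - a) / (DIM('a) - a)) + ennreal (a * ?V) * ennreal (1 powr (- a) / a)"
    using a nn_integral_powr_head[of "DIM('a) - a" 1] nn_integral_powr_tail[of a 1]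
    by (subst nn_integral_add) (simp_all add: nn_integral_cmult)
  also have "\<dots> < \<infinity>"
    by (simp add: ennreal_mult_less_top)
  finally show ?thesis .
qed

lemma nn_integral_dominated_radial:
  fixes u :: "'a::euclidean_space \<Rightarrow> real" and b \<gamma> K :: real
  assumes [measurable]: "u \<in> borel_measurable borel"
    and b: "- real DIM('a) < b" and \<gamma>: "DIM('a) < \<gamma>" and K: "0 \<le> K"
    and in_le: "\<And>x. norm x \<le> 1 \<Longrightarrow> x \<noteq> 0 \<Longrightarrow> u x \<le> K * norm x powr b"
    and out_le: "\<And>x. 1 \<le> norm x \<Longrightarrow> u x \<le> K * norm x powr (- \<gamma>)"
  shows "(\<integral>\<^sup>+x. ennreal (u x) \<partial>lborel) < \<infinity>"
proof -
  have "AE x in lborel. ennreal (u x) \<le> ennreal K * (if norm x \<le> 1 then ennreal (norm x powr b) else 0)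
    + ennreal K * (if 1 \<le> norm x then ennreal (norm x powr (- \<gamma>)) else 0)"
    using AE_lborel_singleton[of "0::'a"]
  proof eventually_elim
    case (elim x)
    show ?case
    proof (cases "norm x \<le> 1")
      case True
      then have "ennreal (u x) \<le> ennreal K * ennreal (norm x powr b)"
        using in_le[of x] elim K by (simp add: ennreal_mult[symmetric] ennreal_leI)
      then show ?thesis
        using True by (simp add: add_increasing2)
    next
      case False
      then show ?thesis
        using out_le[of x] K by (simp add: ennreal_mult[symmetric] ennreal_leI)
    qed
  qed
  then have "(\<integral>\<^sup>+x. ennreal (u x) \<partial>lborel) \<le> (\<integral>\<^sup>+x. ennreal K * (if norm x \<le> 1 then ennreal (norm x powr b) else 0)
    + ennreal K * (if 1 \<le> norm x then ennreal (norm x powr (- \<gamma>)) else 0) \<partial>(lborel::'a measure))"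
    by (rule nn_integral_mono_AE)
  also have "\<dots> = ennreal K * (\<integral>\<^sup>+x. (if norm x \<le> 1 then ennreal (norm x powr b) else 0) \<partial>(lborel::'a measure))
    + ennreal K * (\<integral>\<^sup>+x. (if 1 \<le> norm x then ennreal (norm x powr (- \<gamma>)) else 0) \<partial>(lborel::'a measure))"
    by (subst nn_integral_add) (simp_all add: nn_integral_cmult)
  also have "\<dots> < \<infinity>"
    using nn_integral_norm_powr_inside[OF b] order_le_less_trans[OF nn_integral_norm_powr_outside[OF zero_less_one \<gamma>] ennreal_less_top]
    by (simp add: ennreal_mult_less_top)
  finally show ?thesis .
qed

text \<open>Replacing ln r by r leaves the quadratic M r - \<kappa> r^2 in the exponent, whose
  maximum is M^2 / (4 \<kappa>).\<close>

lemma powr_mult_exp_le: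
  fixes r \<kappa> M :: real
  assumes "0 \<le> r" "0 < \<kappa>" "0 \<le> M"
  shows "r powr M * exp (- \<kappa> * r\<^sup>2) \<le> exp (M\<^sup>2 / (4 * \<kappa>))"
proof (cases "r = 0")
  case False
  then have r: "0 < r"
    using assms by simp
  have "r powr M * exp (- \<kappa> * r\<^sup>2) = exp (M * ln r - \<kappa> * r\<^sup>2)"
    using r by (simp add: powr_def exp_add[symmetric] algebra_simps)
  also have "M * ln r - \<kappa> * r\<^sup>2 \<le> M * r - \<kappa> * r\<^sup>2"
    using ln_le_minus_one[OF r] assms by (intro diff_right_mono mult_left_mono) auto
  also have "M * r - \<kappa> * r\<^sup>2 \<le> M\<^sup>2 / (4 * \<kappa>)"
    using assms zero_le_power2[of "2 * \<kappa> * r - M"]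
    by (simp add: field_simps power2_eq_square)
  finally show ?thesis
    by simp
qed simp

lemma nn_integral_norm_powr_gauss:
  fixes b \<kappa> :: real
  assumes b: "- real DIM('a) < b" and \<kappa>: "0 < \<kappa>"
  shows "(\<integral>\<^sup>+x. ennreal (norm x powr b * exp (- \<kappa> * (norm x)\<^sup>2)) \<partial>(lborel::'a::euclidean_space measure)) < \<infinity>"
proof -
  \<comment> \<open>M is large enough that b - M \<le> -\<gamma> whatever the sign of b; the
    Gaussian pays for the extra power M.\<close>
  define \<gamma> M where "\<gamma> = real DIM('a) + 1" and "M = real DIM('a) + 1 + \<bar>b\<bar>"
  define K where "K = max 1 (exp (M\<^sup>2 / (4 * \<kappa>)))"
  show ?thesis
  proof (rule nn_integral_dominated_radial[where b = b and \<gamma> = \<gamma> and K = K])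
    show "(\<lambda>x::'a. norm x powr b * exp (- \<kappa> * (norm x)\<^sup>2)) \<in> borel_measurable borel"
      by measurable
    show "norm x powr b * exp (- \<kappa> * (norm x)\<^sup>2) \<le> K * norm x powr b" for x :: 'a
    proof -
      have "exp (- \<kappa> * (norm x)\<^sup>2) \<le> 1"
        using \<kappa> by simp
      also have "1 \<le> K"
        by (simp add: K_def)
      finally show ?thesis
        by (subst mult.commute) (intro mult_right_mono, auto)
    qed
    show "norm x powr b * exp (- \<kappa> * (norm x)\<^sup>2) \<le> K * norm x powr (- \<gamma>)" if "1 \<le> norm x" for x :: 'a
    proof -
      have "norm x powr b * exp (- \<kappa> * (norm x)\<^sup>2) = norm x powr (b - M) * (norm x powr M * exp (- \<kappa> * (norm x)\<^sup>2))"
        using that by (simp add: powr_add[symmetric] mult.assoc[symmetric])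
      also have "\<dots> \<le> norm x powr (- \<gamma>) * K"
        using that powr_mult_exp_le[of "norm x" \<kappa> M] \<kappa>
        by (intro mult_mono powr_mono) (auto simp: M_def \<gamma>_def K_def intro: order_trans)
      finally show ?thesis
        by (simp add: mult.commute)
    qed
  qed (use b in \<open>auto simp: \<gamma>_def K_def\<close>)
qed

section \<open>The Fourier transform and Gaussians\<close>

definition chi :: "real \<Rightarrow> complex" where
  "chi t = exp (- 2 * complex_of_real pi * \<i> * complex_of_real t)"

lemma chi_eq_cis: "chi t = cis (- (2 * pi * t))"
  by (simp add: chi_def cis_conv_exp mult_ac)

lemma norm_chi [simp]: "norm (chi t) = 1"
  by (simp add: chi_eq_cis)

lemma chi_add: "chi (s + t) = chi s * chi t"
  by (simp add: chi_def exp_add[symmetric] algebra_simps)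

lemma chi_minus: "chi (- t) = cnj (chi t)"
  by (simp add: chi_eq_cis cis_cnj)

lemma chi_0 [simp]: "chi 0 = 1"
  by (simp add: chi_def)

lemma continuous_on_chi [continuous_intros]: "continuous_on S f \<Longrightarrow> continuous_on S (\<lambda>x. chi (f x))"
  unfolding chi_def by (intro continuous_intros)

lemma borel_measurable_chi [measurable]: "chi \<in> borel_measurable borel"
  by (intro borel_measurable_continuous_onI continuous_intros)

lemma chi_sum: "finite I \<Longrightarrow> chi (\<Sum>i\<in>I. f i) = (\<Prod>i\<in>I. chi (f i))"
  by (induction I rule: finite_induct) (auto simp: chi_add)

text \<open>For Borel functions the transform can be computed on \<open>lborel\<close>, where
  Fubini's theorem and affine substitutions apply. Lebesgue measurable functions return only at the
  end, through a Borel representative.\<close>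

lemma fourier_eq:
  fixes f :: "'a::euclidean_space \<Rightarrow> complex"
  assumes [measurable]: "f \<in> borel_measurable borel"
  shows "fourier f \<xi> = (LINT x|lborel. f x * chi (x \<bullet> \<xi>))"
  unfolding fourier_def chi_def[symmetric] by (intro integral_completion) measurable

lemma integrable_mult_chi:
  fixes f :: "'a::euclidean_space \<Rightarrow> complex"
  assumes f: "integrable lborel f"
  shows "integrable lborel (\<lambda>x. f x * chi (x \<bullet> \<xi>))"
proof (rule Bochner_Integration.integrable_bound[OF f])
  have [measurable]: "f \<in> borel_measurable borel"
    using f by simp
  show "(\<lambda>x. f x * chi (x \<bullet> \<xi>)) \<in> borel_measurable lborel"
    by measurable
qed (simp add: norm_mult)

lemma borel_measurable_fourier [measurable]:
  fixes f :: "'a::euclidean_space \<Rightarrow> complex"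
  assumes [measurable]: "f \<in> borel_measurable borel"
  shows "fourier f \<in> borel_measurable borel"
proof -
  have "(\<lambda>\<xi>. LINT x|lborel. f x * chi (x \<bullet> \<xi>)) \<in> borel_measurable lborel"
    by measurable
  then show ?thesis
    by (simp add: fourier_eq[OF assms, abs_def] cong: measurable_cong)
qed

lemma norm_fourier_le:
  fixes f :: "'a::euclidean_space \<Rightarrow> complex"
  assumes f: "integrable lborel f"
  shows "norm (fourier f \<xi>) \<le> (LINT x|lborel. norm (f x))"
proof -
  have "fourier f \<xi> = (LINT x|lborel. f x * chi (x \<bullet> \<xi>))"
    using f by (intro fourier_eq) auto
  then show ?thesis
    using integral_norm_bound[of lborel "\<lambda>x. f x * chi (x \<bullet> \<xi>)"] by (simp add: norm_mult)
qed

lemma integrable_pair_mult: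
  fixes f :: "'a::euclidean_space \<Rightarrow> complex" and g :: "'b::euclidean_space \<Rightarrow> complex"
    and k :: "'a \<Rightarrow> 'b \<Rightarrow> complex"
  assumes f: "integrable lborel f" and g: "integrable lborel g"
    and k[measurable]: "case_prod k \<in> borel_measurable (borel \<Otimes>\<^sub>M borel)" and k1: "\<And>x y. norm (k x y) \<le> B"
  shows "integrable (lborel \<Otimes>\<^sub>M lborel) (\<lambda>(x, y). f x * g y * k x y)"
proof -
  have [measurable]: "f \<in> borel_measurable borel" "g \<in> borel_measurable borel"
    using f g by auto
  have B: "0 \<le> B"
    using k1 norm_ge_zero order_trans by blast
  have "integrable (lborel \<Otimes>\<^sub>M lborel) (\<lambda>(x, y). f x * g y)"
  proof (rule lborel_pair.Fubini_integrable)
    have "(LINT y|lborel. norm (case (x, y) of (x, y) \<Rightarrow> f x * g y)) = norm (f x) * (LINT y|lborel. norm (g y))" for x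
      by (simp add: norm_mult)
    then show "integrable lborel (\<lambda>x. LINT y|lborel. norm (case (x, y) of (x, y) \<Rightarrow> f x * g y))"
      using f by simp
    show "AE x in lborel. integrable lborel (\<lambda>y. case (x, y) of (x, y) \<Rightarrow> f x * g y)"
      using g by simp
  qed measurable
  then have "integrable (lborel \<Otimes>\<^sub>M lborel) (\<lambda>z. of_real B * (case z of (x, y) \<Rightarrow> f x * g y))"
    by (rule integrable_mult_right)
  then show ?thesis
  proof (rule Bochner_Integration.integrable_bound)
    show "AE z in lborel \<Otimes>\<^sub>M lborel. norm (case z of (x, y) \<Rightarrow> f x * g y * k x y)
        \<le> norm (of_real B * (case z of (x, y) \<Rightarrow> f x * g y))"
    proof (rule AE_I2, clarify)
      fix x :: 'a and y :: 'b
      show "norm (f x * g y * k x y) \<le> norm (of_real B * (f x * g y))"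
        using k1[of x y] B by (simp add: norm_mult mult_left_mono mult.commute[of B])
    qed
  qed measurable
qed

text \<open>Fubini's theorem for a unimodular kernel. With g a modulated Gaussian this becomes a
  regularised inversion formula, and with g a damped conjugate transform a regularised Parseval
  formula.\<close>

lemma fourier_multiplication:
  fixes f g :: "'a::euclidean_space \<Rightarrow> complex"
  assumes f: "integrable lborel f" and g: "integrable lborel g"
  shows "(LINT \<xi>|lborel. fourier f \<xi> * g \<xi>) = (LINT x|lborel. f x * fourier g x)"
proof -
  have [measurable]: "f \<in> borel_measurable borel" "g \<in> borel_measurable borel"
    using f g by auto
  have int: "integrable (lborel \<Otimes>\<^sub>M lborel) (\<lambda>(x, y). f x * g y * chi (x \<bullet> y))"
    by (rule integrable_pair_mult[OF f g, where B = 1]) auto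
  have "fourier f \<xi> * g \<xi> = (LINT x|lborel. f x * g \<xi> * chi (x \<bullet> \<xi>))" for \<xi>
  proof -
    have "(LINT x|lborel. f x * g \<xi> * chi (x \<bullet> \<xi>)) = (LINT x|lborel. g \<xi> * (f x * chi (x \<bullet> \<xi>)))"
      by (simp only: mult_ac)
    also have "\<dots> = g \<xi> * fourier f \<xi>"
      by (subst integral_mult_right_zero) (simp add: fourier_eq)
    finally show ?thesis
      by simp
  qed
  then have "(LINT \<xi>|lborel. fourier f \<xi> * g \<xi>) = (LINT \<xi>|lborel. (LINT x|lborel. f x * g \<xi> * chi (x \<bullet> \<xi>)))"
    by simp
  also have "\<dots> = (LINT x|lborel. (LINT \<xi>|lborel. f x * g \<xi> * chi (x \<bullet> \<xi>)))"
    by (rule lborel_pair.Fubini_integral[OF int])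
  also have "\<dots> = (LINT x|lborel. f x * fourier g x)"
  proof (rule Bochner_Integration.integral_cong[OF refl])
    show "(LINT \<xi>|lborel. f x * g \<xi> * chi (x \<bullet> \<xi>)) = f x * fourier g x" for x
      unfolding mult.assoc by (subst integral_mult_right_zero) (simp add: fourier_eq inner_commute)
  qed
  finally show ?thesis .
qed

lemma lborel_prod_integral:
  fixes f :: "'a::euclidean_space \<Rightarrow> real \<Rightarrow> complex"
  assumes int: "\<And>b. b \<in> Basis \<Longrightarrow> integrable lborel (f b)"
  shows "integrable lborel (\<lambda>x::'a. \<Prod>b\<in>Basis. f b (x \<bullet> b))"
    and "(LINT x|lborel. (\<Prod>b\<in>Basis. f b (x \<bullet> b))) = (\<Prod>b\<in>Basis. LINT t|lborel. f b t)"
proof -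
  interpret product_sigma_finite "\<lambda>_::'a. lborel :: real measure" ..
  have [measurable]: "\<And>b. b \<in> Basis \<Longrightarrow> f b \<in> borel_measurable borel"
    using int by auto
  have *: "(\<Prod>b\<in>Basis. f b ((\<Sum>b\<in>Basis. y b *\<^sub>R b) \<bullet> b)) = (\<Prod>b\<in>Basis. f b (y b))" for y :: "'a \<Rightarrow> real"
    by (intro prod.cong) auto
  show "integrable lborel (\<lambda>x::'a. \<Prod>b\<in>Basis. f b (x \<bullet> b))"
    by (subst lborel_eq, subst integrable_distr_eq) (simp_all add: * product_integrable_prod int)
  show "(LINT x|lborel. (\<Prod>b\<in>Basis. f b (x \<bullet> b))) = (\<Prod>b\<in>Basis. LINT t|lborel. f b t)"
    by (subst lborel_eq, subst integral_distr) (simp_all add: * product_integral_prod int)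
qed

definition gauss :: "real \<Rightarrow> 'a::euclidean_space \<Rightarrow> complex" where
  "gauss a x = complex_of_real (exp (- pi * a * (norm x)\<^sup>2))"

lemma borel_measurable_gauss [measurable]: "gauss a \<in> borel_measurable borel"
  unfolding gauss_def by measurable

lemma norm_gauss: "norm (gauss a x) = exp (- pi * a * (norm x)\<^sup>2)"
  by (simp add: gauss_def)

text \<open>The substitution x = c y with 2 \<pi> a c^2 = 1 turns the Gaussian into a multiple of
  the standard normal density, whose characteristic function is known.\<close>

lemma gauss_real_integral:
  fixes a t :: real
  assumes a: "0 < a"
  shows "integrable lborel (\<lambda>x::real. gauss a x)"
    and "(LINT x|lborel. gauss a x * chi (x * t)) = complex_of_real (a powr (- 1 / 2)) * gauss (1 / a) t"
proof -
  define c where "c = 1 / sqrt (2 * pi * a)"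
  have c: "0 < c" "c \<noteq> 0" "2 * pi * a * c\<^sup>2 = 1"
    using a by (auto simp: c_def power_divide)
  have g: "gauss a (0 + c * y) = complex_of_real (sqrt (2 * pi)) * complex_of_real (std_normal_density y)" for y :: real
  proof -
    have "pi * a * (c * y)\<^sup>2 = (2 * pi * a * c\<^sup>2) * y\<^sup>2 / 2"
      by (simp add: power_mult_distrib)
    then show ?thesis
      unfolding c(3) by (simp add: gauss_def std_normal_density_def mult.assoc)
  qed
  have sn: "integrable lborel std_normal_density"
    by (rule integrable_normal_density) simp
  show "integrable lborel (\<lambda>x::real. gauss a x)"
    using c sn by (subst lborel_integrable_real_affine_iff[of c _ 0, symmetric]) (simp_all add: g[simplified])
  have "(LINT x|lborel. gauss a x * chi (x * t)) =
      c *\<^sub>R (LINT y|lborel. gauss a (0 + c * y) * chi ((0 + c * y) * t))"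
    using c by (subst lborel_integral_real_affine[of c _ 0]) auto
  also have "\<dots> = c *\<^sub>R (LINT y|lborel. complex_of_real (sqrt (2 * pi)) * (std_normal_density y *\<^sub>R iexp ((- (2 * pi * c * t)) * y)))"
  proof -
    have "chi ((0 + c * y) * t) = iexp ((- (2 * pi * c * t)) * y)" for y
      by (simp add: chi_def mult_ac)
    then show ?thesis
      unfolding g by (simp add: scaleR_conv_of_real mult.assoc)
  qed
  also have "\<dots> = c *\<^sub>R (complex_of_real (sqrt (2 * pi)) * char std_normal_distribution (- (2 * pi * c * t)))"
    unfolding char_def integral_mult_right_zero
    by (subst integral_density) (auto simp: normal_density_nonneg)
  also have "\<dots> = complex_of_real (c * sqrt (2 * pi) * exp (- (2 * pi * c * t)\<^sup>2 / 2))"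
    by (simp add: char_std_normal_distribution scaleR_conv_of_real)
  also have "c * sqrt (2 * pi) = a powr (- 1 / 2)"
    using a by (simp add: c_def real_sqrt_mult powr_minus_divide powr_half_sqrt)
  also have "- (2 * pi * c * t)\<^sup>2 / 2 = - pi * t\<^sup>2 / a"
  proof -
    have "(2 * pi * c * t)\<^sup>2 / 2 = (2 * pi * a * c\<^sup>2) * pi * t\<^sup>2 / a"
      using a by (simp add: power_mult_distrib power2_eq_square)
    then show ?thesis
      unfolding c(3) by simp
  qed
  finally show "(LINT x|lborel. gauss a x * chi (x * t)) = complex_of_real (a powr (- 1 / 2)) * gauss (1 / a) t"
    by (simp add: gauss_def)
qed

lemma gauss_prod: "gauss a x = (\<Prod>b\<in>Basis. gauss a (x \<bullet> b))"
proof -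
  have "(norm x)\<^sup>2 = (\<Sum>b\<in>Basis. (norm (x \<bullet> b))\<^sup>2)"
    unfolding power2_norm_eq_inner euclidean_inner[of x x] by (simp add: power2_eq_square)
  then have "exp (- pi * a * (norm x)\<^sup>2) = (\<Prod>b\<in>Basis. exp (- pi * a * (norm (x \<bullet> b))\<^sup>2))"
    by (simp only: sum_distrib_left exp_sum finite_Basis)
  then show ?thesis
    by (simp only: gauss_def of_real_prod)
qed

lemma integrable_gauss:
  assumes "0 < a"
  shows "integrable lborel (gauss a :: 'a::euclidean_space \<Rightarrow> complex)"
  by (subst gauss_prod[abs_def]) (intro lborel_prod_integral gauss_real_integral assms)

lemma fourier_gauss:
  fixes \<xi> :: "'a::euclidean_space"
  assumes a: "0 < a"
  shows "fourier (gauss a) \<xi> = complex_of_real (a powr (- real DIM('a) / 2)) * gauss (1 / a) \<xi>"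
proof -
  have "fourier (gauss a) \<xi> = (LINT x|lborel. gauss a x * chi (x \<bullet> \<xi>))"
    by (rule fourier_eq) measurable
  also have "\<dots> = (LINT x|lborel. (\<Prod>b\<in>Basis. gauss a (x \<bullet> b) * chi ((x \<bullet> b) * (\<xi> \<bullet> b))))"
    by (rule Bochner_Integration.integral_cong[OF refl])
      (simp only: prod.distrib chi_sum[symmetric] finite_Basis gauss_prod[symmetric] euclidean_inner[symmetric])
  also have "\<dots> = (\<Prod>b\<in>(Basis::'a set). LINT t|lborel. gauss a t * chi (t * (\<xi> \<bullet> b)))"
    using integrable_mult_chi[OF gauss_real_integral(1)[OF a]]
    by (intro lborel_prod_integral(2)) (simp add: inner_real_def)
  also have "\<dots> = (\<Prod>b\<in>(Basis::'a set). complex_of_real (a powr (- 1 / 2)) * gauss (1 / a) (\<xi> \<bullet> b))"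
    by (intro prod.cong refl gauss_real_integral a)
  also have "\<dots> = complex_of_real (a powr (- 1 / 2)) ^ DIM('a) * gauss (1 / a) \<xi>"
    by (simp add: prod.distrib gauss_prod[of "1 / a" \<xi>])
  also have "complex_of_real (a powr (- 1 / 2)) ^ DIM('a) = complex_of_real (a powr (- real DIM('a) / 2))"
    using a by (simp add: powr_powr flip: of_real_power powr_realpow)
  finally show ?thesis .
qed

section \<open>Bessel's inequality\<close>

lemma ennreal_norm_integral_le:
  fixes f :: "'a \<Rightarrow> complex"
  shows "ennreal (norm (integral\<^sup>L M f)) \<le> (\<integral>\<^sup>+x. ennreal (norm (f x)) \<partial>M)"
  by (cases "integrable M f") (auto simp: integral_norm_bound_ennreal not_integrable_integral_eq)

lemma integral_cnj_complex:
  fixes f :: "'a \<Rightarrow> complex"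
  shows "(LINT x|M. cnj (f x)) = cnj (LINT x|M. f x)"
  by (cases "integrable M f") (auto simp: not_integrable_integral_eq)

lemma nn_integral_lborel_affine:
  fixes f :: "'a::euclidean_space \<Rightarrow> ennreal"
  assumes [measurable]: "f \<in> borel_measurable borel" and c: "c \<noteq> 0"
  shows "(\<integral>\<^sup>+x. f x \<partial>lborel) = ennreal (\<bar>c\<bar> ^ DIM('a)) * (\<integral>\<^sup>+x. f (t + c *\<^sub>R x) \<partial>lborel)"
  by (subst lborel_affine[OF c, of t]) (simp add: nn_integral_density nn_integral_distr nn_integral_cmult)

lemma nn_integral_lborel_minus:
  fixes f :: "'a::euclidean_space \<Rightarrow> ennreal"
  assumes [measurable]: "f \<in> borel_measurable borel"
  shows "(\<integral>\<^sup>+x. f (x - y) \<partial>lborel) = (\<integral>\<^sup>+x. f x \<partial>lborel)"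
    and "(\<integral>\<^sup>+x. f (y - x) \<partial>lborel) = (\<integral>\<^sup>+x. f x \<partial>lborel)"
  using nn_integral_lborel_affine[of f 1 "- y"] nn_integral_lborel_affine[of f "- 1" y] by simp_all

lemma integral_lborel_affine:
  fixes f :: "'a::euclidean_space \<Rightarrow> complex"
  assumes [measurable]: "f \<in> borel_measurable borel" and c: "c \<noteq> 0"
  shows "(LINT x|lborel. f x) = of_real (\<bar>c\<bar> ^ DIM('a)) * (LINT x|lborel. f (t + c *\<^sub>R x))"
  by (subst lborel_affine[OF c, of t]) (simp add: integral_density integral_distr scaleR_conv_of_real)

lemma integrable_lborel_affine:
  fixes f :: "'a::euclidean_space \<Rightarrow> complex"
  assumes f: "integrable lborel f" and c: "c \<noteq> 0"
  shows "integrable lborel (\<lambda>x. f (t + c *\<^sub>R x))"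
proof (rule integrableI_bounded)
  have [measurable]: "f \<in> borel_measurable borel"
    using f by simp
  show "(\<lambda>x. f (t + c *\<^sub>R x)) \<in> borel_measurable lborel"
    by measurable
  have "ennreal (\<bar>c\<bar> ^ DIM('a)) * (\<integral>\<^sup>+x. norm (f (t + c *\<^sub>R x)) \<partial>lborel) < \<infinity>"
    using f c by (subst nn_integral_lborel_affine[symmetric]) (auto simp: integrable_iff_bounded)
  then show "(\<integral>\<^sup>+x. norm (f (t + c *\<^sub>R x)) \<partial>lborel) < \<infinity>"
    using c by (auto simp: ennreal_mult_less_top)
qed

text \<open>The Gaussian of mass 1 and width of order sqrt \<epsilon>. It is the transform of
  \<open>gauss \<epsilon>\<close>, so that damping the transform by \<open>gauss \<epsilon>\<close>
  means convolving the function with this kernel.\<close>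

definition heat :: "real \<Rightarrow> 'a::euclidean_space \<Rightarrow> complex" where
  "heat \<epsilon> x = complex_of_real (\<epsilon> powr (- real DIM('a) / 2)) * gauss (1 / \<epsilon>) x"

lemma borel_measurable_heat [measurable]: "heat \<epsilon> \<in> borel_measurable borel"
  unfolding heat_def by measurable

lemma fourier_gauss_heat: "0 < \<epsilon> \<Longrightarrow> fourier (gauss \<epsilon>) = heat \<epsilon>"
  by (rule ext) (simp add: fourier_gauss heat_def)

lemma cnj_heat [simp]: "cnj (heat \<epsilon> x) = heat \<epsilon> x"
  by (simp add: heat_def gauss_def)

lemma heat_minus: "heat \<epsilon> (x - y) = heat \<epsilon> (y - x)"
  by (simp add: heat_def gauss_def norm_minus_commute)

lemma integrable_heat: "0 < \<epsilon> \<Longrightarrow> integrable lborel (heat \<epsilon>)"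
  unfolding heat_def by (intro integrable_mult_right integrable_gauss) auto

lemma norm_heat: "heat \<epsilon> x = complex_of_real (norm (heat \<epsilon> x))"
  by (simp add: heat_def gauss_def norm_mult)

lemma norm_heat_le: "norm (heat \<epsilon> (x::'a::euclidean_space)) \<le> \<epsilon> powr (- real DIM('a) / 2)" if "0 < \<epsilon>"
  using that by (simp add: heat_def norm_mult norm_gauss mult_left_le)

lemma integral_heat:
  assumes "0 < \<epsilon>"
  shows "(LINT x|lborel. heat \<epsilon> (x::'a::euclidean_space)) = 1"
proof -
  have "(LINT x|lborel. gauss (1 / \<epsilon>) (x::'a)) = fourier (gauss (1 / \<epsilon>)) (0::'a)"
    by (subst fourier_eq) auto
  also have "\<dots> = complex_of_real ((1 / \<epsilon>) powr (- real DIM('a) / 2))"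
    using assms by (simp add: fourier_gauss gauss_def)
  finally show ?thesis
    using assms by (simp add: heat_def powr_divide powr_minus_divide flip: of_real_mult)
qed

lemma nn_integral_heat:
  assumes "0 < \<epsilon>"
  shows "(\<integral>\<^sup>+x. ennreal (norm (heat \<epsilon> x)) \<partial>(lborel :: 'a::euclidean_space measure)) = 1"
proof -
  have "complex_of_real (LINT x|lborel. norm (heat \<epsilon> (x::'a))) = 1"
    using integral_heat[OF assms] by (subst (asm) norm_heat) (simp only: integral_complex_of_real)
  then have "(LINT x|lborel. norm (heat \<epsilon> (x::'a))) = 1"
    by (simp only: of_real_eq_1_iff)
  then show ?thesis
    using assms integrable_heat[of \<epsilon>] by (subst nn_integral_eq_integral) auto
qed

lemma integrable_heat_shift: "0 < \<epsilon> \<Longrightarrow> integrable lborel (\<lambda>y. heat \<epsilon> (x - y))"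
  using integrable_lborel_affine[OF integrable_heat, of \<epsilon> "- 1" x] by simp

lemma integrable_fourier_mult:
  fixes f g :: "'a::euclidean_space \<Rightarrow> complex"
  assumes f: "integrable lborel f" and g: "integrable lborel g"
  shows "integrable lborel (\<lambda>\<xi>. fourier f \<xi> * g \<xi>)"
proof (rule Bochner_Integration.integrable_bound)
  have [measurable]: "f \<in> borel_measurable borel" "g \<in> borel_measurable borel"
    using f g by auto
  show "integrable lborel (\<lambda>\<xi>. of_real (LINT x|lborel. norm (f x)) * g \<xi>)"
    using g by simp
  show "(\<lambda>\<xi>. fourier f \<xi> * g \<xi>) \<in> borel_measurable lborel"
    by measurable
  show "AE \<xi> in lborel. norm (fourier f \<xi> * g \<xi>) \<le> norm (of_real (LINT x|lborel. norm (f x)) * g \<xi>)"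
    using norm_fourier_le[OF f] by (auto simp: norm_mult intro!: mult_right_mono)
qed

text \<open>The damping makes the inverse integral converge. It is the multiplication formula for a
  modulated Gaussian, whose transform is the heat kernel centred at x.\<close>

lemma fourier_gauss_inversion:
  fixes f :: "'a::euclidean_space \<Rightarrow> complex"
  assumes f: "integrable lborel f" and \<epsilon>: "0 < \<epsilon>"
  shows "(LINT \<xi>|lborel. fourier f \<xi> * gauss \<epsilon> \<xi> * chi (- (\<xi> \<bullet> x))) = (LINT y|lborel. f y * heat \<epsilon> (x - y))"
proof -
  define g where "g \<xi> = gauss \<epsilon> \<xi> * chi (\<xi> \<bullet> (- x))" for \<xi> :: 'a
  have g: "integrable lborel g"
    unfolding g_def using integrable_gauss[OF \<epsilon>] by (rule integrable_mult_chi)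
  have "fourier g y = heat \<epsilon> (x - y)" for y
  proof -
    have "fourier g y = (LINT \<xi>|lborel. gauss \<epsilon> \<xi> * chi (\<xi> \<bullet> (y - x)))"
      unfolding g_def by (subst fourier_eq) (simp_all add: inner_diff_right chi_add[symmetric] mult.assoc add.commute)
    also have "\<dots> = heat \<epsilon> (x - y)"
      using \<epsilon> heat_minus[of \<epsilon> x y] by (simp add: fourier_gauss_heat flip: fourier_eq)
    finally show ?thesis .
  qed
  then show ?thesis
    using fourier_multiplication[OF f g] by (simp add: g_def mult.assoc)
qed

text \<open>The multiplication formula applied to the damped conjugate transform of h, whose own
  transform is a mollification of the conjugate of h. The mollification tends to h itself for
  bounded continuous h, which is how Parseval's formula enters the duality argument.\<close>

lemma fourier_parseval_gauss:
  fixes f h :: "'a::euclidean_space \<Rightarrow> complex"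
  assumes f: "integrable lborel f" and h: "integrable lborel h" and \<epsilon>: "0 < \<epsilon>"
  shows "(LINT \<xi>|lborel. fourier f \<xi> * (cnj (fourier h \<xi>) * gauss \<epsilon> \<xi>))
    = (LINT x|lborel. f x * cnj (LINT y|lborel. h y * heat \<epsilon> (x - y)))"
proof -
  define g where "g \<xi> = cnj (fourier h \<xi>) * gauss \<epsilon> \<xi>" for \<xi>
  have [measurable]: "h \<in> borel_measurable borel"
    using h by simp
  have "integrable lborel (\<lambda>\<xi>. cnj (fourier h \<xi> * gauss \<epsilon> \<xi>))"
    using integrable_fourier_mult[OF h integrable_gauss[OF \<epsilon>]] by (simp only: integrable_cnj)
  then have g: "integrable lborel g"
    by (simp add: g_def[abs_def] gauss_def)
  have "fourier g x = cnj (LINT y|lborel. h y * heat \<epsilon> (x - y))" for x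
  proof -
    have "fourier g x = (LINT \<xi>|lborel. cnj (fourier h \<xi> * gauss \<epsilon> \<xi> * chi (- (\<xi> \<bullet> x))))"
      using g by (subst fourier_eq) (auto simp: g_def gauss_def chi_minus)
    then show ?thesis
      by (simp only: integral_cnj_complex fourier_gauss_inversion[OF h \<epsilon>])
  qed
  then show ?thesis
    using fourier_multiplication[OF f g] by (simp add: g_def)
qed

text \<open>Regularised Parseval with f = h turns the damped integral into a quadratic form with
  kernel \<open>heat \<epsilon> (x - y)\<close>. The inequality 2 |h x| |h y| \<le> |h x|^2 + |h
  y|^2 and the unit mass of the kernel bound it uniformly in \<epsilon>, and Fatou's lemma removes
  the damping.\<close>

lemma bessel:
  fixes h :: "'a::euclidean_space \<Rightarrow> complex"
  assumes h: "integrable lborel h"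
  shows "(\<integral>\<^sup>+\<xi>. ennreal ((norm (fourier h \<xi>))\<^sup>2) \<partial>lborel) \<le> (\<integral>\<^sup>+x. ennreal ((norm (h x))\<^sup>2) \<partial>lborel)"
proof -
  have [measurable]: "h \<in> borel_measurable borel"
    using h by simp
  let ?F = "\<lambda>\<epsilon> \<xi>. (norm (fourier h \<xi>))\<^sup>2 * exp (- pi * \<epsilon> * (norm \<xi>)\<^sup>2)"
  have bound: "(\<integral>\<^sup>+\<xi>. ennreal (?F \<epsilon> \<xi>) \<partial>lborel) \<le> (\<integral>\<^sup>+x. ennreal ((norm (h x))\<^sup>2) \<partial>lborel)" if \<epsilon>: "0 < \<epsilon>" for \<epsilon>
  proof -
    have eq: "complex_of_real (?F \<epsilon> \<xi>) = fourier h \<xi> * (cnj (fourier h \<xi>) * gauss \<epsilon> \<xi>)" for \<xi>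
      by (simp only: of_real_mult complex_norm_square gauss_def mult.assoc)
    have "integrable lborel (\<lambda>\<xi>. cnj (fourier h \<xi> * gauss \<epsilon> \<xi>))"
      using integrable_fourier_mult[OF h integrable_gauss[OF \<epsilon>]] by (simp only: integrable_cnj)
    then have "integrable lborel (\<lambda>\<xi>. cnj (fourier h \<xi>) * gauss \<epsilon> \<xi>)"
      by (simp add: gauss_def)
    from integrable_fourier_mult[OF h this]
    have int: "integrable lborel (?F \<epsilon>)"
      unfolding eq[symmetric] by (simp only: complex_of_real_integrable_eq)
    have "(\<integral>\<^sup>+\<xi>. ennreal (?F \<epsilon> \<xi>) \<partial>lborel) = ennreal (LINT \<xi>|lborel. ?F \<epsilon> \<xi>)"
      using int by (intro nn_integral_eq_integral) auto
    also have "(LINT \<xi>|lborel. ?F \<epsilon> \<xi>) = norm (LINT \<xi>|lborel. fourier h \<xi> * (cnj (fourier h \<xi>) * gauss \<epsilon> \<xi>))"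
      unfolding eq[symmetric] integral_complex_of_real norm_of_real
      by (intro abs_of_nonneg[symmetric] Bochner_Integration.integral_nonneg) auto
    also have "\<dots> = norm (LINT x|lborel. h x * cnj (LINT y|lborel. h y * heat \<epsilon> (x - y)))"
      by (subst fourier_parseval_gauss[OF h h \<epsilon>]) simp
    also have "ennreal \<dots> \<le> (\<integral>\<^sup>+x. ennreal (norm (h x * cnj (LINT y|lborel. h y * heat \<epsilon> (x - y)))) \<partial>lborel)"
      by (rule ennreal_norm_integral_le)
    also have "\<dots> \<le> (\<integral>\<^sup>+x. (\<integral>\<^sup>+y. ennreal (norm (h x) * norm (h y) * norm (heat \<epsilon> (x - y))) \<partial>lborel) \<partial>lborel)"
    proof (rule nn_integral_mono)
      fix x
      have "ennreal (norm (h x * cnj (LINT y|lborel. h y * heat \<epsilon> (x - y))))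
          = ennreal (norm (h x)) * ennreal (norm (LINT y|lborel. h y * heat \<epsilon> (x - y)))"
        by (simp add: norm_mult ennreal_mult)
      also have "\<dots> \<le> ennreal (norm (h x)) * (\<integral>\<^sup>+y. ennreal (norm (h y * heat \<epsilon> (x - y))) \<partial>lborel)"
        by (intro mult_left_mono ennreal_norm_integral_le) auto
      also have "\<dots> = (\<integral>\<^sup>+y. ennreal (norm (h x) * norm (h y) * norm (heat \<epsilon> (x - y))) \<partial>lborel)"
        by (subst nn_integral_cmult[symmetric]) (auto simp: norm_mult ennreal_mult mult.assoc)
      finally show "ennreal (norm (h x * cnj (LINT y|lborel. h y * heat \<epsilon> (x - y))))
        \<le> (\<integral>\<^sup>+y. ennreal (norm (h x) * norm (h y) * norm (heat \<epsilon> (x - y))) \<partial>lborel)" .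
    qed
    also have "\<dots> \<le> (\<integral>\<^sup>+x. (\<integral>\<^sup>+y. ennreal ((norm (h x))\<^sup>2 / 2) * ennreal (norm (heat \<epsilon> (x - y)))
        + ennreal ((norm (h y))\<^sup>2 / 2) * ennreal (norm (heat \<epsilon> (x - y))) \<partial>lborel) \<partial>lborel)"
    proof (intro nn_integral_mono)
      fix x y
      have "norm (h x) * norm (h y) \<le> (norm (h x))\<^sup>2 / 2 + (norm (h y))\<^sup>2 / 2"
        using sum_squares_bound[of "norm (h x)" "norm (h y)"] by simp
      then have "norm (h x) * norm (h y) * norm (heat \<epsilon> (x - y)) \<le>
          ((norm (h x))\<^sup>2 / 2 + (norm (h y))\<^sup>2 / 2) * norm (heat \<epsilon> (x - y))"
        by (rule mult_right_mono) simp
      then show "ennreal (norm (h x) * norm (h y) * norm (heat \<epsilon> (x - y)))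
          \<le> ennreal ((norm (h x))\<^sup>2 / 2) * ennreal (norm (heat \<epsilon> (x - y)))
        + ennreal ((norm (h y))\<^sup>2 / 2) * ennreal (norm (heat \<epsilon> (x - y)))"
        by (simp add: ennreal_mult[symmetric] ennreal_plus[symmetric] distrib_right ennreal_leI del: ennreal_plus)
    qed
    also have "\<dots> = (\<integral>\<^sup>+x. (\<integral>\<^sup>+y. ennreal ((norm (h x))\<^sup>2 / 2) * ennreal (norm (heat \<epsilon> (x - y))) \<partial>lborel) \<partial>lborel)
        + (\<integral>\<^sup>+x. (\<integral>\<^sup>+y. ennreal ((norm (h y))\<^sup>2 / 2) * ennreal (norm (heat \<epsilon> (x - y))) \<partial>lborel) \<partial>lborel)"
      by (simp add: nn_integral_add)
    also have "(\<integral>\<^sup>+x. (\<integral>\<^sup>+y. ennreal ((norm (h y))\<^sup>2 / 2) * ennreal (norm (heat \<epsilon> (x - y))) \<partial>lborel) \<partial>lborel)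
        = (\<integral>\<^sup>+y. (\<integral>\<^sup>+x. ennreal ((norm (h y))\<^sup>2 / 2) * ennreal (norm (heat \<epsilon> (x - y))) \<partial>lborel) \<partial>lborel)"
      by (rule lborel_pair.Fubini') measurable
    also have "\<dots> = (\<integral>\<^sup>+x. ennreal ((norm (h x))\<^sup>2 / 2) \<partial>lborel)"
      using \<epsilon> by (simp add: nn_integral_cmult nn_integral_lborel_minus(1)[of "\<lambda>x. ennreal (norm (heat \<epsilon> x))"] nn_integral_heat)
    also have "(\<integral>\<^sup>+x. (\<integral>\<^sup>+y. ennreal ((norm (h x))\<^sup>2 / 2) * ennreal (norm (heat \<epsilon> (x - y))) \<partial>lborel) \<partial>lborel)
        = (\<integral>\<^sup>+x. ennreal ((norm (h x))\<^sup>2 / 2) \<partial>lborel)"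
      using \<epsilon> by (simp add: nn_integral_cmult nn_integral_lborel_minus(2)[of "\<lambda>x. ennreal (norm (heat \<epsilon> x))"] nn_integral_heat)
    also have "(\<integral>\<^sup>+x. ennreal ((norm (h x))\<^sup>2 / 2) \<partial>lborel) + (\<integral>\<^sup>+x. ennreal ((norm (h x))\<^sup>2 / 2) \<partial>lborel)
        = (\<integral>\<^sup>+x. ennreal ((norm (h x))\<^sup>2) \<partial>lborel)"
      by (subst nn_integral_add[symmetric]) (auto simp flip: ennreal_plus)
    finally show ?thesis .
  qed
  have lim: "(\<lambda>n. ennreal (?F (1 / real (Suc n)) \<xi>)) \<longlonglongrightarrow> ennreal ((norm (fourier h \<xi>))\<^sup>2)" for \<xi>
  proof (intro tendsto_ennrealI)
    have "(\<lambda>n. 1 / real (Suc n)) \<longlonglongrightarrow> 0"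
      using LIMSEQ_inverse_real_of_nat by (simp add: inverse_eq_divide)
    then have "(\<lambda>n. ?F (1 / real (Suc n)) \<xi>) \<longlonglongrightarrow> ?F 0 \<xi>"
      by (intro tendsto_intros)
    then show "(\<lambda>n. ?F (1 / real (Suc n)) \<xi>) \<longlonglongrightarrow> (norm (fourier h \<xi>))\<^sup>2"
      by simp
  qed
  have "(\<integral>\<^sup>+\<xi>. ennreal ((norm (fourier h \<xi>))\<^sup>2) \<partial>lborel) = (\<integral>\<^sup>+\<xi>. liminf (\<lambda>n. ennreal (?F (1 / real (Suc n)) \<xi>)) \<partial>lborel)"
    by (intro nn_integral_cong lim_imp_Liminf[OF sequentially_bot lim, symmetric])
  also have "\<dots> \<le> liminf (\<lambda>n. \<integral>\<^sup>+\<xi>. ennreal (?F (1 / real (Suc n)) \<xi>) \<partial>lborel)"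
    by (intro nn_integral_liminf) measurable
  also have "\<dots> \<le> liminf (\<lambda>n::nat. \<integral>\<^sup>+x. ennreal ((norm (h x))\<^sup>2) \<partial>lborel)"
    by (intro Liminf_mono always_eventually allI bound) auto
  also have "\<dots> = (\<integral>\<^sup>+x. ennreal ((norm (h x))\<^sup>2) \<partial>lborel)"
    by (simp add: Liminf_const)
  finally show ?thesis .
qed

section \<open>Interpolation between \<open>L\<^sup>1\<close> and \<open>L\<^sup>2\<close>\<close>

text \<open>The level is 2 * \<tau> so that, when a transform is split into two parts, one of them
  must reach \<tau>. The factor \<open>2 powr v\<close> compensates.\<close>

lemma layer_cake:
  fixes T v :: real
  assumes "0 < v" "0 \<le> T"
  shows "ennreal (T powr v) = (\<integral>\<^sup>+\<tau>. (if 0 \<le> \<tau> \<and> 2 * \<tau> \<le> T then ennreal (v * 2 powr v * \<tau> powr (v - 1)) else 0) \<partial>lborel)"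
proof -
  have "(\<integral>\<^sup>+\<tau>. (if 0 \<le> \<tau> \<and> 2 * \<tau> \<le> T then ennreal (v * 2 powr v * \<tau> powr (v - 1)) else 0) \<partial>lborel)
    = (\<integral>\<^sup>+\<tau>. ennreal (v * 2 powr v) * (if 0 \<le> \<tau> \<and> \<tau> \<le> T / 2 then ennreal (\<tau> powr (v - 1)) else 0) \<partial>lborel)"
    using assms by (intro nn_integral_cong) (auto simp: ennreal_mult[symmetric])
  also have "\<dots> = ennreal (v * 2 powr v) * ennreal ((T / 2) powr v / v)"
    using assms nn_integral_powr_head[of v "T / 2"] by (subst nn_integral_cmult) auto
  also have "\<dots> = ennreal (T powr v)"
    using assms by (simp add: ennreal_mult[symmetric] powr_divide)
  finally show ?thesis by simp
qed

lemma layer_cake_nn_integral: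
  fixes S :: "'a::euclidean_space \<Rightarrow> real" and w :: "'a \<Rightarrow> ennreal"
  assumes [measurable]: "S \<in> borel_measurable borel" "w \<in> borel_measurable borel"
    and v: "0 < v" and S: "\<And>\<xi>. 0 \<le> S \<xi>"
  shows "(\<integral>\<^sup>+\<xi>. ennreal (S \<xi> powr v) * w \<xi> \<partial>lborel) =
    (\<integral>\<^sup>+\<tau>. (if 0 < \<tau> then ennreal (v * 2 powr v * \<tau> powr (v - 1)) *
      (\<integral>\<^sup>+\<xi>. (if 2 * \<tau> \<le> S \<xi> then w \<xi> else 0) \<partial>lborel) else 0) \<partial>lborel)"
proof -
  define c where "c \<tau> = ennreal (v * 2 powr v * \<tau> powr (v - 1))" for \<tau>
  have [measurable]: "c \<in> borel_measurable borel"
    unfolding c_def by measurable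
  define H where "H \<xi> \<tau> = (if 0 \<le> \<tau> \<and> 2 * \<tau> \<le> S \<xi> then c \<tau> * w \<xi> else 0)" for \<xi> \<tau>
  have [measurable]: "case_prod H \<in> borel_measurable (borel \<Otimes>\<^sub>M borel)"
    unfolding H_def by measurable
  have "(\<integral>\<^sup>+\<xi>. ennreal (S \<xi> powr v) * w \<xi> \<partial>lborel) = (\<integral>\<^sup>+\<xi>. (\<integral>\<^sup>+\<tau>. H \<xi> \<tau> \<partial>lborel) \<partial>lborel)"
  proof (intro nn_integral_cong)
    fix \<xi>
    have "ennreal (S \<xi> powr v) * w \<xi> = (\<integral>\<^sup>+\<tau>. (if 0 \<le> \<tau> \<and> 2 * \<tau> \<le> S \<xi> then c \<tau> else 0) \<partial>lborel) * w \<xi>"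
      unfolding c_def by (subst layer_cake[OF v S]) simp
    also have "\<dots> = (\<integral>\<^sup>+\<tau>. H \<xi> \<tau> \<partial>lborel)"
      by (subst nn_integral_multc[symmetric]) (auto simp: H_def intro!: nn_integral_cong)
    finally show "ennreal (S \<xi> powr v) * w \<xi> = (\<integral>\<^sup>+\<tau>. H \<xi> \<tau> \<partial>lborel)" .
  qed
  also have "\<dots> = (\<integral>\<^sup>+\<tau>. (\<integral>\<^sup>+\<xi>. H \<xi> \<tau> \<partial>lborel) \<partial>lborel)"
    by (rule lborel_pair.Fubini'[symmetric]) simp
  also have "\<dots> = (\<integral>\<^sup>+\<tau>. (if 0 < \<tau> then c \<tau> *
      (\<integral>\<^sup>+\<xi>. (if 2 * \<tau> \<le> S \<xi> then w \<xi> else 0) \<partial>lborel) else 0) \<partial>lborel)"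
  proof (intro nn_integral_cong)
    fix \<tau> :: real
    show "(\<integral>\<^sup>+\<xi>. H \<xi> \<tau> \<partial>lborel) = (if 0 < \<tau> then c \<tau> *
      (\<integral>\<^sup>+\<xi>. (if 2 * \<tau> \<le> S \<xi> then w \<xi> else 0) \<partial>lborel) else 0)"
    proof (cases "0 < \<tau>")
      case True
      then have "(\<integral>\<^sup>+\<xi>. H \<xi> \<tau> \<partial>lborel) = (\<integral>\<^sup>+\<xi>. c \<tau> * (if 2 * \<tau> \<le> S \<xi> then w \<xi> else 0) \<partial>lborel)"
        by (intro nn_integral_cong) (auto simp: H_def)
      then show ?thesis
        using True by (simp add: nn_integral_cmult)
    next
      case False
      then have "H \<xi> \<tau> = 0" for \<xi>
        by (cases "\<tau> = 0") (auto simp: H_def c_def)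
      then show ?thesis
        using False by simp
    qed
  qed
  finally show ?thesis
    by (simp only: c_def)
qed

text \<open>Chebyshev's inequality for the measure \<rho>^(-2) d\<xi>: the weight cancels in the
  second moment, which Bessel's inequality controls. It is used with \<rho> = 1 for Hausdorff--Young
  and with \<rho> = |\<xi>|^d for Paley.\<close>

lemma fourier_weak_type_22:
  fixes g :: "'a::euclidean_space \<Rightarrow> complex" and \<rho> :: "'a \<Rightarrow> real"
  assumes g: "integrable lborel g" and [measurable]: "\<rho> \<in> borel_measurable borel"
    and \<rho>: "\<And>\<xi>. 0 \<le> \<rho> \<xi>" and l: "0 < \<tau>"
  shows "(\<integral>\<^sup>+\<xi>. (if \<tau> \<le> norm (fourier g \<xi>) * \<rho> \<xi> then ennreal (\<rho> \<xi> powr (- 2)) else 0) \<partial>lborel)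
    \<le> ennreal (\<tau> powr (- 2)) * (\<integral>\<^sup>+x. ennreal ((norm (g x))\<^sup>2) \<partial>lborel)"
proof -
  have [measurable]: "g \<in> borel_measurable borel"
    using g by simp
  have pw: "(if \<tau> \<le> norm (fourier g \<xi>) * \<rho> \<xi> then ennreal (\<rho> \<xi> powr (- 2)) else 0)
      \<le> ennreal (\<tau> powr (- 2)) * ennreal ((norm (fourier g \<xi>))\<^sup>2)" for \<xi>
  proof (cases "\<tau> \<le> norm (fourier g \<xi>) * \<rho> \<xi>")
    case True
    then have \<rho>0: "0 < \<rho> \<xi>"
      using l \<rho>[of \<xi>] by (cases "\<rho> \<xi> = 0") auto
    have "\<tau>\<^sup>2 \<le> (norm (fourier g \<xi>) * \<rho> \<xi>)\<^sup>2"
      using True l by (intro power_mono) auto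
    then have "\<rho> \<xi> powr (- 2) \<le> \<tau> powr (- 2) * (norm (fourier g \<xi>))\<^sup>2"
      using \<rho>0 l by (simp add: powr_minus powr_numeral power_mult_distrib field_simps)
    then show ?thesis
      using True by (simp add: ennreal_mult[symmetric] ennreal_leI)
  qed auto
  have "(\<integral>\<^sup>+\<xi>. (if \<tau> \<le> norm (fourier g \<xi>) * \<rho> \<xi> then ennreal (\<rho> \<xi> powr (- 2)) else 0) \<partial>lborel)
      \<le> (\<integral>\<^sup>+\<xi>. ennreal (\<tau> powr (- 2)) * ennreal ((norm (fourier g \<xi>))\<^sup>2) \<partial>lborel)"
    by (intro nn_integral_mono pw)
  also have "\<dots> = ennreal (\<tau> powr (- 2)) * (\<integral>\<^sup>+\<xi>. ennreal ((norm (fourier g \<xi>))\<^sup>2) \<partial>lborel)"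
    by (intro nn_integral_cmult) measurable
  also have "\<dots> \<le> ennreal (\<tau> powr (- 2)) * (\<integral>\<^sup>+x. ennreal ((norm (g x))\<^sup>2) \<partial>lborel)"
    by (intro mult_left_mono bessel g) auto
  finally show ?thesis .
qed

text \<open>The decomposition of Marcinkiewicz interpolation: the tall part is estimated by its L^1
  norm, which bounds its transform everywhere, and the low part by the weak type (2,2)
  bound.\<close>

locale height_split =
  fixes h :: "'a::euclidean_space \<Rightarrow> complex" and k :: real
  assumes h: "integrable lborel h"
begin

definition "hi x = (if norm (h x) \<le> k then 0 else h x)"
definition "lo x = (if norm (h x) \<le> k then h x else 0)"

lemma measurable_h [measurable]: "h \<in> borel_measurable borel"
  using h by simp

lemma measurable_hi_lo [measurable]: "hi \<in> borel_measurable borel" "lo \<in> borel_measurable borel"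
  unfolding hi_def[abs_def] lo_def[abs_def] by measurable

lemma integrable_hi: "integrable lborel hi"
  by (rule Bochner_Integration.integrable_bound[OF h]) (auto simp: hi_def)

lemma integrable_lo: "integrable lborel lo"
  by (rule Bochner_Integration.integrable_bound[OF h]) (auto simp: lo_def)

lemma fourier_split: "norm (fourier h \<xi>) \<le> (LINT x|lborel. norm (hi x)) + norm (fourier lo \<xi>)"
proof -
  have "fourier h \<xi> = (LINT x|lborel. hi x * chi (x \<bullet> \<xi>) + lo x * chi (x \<bullet> \<xi>))"
    by (subst fourier_eq) (auto simp: hi_def lo_def intro!: Bochner_Integration.integral_cong)
  also have "\<dots> = fourier hi \<xi> + fourier lo \<xi>"
    using integrable_hi integrable_lo
    by (subst Bochner_Integration.integral_add) (auto simp: fourier_eq integrable_mult_chi)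
  finally show ?thesis
    using norm_fourier_le[OF integrable_hi, of \<xi>] norm_triangle_ineq[of "fourier hi \<xi>" "fourier lo \<xi>"] by simp
qed

lemma nn_integral_hi: "ennreal (LINT x|lborel. norm (hi x)) = (\<integral>\<^sup>+x. (if norm (h x) \<le> k then 0 else ennreal (norm (h x))) \<partial>lborel)"
proof -
  have "ennreal (LINT x|lborel. norm (hi x)) = (\<integral>\<^sup>+x. ennreal (norm (hi x)) \<partial>lborel)"
    using integrable_hi by (intro nn_integral_eq_integral[symmetric]) auto
  then show ?thesis
    by (simp add: hi_def if_distrib[of norm] if_distrib[of ennreal] cong: if_cong)
qed

lemma nn_integral_lo: "(\<integral>\<^sup>+x. ennreal ((norm (lo x))\<^sup>2) \<partial>lborel) = (\<integral>\<^sup>+x. (if norm (h x) \<le> k then ennreal ((norm (h x))\<^sup>2) else 0) \<partial>lborel)"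
  by (auto simp: lo_def intro!: nn_integral_cong)

end

text \<open>Marcinkiewicz interpolation. For each level \<tau> the cutting height is chosen so that
  the transform of the tall part never exceeds \<tau>; only the low part then meets the level set,
  and its weak type bound is integrated over \<tau>. The normalisation of h is what makes the height
  a function of \<tau> alone.\<close>

lemma Hausdorff_Young_normalised:
  fixes u :: real
  assumes u: "1 < u" "u < 2" and v: "v = u / (u - 1)"
  shows "\<exists>C. \<forall>h::'a::euclidean_space \<Rightarrow> complex. integrable lborel h \<longrightarrow>
    (\<integral>\<^sup>+x. ennreal (norm (h x) powr u) \<partial>lborel) \<le> 1 \<longrightarrow>
    (\<integral>\<^sup>+\<xi>. ennreal (norm (fourier h \<xi>) powr v) \<partial>lborel) \<le> ennreal C"
proof (intro exI allI impI)
  fix h :: "'a \<Rightarrow> complex"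
  assume h: "integrable lborel h" and h1: "(\<integral>\<^sup>+x. ennreal (norm (h x) powr u) \<partial>lborel) \<le> 1"
  have [measurable]: "h \<in> borel_measurable borel"
    using h by simp
  have v2: "2 < v"
    using u by (simp add: v field_simps)
  \<comment> \<open>The height k solves k^(1-u) = \<tau>. Where |h| > k one has |h| \<le> k^(1-u)
    |h|^u, so the tall part has L^1 norm at most \<tau>.\<close>
  define k where "k \<tau> = \<tau> powr (- 1 / (u - 1))" for \<tau> :: real
  have k_powr: "k \<tau> powr (1 - u) = \<tau>" if "0 < \<tau>" for \<tau>
  proof -
    have "- 1 / (u - 1) * (1 - u) = 1"
      using u by (simp add: field_simps)
    then show ?thesis
      using that by (simp only: k_def powr_powr) simp
  qed
  define Q where "Q \<tau> = (\<integral>\<^sup>+x. (if norm (h x) \<le> k \<tau> then ennreal ((norm (h x))\<^sup>2) else 0) \<partial>lborel)" for \<tau>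
  have key: "(\<integral>\<^sup>+\<xi>. (if 2 * \<tau> \<le> norm (fourier h \<xi>) then 1 else 0) \<partial>lborel) \<le> ennreal (\<tau> powr (- 2)) * Q \<tau>"
    if l: "0 < \<tau>" for \<tau>
  proof -
    interpret height_split h "k \<tau>"
      by standard (rule h)
    have k0: "0 < k \<tau>" and k1: "k \<tau> powr (1 - u) = \<tau>"
      using l k_powr by (auto simp: k_def)
    have "ennreal (LINT x|lborel. norm (hi x)) \<le> (\<integral>\<^sup>+x. ennreal \<tau> * ennreal (norm (h x) powr u) \<partial>lborel)"
      unfolding nn_integral_hi
    proof (intro nn_integral_mono)
      fix x
      have "norm (h x) \<le> \<tau> * norm (h x) powr u" if "k \<tau> < norm (h x)"
      proof -
        have "norm (h x) = norm (h x) powr (1 - u) * norm (h x) powr u"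
          using that k0 by (simp flip: powr_add)
        also have "\<dots> \<le> k \<tau> powr (1 - u) * norm (h x) powr u"
          using that k0 u by (intro mult_right_mono powr_mono2') auto
        finally show ?thesis
          using k1 by simp
      qed
      then show "(if norm (h x) \<le> k \<tau> then 0 else ennreal (norm (h x))) \<le> ennreal \<tau> * ennreal (norm (h x) powr u)"
        using l by (auto simp: ennreal_mult[symmetric] intro!: ennreal_leI)
    qed
    also have "\<dots> = ennreal \<tau> * (\<integral>\<^sup>+x. ennreal (norm (h x) powr u) \<partial>lborel)"
      by (rule nn_integral_cmult) measurable
    also have "\<dots> \<le> ennreal \<tau>"
      using mult_left_mono[OF h1, of "ennreal \<tau>"] by simp
    finally have hi: "(LINT x|lborel. norm (hi x)) \<le> \<tau>"
      using l by simp
    have "(\<integral>\<^sup>+\<xi>. (if 2 * \<tau> \<le> norm (fourier h \<xi>) then 1 else 0) \<partial>lborel)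
      \<le> (\<integral>\<^sup>+\<xi>. (if \<tau> \<le> norm (fourier lo \<xi>) * 1 then ennreal (1 powr (- 2)) else 0) \<partial>lborel)"
    proof (intro nn_integral_mono)
      fix \<xi>
      show "(if 2 * \<tau> \<le> norm (fourier h \<xi>) then 1 else 0 :: ennreal)
        \<le> (if \<tau> \<le> norm (fourier lo \<xi>) * 1 then ennreal (1 powr (- 2)) else 0)"
        using fourier_split[of \<xi>] hi by auto
    qed
    also have "\<dots> \<le> ennreal (\<tau> powr (- 2)) * Q \<tau>"
      using fourier_weak_type_22[OF integrable_lo, of "\<lambda>_. 1" \<tau>] l unfolding nn_integral_lo Q_def by simp
    finally show ?thesis .
  qed
  define c where "c = v * 2 powr v"
  have c: "0 \<le> c"
    using v2 by (simp add: c_def)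
  have "(\<integral>\<^sup>+\<xi>. ennreal (norm (fourier h \<xi>) powr v) \<partial>lborel)
      = (\<integral>\<^sup>+\<xi>. ennreal (norm (fourier h \<xi>) powr v) * 1 \<partial>lborel)"
    by simp
  also have "\<dots> = (\<integral>\<^sup>+\<tau>. (if 0 < \<tau> then ennreal (v * 2 powr v * \<tau> powr (v - 1)) *
      (\<integral>\<^sup>+\<xi>. (if 2 * \<tau> \<le> norm (fourier h \<xi>) then 1 else 0) \<partial>lborel) else 0) \<partial>lborel)"
    using v2 by (intro layer_cake_nn_integral) auto
  also have "\<dots> \<le> (\<integral>\<^sup>+\<tau>. (if 0 < \<tau> then ennreal (v * 2 powr v * \<tau> powr (v - 1)) * (ennreal (\<tau> powr (- 2)) * Q \<tau>) else 0) \<partial>lborel)"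
    using key by (intro nn_integral_mono) (auto intro!: mult_left_mono)
  also have "\<dots> = (\<integral>\<^sup>+\<tau>. (\<integral>\<^sup>+x. (if 0 < \<tau> \<and> norm (h x) \<le> k \<tau> then ennreal (c * \<tau> powr (v - 3) * (norm (h x))\<^sup>2) else 0) \<partial>lborel) \<partial>lborel)"
  proof (intro nn_integral_cong)
    fix \<tau> :: real
    show "(if 0 < \<tau> then ennreal (v * 2 powr v * \<tau> powr (v - 1)) * (ennreal (\<tau> powr (- 2)) * Q \<tau>) else 0)
      = (\<integral>\<^sup>+x. (if 0 < \<tau> \<and> norm (h x) \<le> k \<tau> then ennreal (c * \<tau> powr (v - 3) * (norm (h x))\<^sup>2) else 0) \<partial>lborel)"
    proof (cases "0 < \<tau>")
      case True
      have "ennreal (v * 2 powr v * \<tau> powr (v - 1)) * (ennreal (\<tau> powr (- 2)) * Q \<tau>) = ennreal (c * \<tau> powr (v - 3)) * Q \<tau>"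
        using c True by (simp add: c_def mult.assoc[symmetric] ennreal_mult[symmetric]) (simp add: powr_add[symmetric] mult.assoc)
      also have "\<dots> = (\<integral>\<^sup>+x. (if 0 < \<tau> \<and> norm (h x) \<le> k \<tau> then ennreal (c * \<tau> powr (v - 3) * (norm (h x))\<^sup>2) else 0) \<partial>lborel)"
        unfolding Q_def using True c
        by (subst nn_integral_cmult[symmetric]) (auto simp: ennreal_mult[symmetric] intro!: nn_integral_cong)
      finally show ?thesis
        using True by simp
    qed simp
  qed
  also have "\<dots> = (\<integral>\<^sup>+x. (\<integral>\<^sup>+\<tau>. (if 0 < \<tau> \<and> norm (h x) \<le> k \<tau> then ennreal (c * \<tau> powr (v - 3) * (norm (h x))\<^sup>2) else 0) \<partial>lborel) \<partial>lborel)"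
    unfolding k_def by (rule lborel_pair.Fubini') measurable
  also have "\<dots> \<le> (\<integral>\<^sup>+x. ennreal (c / (v - 2)) * ennreal (norm (h x) powr u) \<partial>lborel)"
  proof (intro nn_integral_mono)
    fix x
    show "(\<integral>\<^sup>+\<tau>. (if 0 < \<tau> \<and> norm (h x) \<le> k \<tau> then ennreal (c * \<tau> powr (v - 3) * (norm (h x))\<^sup>2) else 0) \<partial>lborel)
      \<le> ennreal (c / (v - 2)) * ennreal (norm (h x) powr u)"
    proof (cases "h x = 0")
      case False
      define s where "s = norm (h x)"
      have s: "0 < s"
        using False by (simp add: s_def)
      \<comment> \<open>Since \<open>k\<close> is decreasing, s \<le> k \<tau> caps \<tau>. The
        \<tau>-integral converges at 0 because v > 2, and the resulting power of s is 2 + (1 - u) (v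
        - 2) = u.\<close>
      have "\<tau> \<le> s powr (1 - u)" if "0 < \<tau>" "s \<le> k \<tau>" for \<tau>
      proof -
        have "k \<tau> powr (1 - u) \<le> s powr (1 - u)"
          using that s u by (intro powr_mono2') auto
        then show ?thesis
          using that by (simp add: k_powr)
      qed
      then have "(\<integral>\<^sup>+\<tau>. (if 0 < \<tau> \<and> s \<le> k \<tau> then ennreal (c * \<tau> powr (v - 3) * s\<^sup>2) else 0) \<partial>lborel)
        \<le> (\<integral>\<^sup>+\<tau>. ennreal (c * s\<^sup>2) * (if 0 \<le> \<tau> \<and> \<tau> \<le> s powr (1 - u) then ennreal (\<tau> powr ((v - 2) - 1)) else 0) \<partial>lborel)"
        using c by (intro nn_integral_mono) (auto simp: ennreal_mult[symmetric] mult_ac)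
      also have "\<dots> = ennreal (c * s\<^sup>2) * ennreal ((s powr (1 - u)) powr (v - 2) / (v - 2))"
        using v2 nn_integral_powr_head[of "v - 2" "s powr (1 - u)"] by (subst nn_integral_cmult) auto
      also have "\<dots> = ennreal (c / (v - 2) * (s powr 2 * (s powr (1 - u)) powr (v - 2)))"
        using c s v2 by (simp add: ennreal_mult[symmetric] powr_numeral)
      also have "s powr 2 * (s powr (1 - u)) powr (v - 2) = s powr (2 + (1 - u) * (v - 2))"
        by (simp add: powr_powr powr_add)
      also have "2 + (1 - u) * (v - 2) = u"
        using u by (simp add: v field_simps)
      finally show ?thesis
        using c v2 unfolding s_def by (subst ennreal_mult[symmetric]) auto
    qed (simp cong: if_cong)
  qed
  also have "\<dots> = ennreal (c / (v - 2)) * (\<integral>\<^sup>+x. ennreal (norm (h x) powr u) \<partial>lborel)"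
    by (rule nn_integral_cmult) measurable
  also have "\<dots> \<le> ennreal (c / (v - 2))"
    using mult_left_mono[OF h1, of "ennreal (c / (v - 2))"] by simp
  finally show "(\<integral>\<^sup>+\<xi>. ennreal (norm (fourier h \<xi>) powr v) \<partial>lborel) \<le> ennreal (v * 2 powr v / (v - 2))"
    by (simp add: c_def)
qed


text \<open>Marcinkiewicz interpolation for the map from h to
  \<open>fourier h \<xi> * norm \<xi> powr d\<close> into the measure |\<xi>|^(-2d) d\<xi>. It is of
  weak type (1,1) by the tail of that measure and of weak type (2,2) by Bessel's inequality. Both
  parts contribute here, and the height is \<tau> itself.\<close>

lemma Paley_normalised:
  fixes u :: real
  assumes u: "1 < u" "u < 2"
  shows "\<exists>C. \<forall>h::'a::euclidean_space \<Rightarrow> complex. integrable lborel h \<longrightarrow>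
    (\<integral>\<^sup>+x. ennreal (norm (h x) powr u) \<partial>lborel) \<le> 1 \<longrightarrow>
    (\<integral>\<^sup>+\<xi>. ennreal ((norm (fourier h \<xi>) * norm \<xi> powr real DIM('a)) powr u) * ennreal (norm \<xi> powr (- 2 * real DIM('a))) \<partial>lborel) \<le> ennreal C"
proof (intro exI allI impI)
  fix h :: "'a \<Rightarrow> complex"
  assume h: "integrable lborel h" and h1: "(\<integral>\<^sup>+x. ennreal (norm (h x) powr u) \<partial>lborel) \<le> 1"
  have [measurable]: "h \<in> borel_measurable borel"
    using h by simp
  let ?d = "real DIM('a)"
  define V where "V = 2 * unit_ball_vol ?d"
  have V: "0 \<le> V"
    by (simp add: V_def unit_ball_vol_nonneg)
  define P where "P \<tau> = (\<integral>\<^sup>+x. (if norm (h x) \<le> \<tau> then 0 else ennreal (norm (h x))) \<partial>lborel)" for \<tau>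
  define Q where "Q \<tau> = (\<integral>\<^sup>+x. (if norm (h x) \<le> \<tau> then ennreal ((norm (h x))\<^sup>2) else 0) \<partial>lborel)" for \<tau>
  have key: "(\<integral>\<^sup>+\<xi>. (if 2 * \<tau> \<le> norm (fourier h \<xi>) * norm \<xi> powr ?d then ennreal (norm \<xi> powr (- 2 * ?d)) else 0) \<partial>lborel)
      \<le> ennreal (V / \<tau>) * P \<tau> + ennreal (\<tau> powr (- 2)) * Q \<tau>" if l: "0 < \<tau>" for \<tau>
  proof -
    interpret height_split h \<tau>
      by standard (rule h)
    define N where "N = (LINT x|lborel. norm (hi x))"
    have N: "0 \<le> N"
      by (simp add: N_def)
    have hi: "(\<integral>\<^sup>+\<xi>. (if \<tau> \<le> N * norm \<xi> powr ?d then ennreal (norm \<xi> powr (- 2 * ?d)) else 0) \<partial>(lborel :: 'a measure)) \<le> ennreal (V / \<tau>) * P \<tau>"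
    proof (cases "N = 0")
      case False
      then have N0: "0 < N"
        using N by simp
      \<comment> \<open>t solves N t^d = \<tau>: the level set lies outside the ball of radius t,
        and the tail integral of |\<xi>|^(-2d) there is proportional to t^(-d) = N / \<tau>.\<close>
      define t where "t = (\<tau> / N) powr (1 / ?d)"
      have t: "0 < t" and td: "t powr (- ?d) = N / \<tau>"
        using N0 l by (auto simp: t_def powr_powr powr_minus field_simps)
      have "t \<le> norm \<xi>" if "\<tau> \<le> N * norm \<xi> powr ?d" for \<xi> :: 'a
      proof -
        have "(\<tau> / N) powr (1 / ?d) \<le> (norm \<xi> powr ?d) powr (1 / ?d)"
          using that N0 l by (intro powr_mono2) (auto simp: field_simps)
        then show ?thesis
          by (simp add: t_def powr_powr)
      qed
      then have "(\<integral>\<^sup>+\<xi>. (if \<tau> \<le> N * norm \<xi> powr ?d then ennreal (norm \<xi> powr (- 2 * ?d)) else 0) \<partial>(lborel :: 'a measure))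
        \<le> (\<integral>\<^sup>+\<xi>. (if t \<le> norm \<xi> then ennreal (norm \<xi> powr (- (2 * ?d))) else 0) \<partial>(lborel :: 'a measure))"
        by (intro nn_integral_mono) auto
      also have "\<dots> \<le> ennreal (2 * ?d * unit_ball_vol ?d / (2 * ?d - ?d) * t powr (?d - 2 * ?d))"
        using t by (intro nn_integral_norm_powr_outside) auto
      also have "\<dots> = ennreal (V / \<tau> * N)"
        using td by (simp add: V_def)
      also have "\<dots> = ennreal (V / \<tau>) * P \<tau>"
        using V l N by (simp only: P_def nn_integral_hi[symmetric] N_def[symmetric] ennreal_mult divide_nonneg_pos)
      finally show ?thesis .
    qed (use l in auto)
    have lo: "(\<integral>\<^sup>+\<xi>. (if \<tau> \<le> norm (fourier lo \<xi>) * norm \<xi> powr ?d then ennreal ((norm \<xi> powr ?d) powr (- 2)) else 0) \<partial>lborel)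
      \<le> ennreal (\<tau> powr (- 2)) * Q \<tau>"
      using fourier_weak_type_22[OF integrable_lo, of "\<lambda>\<xi>. norm \<xi> powr ?d" \<tau>] l unfolding nn_integral_lo Q_def by simp
    have "(\<integral>\<^sup>+\<xi>. (if 2 * \<tau> \<le> norm (fourier h \<xi>) * norm \<xi> powr ?d then ennreal (norm \<xi> powr (- 2 * ?d)) else 0) \<partial>lborel)
      \<le> (\<integral>\<^sup>+\<xi>. (if \<tau> \<le> N * norm \<xi> powr ?d then ennreal (norm \<xi> powr (- 2 * ?d)) else 0)
        + (if \<tau> \<le> norm (fourier lo \<xi>) * norm \<xi> powr ?d then ennreal ((norm \<xi> powr ?d) powr (- 2)) else 0) \<partial>lborel)"
    proof (intro nn_integral_mono)
      fix \<xi> :: 'a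
      have "norm (fourier h \<xi>) * norm \<xi> powr ?d \<le> (N + norm (fourier lo \<xi>)) * norm \<xi> powr ?d"
        unfolding N_def by (intro mult_right_mono fourier_split) auto
      then have "\<tau> \<le> N * norm \<xi> powr ?d \<or> \<tau> \<le> norm (fourier lo \<xi>) * norm \<xi> powr ?d"
        if "2 * \<tau> \<le> norm (fourier h \<xi>) * norm \<xi> powr ?d"
        using that by (simp add: distrib_right) linarith
      then show "(if 2 * \<tau> \<le> norm (fourier h \<xi>) * norm \<xi> powr ?d then ennreal (norm \<xi> powr (- 2 * ?d)) else 0)
        \<le> (if \<tau> \<le> N * norm \<xi> powr ?d then ennreal (norm \<xi> powr (- 2 * ?d)) else 0)
        + (if \<tau> \<le> norm (fourier lo \<xi>) * norm \<xi> powr ?d then ennreal ((norm \<xi> powr ?d) powr (- 2)) else 0)"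
        by (auto simp: powr_powr mult.commute)
    qed
    also have "\<dots> = (\<integral>\<^sup>+\<xi>. (if \<tau> \<le> N * norm \<xi> powr ?d then ennreal (norm \<xi> powr (- 2 * ?d)) else 0) \<partial>(lborel :: 'a measure))
        + (\<integral>\<^sup>+\<xi>. (if \<tau> \<le> norm (fourier lo \<xi>) * norm \<xi> powr ?d then ennreal ((norm \<xi> powr ?d) powr (- 2)) else 0) \<partial>lborel)"
      by (intro nn_integral_add) measurable
    also have "\<dots> \<le> ennreal (V / \<tau>) * P \<tau> + ennreal (\<tau> powr (- 2)) * Q \<tau>"
      by (intro add_mono hi lo)
    finally show ?thesis .
  qed
  define c where "c = u * 2 powr u"
  have c: "0 \<le> c"
    using u by (simp add: c_def)
  define A where "A x \<tau> = (if 0 < \<tau> \<and> \<not> norm (h x) \<le> \<tau> then ennreal (c * V * \<tau> powr (u - 2) * norm (h x)) else 0)" for x and \<tau> :: real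
  define B where "B x \<tau> = (if 0 < \<tau> \<and> norm (h x) \<le> \<tau> then ennreal (c * \<tau> powr (u - 3) * (norm (h x))\<^sup>2) else 0)" for x and \<tau> :: real
  have [measurable]: "case_prod A \<in> borel_measurable (borel \<Otimes>\<^sub>M borel)" "case_prod B \<in> borel_measurable (borel \<Otimes>\<^sub>M borel)"
    unfolding A_def B_def by measurable
  have "(\<integral>\<^sup>+\<xi>. ennreal ((norm (fourier h \<xi>) * norm \<xi> powr ?d) powr u) * ennreal (norm \<xi> powr (- 2 * ?d)) \<partial>lborel)
      = (\<integral>\<^sup>+\<tau>. (if 0 < \<tau> then ennreal (u * 2 powr u * \<tau> powr (u - 1)) *
      (\<integral>\<^sup>+\<xi>. (if 2 * \<tau> \<le> norm (fourier h \<xi>) * norm \<xi> powr ?d then ennreal (norm \<xi> powr (- 2 * ?d)) else 0) \<partial>lborel) else 0) \<partial>lborel)"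
    using u by (intro layer_cake_nn_integral) auto
  also have "\<dots> \<le> (\<integral>\<^sup>+\<tau>. (if 0 < \<tau> then ennreal (c * \<tau> powr (u - 1)) * (ennreal (V / \<tau>) * P \<tau> + ennreal (\<tau> powr (- 2)) * Q \<tau>) else 0) \<partial>lborel)"
    using key by (intro nn_integral_mono) (auto simp: c_def intro!: mult_left_mono)
  also have "\<dots> = (\<integral>\<^sup>+\<tau>. (\<integral>\<^sup>+x. A x \<tau> + B x \<tau> \<partial>lborel) \<partial>lborel)"
  proof (intro nn_integral_cong)
    fix \<tau> :: real
    show "(if 0 < \<tau> then ennreal (c * \<tau> powr (u - 1)) * (ennreal (V / \<tau>) * P \<tau> + ennreal (\<tau> powr (- 2)) * Q \<tau>) else 0)
      = (\<integral>\<^sup>+x. A x \<tau> + B x \<tau> \<partial>lborel)"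
    proof (cases "0 < \<tau>")
      case True
      have e: "\<tau> powr (u - 1) / \<tau> = \<tau> powr (u - 2)" "\<tau> powr (u - 1) * \<tau> powr (- 2) = \<tau> powr (u - 3)"
        using True by (auto simp: powr_diff powr_add[symmetric] field_simps power2_eq_square power3_eq_cube)
      have "ennreal (c * \<tau> powr (u - 1)) * (ennreal (V / \<tau>) * P \<tau> + ennreal (\<tau> powr (- 2)) * Q \<tau>)
        = ennreal (c * \<tau> powr (u - 1)) * ennreal (V / \<tau>) * P \<tau> + ennreal (c * \<tau> powr (u - 1)) * ennreal (\<tau> powr (- 2)) * Q \<tau>"
        by (simp add: distrib_left mult.assoc)
      also have "ennreal (c * \<tau> powr (u - 1)) * ennreal (V / \<tau>) = ennreal (c * V * \<tau> powr (u - 2))"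
        using c V True by (simp add: ennreal_mult[symmetric] mult_ac e(1)[symmetric])
      also have "ennreal (c * \<tau> powr (u - 1)) * ennreal (\<tau> powr (- 2)) = ennreal (c * \<tau> powr (u - 3))"
        using c e(2) by (simp add: ennreal_mult[symmetric] mult.assoc)
      also have "ennreal (c * V * \<tau> powr (u - 2)) * P \<tau> = (\<integral>\<^sup>+x. A x \<tau> \<partial>lborel)"
        unfolding P_def A_def using True c V
        by (subst nn_integral_cmult[symmetric]) (auto simp: ennreal_mult[symmetric] intro!: nn_integral_cong)
      also have "ennreal (c * \<tau> powr (u - 3)) * Q \<tau> = (\<integral>\<^sup>+x. B x \<tau> \<partial>lborel)"
        unfolding Q_def B_def using True c
        by (subst nn_integral_cmult[symmetric]) (auto simp: ennreal_mult[symmetric] intro!: nn_integral_cong)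
      also have "(\<integral>\<^sup>+x. A x \<tau> \<partial>lborel) + (\<integral>\<^sup>+x. B x \<tau> \<partial>lborel) = (\<integral>\<^sup>+x. A x \<tau> + B x \<tau> \<partial>lborel)"
        by (intro nn_integral_add[symmetric]) measurable
      finally show ?thesis
        using True by simp
    next
      case False
      then have "A x \<tau> + B x \<tau> = 0" for x
        by (simp add: A_def B_def)
      then show ?thesis
        using False by simp
    qed
  qed
  also have "\<dots> = (\<integral>\<^sup>+x. (\<integral>\<^sup>+\<tau>. A x \<tau> + B x \<tau> \<partial>lborel) \<partial>lborel)"
    by (rule lborel_pair.Fubini') measurable
  also have "\<dots> \<le> (\<integral>\<^sup>+x. ennreal (c * V / (u - 1) + c / (2 - u)) * ennreal (norm (h x) powr u) \<partial>lborel)"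
  proof (intro nn_integral_mono)
    fix x
    define s where "s = norm (h x)"
    \<comment> \<open>The tall part gives a \<tau>-integral over (0, s), finite because u > 1; the
      low part below gives one over (s, \<infinity>), finite because u < 2.\<close>
    have A: "(\<integral>\<^sup>+\<tau>. A x \<tau> \<partial>lborel) \<le> ennreal (c * V / (u - 1) * s powr u)"
    proof -
      have "(\<integral>\<^sup>+\<tau>. A x \<tau> \<partial>lborel) \<le> (\<integral>\<^sup>+\<tau>. ennreal (c * V * s) * (if 0 \<le> \<tau> \<and> \<tau> \<le> s then ennreal (\<tau> powr ((u - 1) - 1)) else 0) \<partial>lborel)"
        using c V by (intro nn_integral_mono) (auto simp: A_def s_def ennreal_mult[symmetric] mult_ac)
      also have "\<dots> = ennreal (c * V * s) * ennreal (s powr (u - 1) / (u - 1))"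
        using u nn_integral_powr_head[of "u - 1" s] by (subst nn_integral_cmult) (auto simp: s_def)
      also have "\<dots> = ennreal (c * V / (u - 1) * (s powr 1 * s powr (u - 1)))"
        using c V u by (simp add: ennreal_mult[symmetric] s_def)
      finally show ?thesis
        unfolding powr_add[symmetric] by simp
    qed
    have B: "(\<integral>\<^sup>+\<tau>. B x \<tau> \<partial>lborel) \<le> ennreal (c / (2 - u) * s powr u)"
    proof (cases "s = 0")
      case True
      then have "B x \<tau> = 0" for \<tau>
        by (simp add: B_def s_def)
      then show ?thesis
        by simp
    next
      case False
      then have s: "0 < s"
        by (simp add: s_def)
      have "(\<integral>\<^sup>+\<tau>. B x \<tau> \<partial>lborel) \<le> (\<integral>\<^sup>+\<tau>. ennreal (c * s\<^sup>2) * (if s \<le> \<tau> then ennreal (\<tau> powr (- (2 - u) - 1)) else 0) \<partial>lborel)"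
        using c by (intro nn_integral_mono) (auto simp: B_def s_def ennreal_mult[symmetric] mult_ac)
      also have "\<dots> = ennreal (c * s\<^sup>2) * ennreal (s powr (- (2 - u)) / (2 - u))"
        using u s nn_integral_powr_tail[of "2 - u" s] by (subst nn_integral_cmult) auto
      also have "\<dots> = ennreal (c / (2 - u) * (s powr 2 * s powr (- (2 - u))))"
        using c u s by (simp add: ennreal_mult[symmetric] powr_numeral)
      finally show ?thesis
        unfolding powr_add[symmetric] by simp
    qed
    have "(\<integral>\<^sup>+\<tau>. A x \<tau> + B x \<tau> \<partial>lborel) = (\<integral>\<^sup>+\<tau>. A x \<tau> \<partial>lborel) + (\<integral>\<^sup>+\<tau>. B x \<tau> \<partial>lborel)"
      by (intro nn_integral_add) measurable
    also have "\<dots> \<le> ennreal (c * V / (u - 1) * s powr u) + ennreal (c / (2 - u) * s powr u)"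
      by (intro add_mono A B)
    also have "\<dots> = ennreal (c * V / (u - 1) + c / (2 - u)) * ennreal (s powr u)"
      using c V u by (simp add: ennreal_plus[symmetric] ennreal_mult[symmetric] distrib_right del: ennreal_plus)
    finally show "(\<integral>\<^sup>+\<tau>. A x \<tau> + B x \<tau> \<partial>lborel) \<le> ennreal (c * V / (u - 1) + c / (2 - u)) * ennreal (norm (h x) powr u)"
      by (simp add: s_def)
  qed
  also have "\<dots> = ennreal (c * V / (u - 1) + c / (2 - u)) * (\<integral>\<^sup>+x. ennreal (norm (h x) powr u) \<partial>lborel)"
    by (rule nn_integral_cmult) measurable
  also have "\<dots> \<le> ennreal (c * V / (u - 1) + c / (2 - u))"
    using mult_left_mono[OF h1, of "ennreal (c * V / (u - 1) + c / (2 - u))"] by simp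
  finally show "(\<integral>\<^sup>+\<xi>. ennreal ((norm (fourier h \<xi>) * norm \<xi> powr ?d) powr u) * ennreal (norm \<xi> powr (- 2 * ?d)) \<partial>lborel)
      \<le> ennreal (u * 2 powr u * (2 * unit_ball_vol ?d) / (u - 1) + u * 2 powr u / (2 - u))"
    by (simp add: c_def V_def)
qed

section \<open>Pitt's inequality\<close>

text \<open>The inverse of \<open>recip\<close>. Exponents are specified by their reciprocals, in
  which the relations of Hoelder and of duality are linear.\<close>

definition exponent :: "real \<Rightarrow> ennreal" where
  "exponent t = (if t = 0 then top else ennreal (1 / t))"

lemma exponent:
  assumes "0 \<le> t" "t \<le> 1"
  shows recip_exponent: "recip (exponent t) = t" and one_le_exponent: "1 \<le> exponent t"
  using assms by (auto simp: exponent_def recip_ennreal)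

lemma recip_nonneg: "0 \<le> recip p"
  by (simp add: recip_def)

lemma recip_le_1: "1 \<le> p \<Longrightarrow> recip p \<le> 1"
  by (erule exponent_cases) auto

lemma recip_antimono: "1 \<le> p \<Longrightarrow> p \<le> q \<Longrightarrow> recip q \<le> recip p"
proof -
  assume p: "1 \<le> p" and pq: "p \<le> q"
  show ?thesis
  proof (rule exponent_cases[OF order_trans[OF p pq]])
    fix Q assume Q: "1 \<le> Q" "q = ennreal Q" "recip q = 1 / Q"
    from p show ?thesis
      by (rule exponent_cases) (use pq Q in \<open>auto simp: top_unique intro!: divide_left_mono\<close>)
  qed (simp add: recip_nonneg)
qed

lemma recip_le_iff: "1 \<le> p \<Longrightarrow> 1 \<le> q \<Longrightarrow> recip q \<le> recip p \<longleftrightarrow> p \<le> q"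
  by (metis recip_antimono recip_inj linorder_linear order_antisym)

lemma Lp_norm_1: "Lp_norm 1 f = (\<integral>\<^sup>+x. ennreal (norm (f x)) \<partial>lborel)"
proof (rule antisym)
  have *: "Lp_norm 1 f \<le> ennreal c \<longleftrightarrow> (\<integral>\<^sup>+x. ennreal (norm (f x)) \<partial>lborel) \<le> ennreal c" if "0 \<le> c" for c
    using Lp_norm_le_iff[of 1 c f] that by simp
  show "Lp_norm 1 f \<le> (\<integral>\<^sup>+x. ennreal (norm (f x)) \<partial>lborel)"
    by (rule ennreal_le_by_real) (simp add: *)
  show "(\<integral>\<^sup>+x. ennreal (norm (f x)) \<partial>lborel) \<le> Lp_norm 1 f"
    by (rule ennreal_le_by_real) (simp add: *[symmetric])
qed

text \<open>Pointwise, the integrand is a geometric mean of the integrands of Hausdorff--Young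
  (exponent w = u/(u-1), no weight) and of Paley (exponent u). Young's inequality bounds it by their
  sum, so real interpolation inequalities alone suffice.\<close>

lemma Pitt_dual_aux:
  fixes u v \<beta> :: real
  assumes u: "1 < u" "u < 2" and v: "u \<le> v" "v \<le> u / (u - 1)"
    and \<beta>: "\<beta> = DIM('a) * (1 / v + 1 / u - 1)"
  shows "\<exists>C>0. \<forall>h::'a::euclidean_space \<Rightarrow> complex. integrable lborel h \<longrightarrow> Lp_norm (ennreal u) h \<le> 1 \<longrightarrow>
    Lp_norm (ennreal v) (\<lambda>\<xi>. fourier h \<xi> * complex_of_real (norm \<xi> powr (- \<beta>))) \<le> ennreal C"
proof -
  let ?d = "real DIM('a)"
  define w where "w = u / (u - 1)"
  \<comment> \<open>l is found by matching the powers of |fourier h|, which is \<open>e1\<close>;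
    the scaling relation that defines \<beta> then makes the powers of |\<xi>| match as well, which
    is \<open>e2\<close>.\<close>
  define l where "l = (v - u) / (w - u)"
  have wu: "w - u = u * (2 - u) / (u - 1)"
    using u by (simp add: w_def field_simps)
  have wu0: "0 < w - u"
    unfolding wu using u by simp
  have l01: "0 \<le> l" "l \<le> 1"
    using v wu0 by (auto simp: l_def w_def)
  have e1: "l * w + (1 - l) * u = v"
  proof -
    have "l * (w - u) = v - u"
      using wu0 by (simp add: l_def)
    then show ?thesis
      by (simp add: algebra_simps)
  qed
  have e2: "(1 - l) * (?d * u - 2 * ?d) = - \<beta> * v"
  proof -
    have "1 - l = (w - v) / (w - u)"
      using wu0 by (simp add: l_def field_simps)
    then have "(1 - l) * (2 - u) = (w - v) * (u - 1) / u"
      unfolding wu using u by simp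
    also have "\<dots> = v * (1 / v + 1 / u - 1)"
      using u v by (simp add: w_def field_simps)
    finally have "?d * ((1 - l) * (2 - u)) = \<beta> * v"
      by (simp add: \<beta>)
    then show ?thesis
      by (simp add: algebra_simps)
  qed
  obtain C1 where C1: "\<And>h::'a \<Rightarrow> complex. integrable lborel h \<Longrightarrow>
    (\<integral>\<^sup>+x. ennreal (norm (h x) powr u) \<partial>lborel) \<le> 1 \<Longrightarrow>
    (\<integral>\<^sup>+\<xi>. ennreal (norm (fourier h \<xi>) powr w) \<partial>lborel) \<le> ennreal C1"
    using Hausdorff_Young_normalised[OF u w_def] by blast
  obtain C2 where C2: "\<And>h::'a \<Rightarrow> complex. integrable lborel h \<Longrightarrow>
    (\<integral>\<^sup>+x. ennreal (norm (h x) powr u) \<partial>lborel) \<le> 1 \<Longrightarrow>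
    (\<integral>\<^sup>+\<xi>. ennreal ((norm (fourier h \<xi>) * norm \<xi> powr ?d) powr u) * ennreal (norm \<xi> powr (- 2 * ?d)) \<partial>lborel) \<le> ennreal C2"
    using Paley_normalised[OF u] by blast
  define K where "K = \<bar>C1\<bar> + \<bar>C2\<bar> + 1"
  have K: "0 < K"
    by (simp add: K_def add_nonneg_pos)
  show ?thesis
  proof (intro exI[of _ "K powr (1 / v)"] conjI allI impI)
    fix h :: "'a \<Rightarrow> complex"
    assume h: "integrable lborel h" and "Lp_norm (ennreal u) h \<le> 1"
    then have h1: "(\<integral>\<^sup>+x. ennreal (norm (h x) powr u) \<partial>lborel) \<le> 1"
      using Lp_norm_le_iff[of u 1 h] u by simp
    have [measurable]: "h \<in> borel_measurable borel"
      using h by simp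
    have pw: "norm (fourier h \<xi> * complex_of_real (norm \<xi> powr (- \<beta>))) powr v
      \<le> norm (fourier h \<xi>) powr w + (norm (fourier h \<xi>) * norm \<xi> powr ?d) powr u * norm \<xi> powr (- 2 * ?d)" for \<xi> :: 'a
    proof (cases "fourier h \<xi> = 0 \<or> \<xi> = 0")
      case False
      define a b where "a = norm (fourier h \<xi>)" and "b = norm \<xi>"
      have ab: "0 < a" "0 < b"
        using False by (auto simp: a_def b_def)
      have "(a * b powr (- \<beta>)) powr v = a powr (l * w + (1 - l) * u) * b powr ((1 - l) * (?d * u - 2 * ?d))"
        using ab by (simp add: e1 e2 powr_mult powr_powr)
      also have "\<dots> = (a powr w) powr l * ((a * b powr ?d) powr u * b powr (- 2 * ?d)) powr (1 - l)"
        using ab by (simp add: powr_mult powr_powr powr_add[symmetric] powr_add distrib_left right_diff_distrib' algebra_simps)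
      also have "\<dots> \<le> l * (a powr w) + (1 - l) * ((a * b powr ?d) powr u * b powr (- 2 * ?d))"
        using ab l01 by (intro Youngs_inequality_0) auto
      also have "\<dots> \<le> 1 * (a powr w) + 1 * ((a * b powr ?d) powr u * b powr (- 2 * ?d))"
        using l01 by (intro add_mono mult_right_mono) auto
      finally show ?thesis
        by (simp add: a_def b_def norm_mult)
    qed auto
    have "(\<integral>\<^sup>+\<xi>. ennreal (norm (fourier h \<xi> * complex_of_real (norm \<xi> powr (- \<beta>))) powr v) \<partial>lborel)
      \<le> (\<integral>\<^sup>+\<xi>. ennreal (norm (fourier h \<xi>) powr w)
         + ennreal ((norm (fourier h \<xi>) * norm \<xi> powr ?d) powr u) * ennreal (norm \<xi> powr (- 2 * ?d)) \<partial>lborel)"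
      by (intro nn_integral_mono order_trans[OF ennreal_leI[OF pw]])
        (simp add: ennreal_mult[symmetric] ennreal_plus[symmetric] del: ennreal_plus)
    also have "\<dots> = (\<integral>\<^sup>+\<xi>. ennreal (norm (fourier h \<xi>) powr w) \<partial>lborel)
         + (\<integral>\<^sup>+\<xi>. ennreal ((norm (fourier h \<xi>) * norm \<xi> powr ?d) powr u) * ennreal (norm \<xi> powr (- 2 * ?d)) \<partial>lborel)"
      by (intro nn_integral_add) measurable
    also have "\<dots> \<le> ennreal C1 + ennreal C2"
      by (intro add_mono C1 C2 h h1)
    also have "\<dots> \<le> ennreal \<bar>C1\<bar> + ennreal \<bar>C2\<bar>"
      by (intro add_mono ennreal_leI) auto
    also have "\<dots> \<le> ennreal K"
      by (simp add: K_def ennreal_plus[symmetric] ennreal_leI del: ennreal_plus)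
    also have "K = (K powr (1 / v)) powr v"
      using K u v by (simp add: powr_powr)
    finally show "Lp_norm (ennreal v) (\<lambda>\<xi>. fourier h \<xi> * complex_of_real (norm \<xi> powr (- \<beta>))) \<le> ennreal (K powr (1 / v))"
      using u v by (subst Lp_norm_le_iff) auto
  qed (use K in simp)
qed

text \<open>At q = \<infinity> and at q = 2 the hypotheses force \<beta> = 0, which leaves the
  trivial bound from L^1 to L^\<infinity> and Bessel's inequality. In between, the interpolated
  bound applies with u the dual exponent of q.\<close>

lemma Pitt_dual:
  fixes p q p' q' :: ennreal and \<beta> :: real
  assumes p: "1 \<le> p" and q: "2 \<le> q" and p': "1 \<le> p'" "recip p' = 1 - recip p" and q': "1 \<le> q'" "recip q' = 1 - recip q"
    and \<beta>: "0 \<le> \<beta>" "\<beta> = DIM('a) * (1 - recip q - recip p)"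
    and pq: "\<beta> = 0 \<or> p \<le> q \<and> q < \<infinity>"
  shows "\<exists>C>0. \<forall>h::'a::euclidean_space \<Rightarrow> complex. integrable lborel h \<longrightarrow> Lp_norm q' h \<le> 1 \<longrightarrow>
    Lp_norm p' (\<lambda>\<xi>. fourier h \<xi> * complex_of_real (norm \<xi> powr (- \<beta>))) \<le> ennreal C"
proof -
  have q1: "1 \<le> q"
    using q by (meson one_le_numeral order_trans)
  \<comment> \<open>\<open>0 powr 0 = 0\<close>, so the trivial weight is 0 instead of 1 at the
    origin and can only be bounded.\<close>
  have norm_le: "norm (z * complex_of_real (norm (\<xi>::'a) powr (- 0))) \<le> norm z" for z \<xi>
    by (cases "\<xi> = 0") (auto simp: norm_mult)
  consider "q = top" | "q = 2" | "2 < q" "q < top"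
    using q by (metis order_le_less less_top)
  then show ?thesis
  proof cases
    case 1
    then have b: "\<beta> = 0" and "recip q' = 1"
      using pq q' by auto
    moreover have "recip p' = 0"
      using b \<beta> 1 p' by simp
    ultimately have "q' = 1" "p' = top"
      using recip_inj[of q' 1] recip_inj[of p' top] p' q' by (auto simp: recip_def)
    show ?thesis
    proof (intro exI[of _ 1] conjI allI impI)
      fix h :: "'a \<Rightarrow> complex"
      assume h: "integrable lborel h" and h1: "Lp_norm q' h \<le> 1"
      have [measurable]: "h \<in> borel_measurable borel"
        using h by simp
      have "ennreal (LINT x|lborel. norm (h x)) \<le> 1"
        using h h1 unfolding \<open>q' = 1\<close> Lp_norm_1 by (subst nn_integral_eq_integral[symmetric]) auto
      then have "norm (fourier h \<xi>) \<le> 1" for \<xi>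
        using norm_fourier_le[OF h, of \<xi>] by simp
      then show "Lp_norm p' (\<lambda>\<xi>. fourier h \<xi> * complex_of_real (norm \<xi> powr (- \<beta>))) \<le> ennreal 1"
        unfolding \<open>p' = top\<close> b using norm_le order_trans by (subst Lp_norm_inf_le_iff) (auto intro!: AE_I2)
    qed simp
  next
    case 2
    then have r: "recip q = 1 / 2"
      using recip_ennreal[of 2] by simp
    have b: "\<beta> = 0"
    proof (rule ccontr)
      assume "\<beta> \<noteq> 0"
      then have "recip q \<le> recip p"
        using pq p by (intro recip_antimono) auto
      then have "\<beta> \<le> 0"
        unfolding \<beta> r by (intro mult_nonneg_nonpos) auto
      then show False
        using \<beta> \<open>\<beta> \<noteq> 0\<close> by simp
    qed
    then have "recip p = 1 / 2"
      using \<beta> r by simp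
    then have e: "q' = ennreal 2" "p' = ennreal 2"
      using recip_inj[of q' "ennreal 2"] recip_inj[of p' "ennreal 2"] p' q' r recip_ennreal[of 2] by auto
    show ?thesis
    proof (intro exI[of _ 1] conjI allI impI)
      fix h :: "'a \<Rightarrow> complex"
      assume h: "integrable lborel h" and h1: "Lp_norm q' h \<le> 1"
      have [measurable]: "h \<in> borel_measurable borel"
        using h by simp
      have "(\<integral>\<^sup>+x. ennreal ((norm (h x))\<^sup>2) \<partial>lborel) \<le> 1"
        using Lp_norm_le_iff[of 2 1 h] h1 unfolding e by (simp add: powr_numeral)
      then have "(\<integral>\<^sup>+\<xi>. ennreal ((norm (fourier h \<xi>))\<^sup>2) \<partial>lborel) \<le> 1"
        using bessel[OF h] by simp
      then have "Lp_norm p' (fourier h) \<le> ennreal 1"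
        unfolding e using Lp_norm_le_iff[of 2 1 "fourier h"] by (simp add: powr_numeral)
      moreover have "Lp_norm p' (\<lambda>\<xi>. fourier h \<xi> * complex_of_real (norm \<xi> powr (- \<beta>))) \<le> Lp_norm p' (fourier h)"
        unfolding b by (intro Lp_norm_mono p' norm_le) auto
      ultimately show "Lp_norm p' (\<lambda>\<xi>. fourier h \<xi> * complex_of_real (norm \<xi> powr (- \<beta>))) \<le> ennreal 1"
        by simp
    qed simp
  next
    case 3
    obtain Q where Q: "q = ennreal Q" "2 < Q" "recip q = 1 / Q"
      using q1 3 by (cases rule: exponent_cases) auto
    define u where "u = Q / (Q - 1)"
    have u: "1 < u" "u < 2" "1 / u = 1 - 1 / Q" "u / (u - 1) = Q"
      using Q by (auto simp: u_def field_simps)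
    have q'u: "q' = ennreal u"
      using recip_inj[of q' "ennreal u"] q' Q u recip_ennreal[of u] by auto
    have "1 / Q < 1 / 2"
      using Q by (simp add: field_simps)
    \<comment> \<open>Both alternatives of \<open>pq\<close> give 1/q \<le> 1/p: if \<beta> = 0,
      then 1/p = 1 - 1/q, which exceeds 1/q since q > 2. This yields u \<le> v; the other bound v
      \<le> Q expresses \<beta> \<ge> 0.\<close>
    have "\<beta> = 0 \<longrightarrow> recip p = 1 - recip q"
      using \<beta> by auto
    then have rp: "recip q \<le> recip p"
      using pq p recip_antimono[of p q] Q(3) \<open>1 / Q < 1 / 2\<close> by auto
    have rp2: "recip p \<le> 1 - recip q"
      using \<beta> by (auto simp: zero_le_mult_iff)
    then have "recip p' > 0"
      using p'(2) Q(2,3) zero_less_divide_1_iff[of Q] by linarith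
    then obtain v where v: "p' = ennreal v" "1 \<le> v" "recip p' = 1 / v"
      by - (rule exponent_cases[OF p'(1)], auto)
    have v1: "1 / v \<le> 1 / u" "1 / Q \<le> 1 / v"
      using v p' rp rp2 Q u by auto
    then have "u \<le> v" "v \<le> Q"
      using v u Q by (auto simp: inverse_eq_divide[symmetric])
    moreover have "\<beta> = DIM('a) * (1 / v + 1 / u - 1)"
      using \<beta> v p' Q u by simp
    ultimately show ?thesis
      unfolding q'u v(1) using u by (intro Pitt_dual_aux) auto
  qed
qed


section \<open>Duality: removing the regularisation, and recovering a norm from pairings\<close>

lemma borel_measurable_cnj [measurable]: "cnj \<in> borel_measurable borel"
  by (intro borel_measurable_continuous_onI continuous_intros)

text \<open>The substitution y = x - \<delta> z moves the parameter from the kernel into the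
  argument of h, so that one fixed kernel serves as the dominating function for all \<delta>. The
  heat parameter is \<delta>^2 because the kernel has width sqrt \<epsilon>.\<close>

lemma heat_conv_scaled:
  fixes h :: "'a::euclidean_space \<Rightarrow> complex"
  assumes [measurable]: "h \<in> borel_measurable borel" and d: "0 < \<delta>"
  shows "(LINT y|lborel. h y * heat (\<delta>\<^sup>2) (x - y)) = (LINT z|lborel. h (x - \<delta> *\<^sub>R z) * heat 1 z)"
proof -
  have e: "\<delta> ^ DIM('a) * (\<delta>\<^sup>2) powr (- real DIM('a) / 2) = 1"
  proof -
    have "(\<delta>\<^sup>2) powr (- real DIM('a) / 2) = \<delta> powr (- real DIM('a))"
      using d by (simp add: powr_powr flip: powr_numeral)
    then show ?thesis
      using d by (simp add: powr_minus powr_realpow)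
  qed
  have "(LINT y|lborel. h y * heat (\<delta>\<^sup>2) (x - y))
      = of_real (\<bar>- \<delta>\<bar> ^ DIM('a)) * (LINT z|lborel. h (x + (- \<delta>) *\<^sub>R z) * heat (\<delta>\<^sup>2) (x - (x + (- \<delta>) *\<^sub>R z)))"
    using d by (intro integral_lborel_affine) auto
  also have "\<dots> = (LINT z|lborel. of_real (\<delta> ^ DIM('a)) * (h (x - \<delta> *\<^sub>R z) * heat (\<delta>\<^sup>2) (\<delta> *\<^sub>R z)))"
    using d by (subst integral_mult_right_zero) simp
  also have "\<dots> = (LINT z|lborel. h (x - \<delta> *\<^sub>R z) * heat 1 z)"
  proof (rule Bochner_Integration.integral_cong[OF refl])
    fix z :: 'a
    have "gauss (1 / \<delta>\<^sup>2) (\<delta> *\<^sub>R z) = gauss 1 z"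
      using d by (simp add: gauss_def power_mult_distrib)
    then have "of_real (\<delta> ^ DIM('a)) * heat (\<delta>\<^sup>2) (\<delta> *\<^sub>R z) = complex_of_real (\<delta> ^ DIM('a) * (\<delta>\<^sup>2) powr (- real DIM('a) / 2)) * gauss 1 z"
      by (simp only: heat_def of_real_mult mult.assoc)
    also have "\<dots> = heat 1 z"
      unfolding e by (simp add: heat_def)
    finally show "of_real (\<delta> ^ DIM('a)) * (h (x - \<delta> *\<^sub>R z) * heat (\<delta>\<^sup>2) (\<delta> *\<^sub>R z)) = h (x - \<delta> *\<^sub>R z) * heat 1 z"
      by (metis mult.left_commute)
  qed
  finally show ?thesis .
qed

text \<open>Two applications of dominated convergence: inside with majorant M |heat 1|, outside with
  majorant M |f|. Continuity of h gives pointwise convergence, which is why test functions are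
  continuous first and merely measurable later.\<close>

lemma heat_conv_tendsto:
  fixes f h :: "'a::euclidean_space \<Rightarrow> complex"
  assumes f: "integrable lborel f" and h: "continuous_on UNIV h" and M: "\<And>x. norm (h x) \<le> M"
  shows "(\<lambda>n. LINT x|lborel. f x * cnj (LINT y|lborel. h y * heat ((1 / real (Suc n))\<^sup>2) (x - y)))
    \<longlonglongrightarrow> (LINT x|lborel. f x * cnj (h x))"
proof -
  define \<delta> where "\<delta> n = 1 / real (Suc n)" for n
  have d: "0 < \<delta> n" for n
    by (simp add: \<delta>_def)
  have d0: "\<delta> \<longlonglongrightarrow> 0"
    unfolding \<delta>_def using LIMSEQ_inverse_real_of_nat by (simp add: inverse_eq_divide)
  have M0: "0 \<le> M"
    using M norm_ge_zero order_trans by blast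
  have [measurable]: "h \<in> borel_measurable borel" "f \<in> borel_measurable borel"
    using h f by (auto intro: borel_measurable_continuous_onI)
  have i1: "integrable lborel (\<lambda>z. M * norm (heat 1 (z::'a)))"
    using integrable_heat[of 1, where 'a = 'a] by simp
  have inner: "(\<lambda>n. LINT y|lborel. h y * heat ((\<delta> n)\<^sup>2) (x - y)) \<longlonglongrightarrow> h x" for x
  proof -
    have "(\<lambda>n. LINT z|lborel. h (x - \<delta> n *\<^sub>R z) * heat 1 z) \<longlonglongrightarrow> (LINT z|lborel. h x * heat 1 (z::'a))"
    proof (rule integral_dominated_convergence[OF _ _ i1])
      show "AE z in lborel. (\<lambda>n. h (x - \<delta> n *\<^sub>R z) * heat 1 z) \<longlonglongrightarrow> h x * heat 1 z"
      proof (intro AE_I2 tendsto_intros)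
        fix z :: 'a
        have "(\<lambda>n. x - \<delta> n *\<^sub>R z) \<longlonglongrightarrow> x - 0 *\<^sub>R z"
          by (intro tendsto_intros d0)
        then show "(\<lambda>n. h (x - \<delta> n *\<^sub>R z)) \<longlonglongrightarrow> h x"
          using continuous_on_tendsto_compose[OF h, of "\<lambda>n. x - \<delta> n *\<^sub>R z" x sequentially] by simp
      qed
      show "AE z in lborel. norm (h (x - \<delta> n *\<^sub>R z) * heat 1 z) \<le> M * norm (heat 1 z)" for n
        using M by (auto simp: norm_mult intro!: mult_right_mono)
    qed measurable
    moreover have "(LINT z|lborel. h x * heat 1 (z::'a)) = h x"
      by (simp add: integral_heat)
    ultimately show ?thesis
      using d by (simp add: heat_conv_scaled integral_heat)
  qed
  have bound: "norm (LINT y|lborel. h y * heat ((\<delta> n)\<^sup>2) (x - y)) \<le> M" for n x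
  proof -
    have "ennreal (norm (LINT z|lborel. h (x - \<delta> n *\<^sub>R z) * heat 1 z))
        \<le> (\<integral>\<^sup>+z. ennreal (norm (h (x - \<delta> n *\<^sub>R z) * heat 1 z)) \<partial>lborel)"
      by (rule ennreal_norm_integral_le)
    also have "\<dots> \<le> (\<integral>\<^sup>+z. ennreal M * ennreal (norm (heat 1 (z::'a))) \<partial>lborel)"
      using M M0 by (intro nn_integral_mono) (auto simp: norm_mult ennreal_mult[symmetric] intro!: ennreal_leI mult_right_mono)
    also have "\<dots> = ennreal M"
      by (subst nn_integral_cmult) (auto simp: nn_integral_heat)
    finally show ?thesis
      using d M0 by (simp add: heat_conv_scaled)
  qed
  show ?thesis
    unfolding \<delta>_def[symmetric]
  proof (rule integral_dominated_convergence[where w = "\<lambda>x. norm (f x) * M"])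
    show "integrable lborel (\<lambda>x. norm (f x) * M)"
      using f by simp
    show "AE x in lborel. (\<lambda>n. f x * cnj (LINT y|lborel. h y * heat ((\<delta> n)\<^sup>2) (x - y))) \<longlonglongrightarrow> f x * cnj (h x)"
      by (intro AE_I2 tendsto_intros inner)
    show "AE x in lborel. norm (f x * cnj (LINT y|lborel. h y * heat ((\<delta> n)\<^sup>2) (x - y))) \<le> norm (f x) * M" for n
      using bound by (auto simp: norm_mult intro!: mult_left_mono)
  qed measurable
qed

lemma integrable_bounded_support:
  fixes h :: "'a::euclidean_space \<Rightarrow> complex"
  assumes [measurable]: "h \<in> borel_measurable borel" and "\<And>x. norm (h x) \<le> M" and "\<And>x. R < norm x \<Longrightarrow> h x = 0"
  shows "integrable lborel h"
proof (rule Bochner_Integration.integrable_bound)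
  show "integrable lborel (\<lambda>x::'a. \<bar>M\<bar> * indicator (cball 0 R) x)"
    by (intro integrable_mult_right integrable_real_indicator) (auto simp: emeasure_lborel_cball_finite[unfolded infinity_ennreal_def])
  show "AE x in lborel. norm (h x) \<le> norm (\<bar>M\<bar> * indicator (cball 0 R) x)"
    using assms(2,3) by (auto intro!: AE_I2 simp: indicator_def order_trans[OF assms(2) abs_ge_self] not_le)
qed measurable

text \<open>A measurable function is almost everywhere a limit of continuous functions, which are truncated
  in height and support so that dominated convergence applies.\<close>

lemma pairing_bound_extend:
  fixes f h :: "'a::euclidean_space \<Rightarrow> complex" and K s :: real
  assumes f: "integrable lborel f" and s: "1 \<le> s" and K: "0 \<le> K"
    and bound: "\<And>g M R. continuous_on UNIV g \<Longrightarrow> (\<And>x. norm (g x) \<le> M) \<Longrightarrow> (\<And>x. R < norm x \<Longrightarrow> g x = 0) \<Longrightarrow>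
      Lp_norm (ennreal s) g \<le> 1 \<Longrightarrow> norm (LINT x|lborel. f x * cnj (g x)) \<le> K"
    and h[measurable]: "h \<in> borel_measurable borel" and M: "\<And>x. norm (h x) \<le> M" and R: "\<And>x. R < norm x \<Longrightarrow> h x = 0"
    and h1: "Lp_norm (ennreal s) h \<le> 1"
  shows "norm (LINT x|lborel. f x * cnj (h x)) \<le> K"
proof -
  have M0: "0 \<le> M"
    using M norm_ge_zero order_trans by blast
  have [measurable]: "f \<in> borel_measurable borel"
    using f by simp
  have "h \<in> borel_measurable lebesgue"
    using h by (simp add: measurable_completion)
  then have "h measurable_on UNIV"
    by (rule lebesgue_measurable_imp_measurable_on) simp
  then obtain N g where N: "negligible N" and cont: "\<And>n. continuous_on UNIV (g n)"
    and lim: "\<And>x. x \<notin> N \<Longrightarrow> (\<lambda>n. g n x) \<longlonglongrightarrow> h x"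
    unfolding measurable_on_def by auto
  have AE_N: "AE x in lborel. x \<notin> N"
    using N AE_not_in[of N lebesgue] by (auto simp: negligible_iff_null_sets AE_completion_iff)
  define M' where "M' = M + 1"
  have M': "0 < M'" "M \<le> M'" "M < M'"
    using M0 by (auto simp: M'_def)
  \<comment> \<open>A continuous cutoff: 1 on the ball of radius R, where h lives, and 0 outside
    radius R + 1. The quotient in \<open>hh\<close> truncates moduli continuously at M', which
    exceeds |h| and so leaves the limit unchanged.\<close>
  define \<theta> where "\<theta> x = max 0 (min 1 (R + 1 - norm x))" for x :: 'a
  define hh where "hh n x = complex_of_real (\<theta> x * (M' / max M' (norm (g n x)))) * g n x" for n x
  have \<theta>: "0 \<le> \<theta> x" "\<theta> x \<le> 1" for x
    by (auto simp: \<theta>_def)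
  have hh_cont: "continuous_on UNIV (hh n)" for n
    unfolding hh_def \<theta>_def using M' cont[of n] by (intro continuous_intros) auto
  have [measurable]: "hh n \<in> borel_measurable borel" for n
    by (rule borel_measurable_continuous_onI[OF hh_cont])
  have hh_le: "norm (hh n x) \<le> M'" for n x
  proof -
    have "norm (hh n x) = \<theta> x * (M' * (norm (g n x) / max M' (norm (g n x))))"
      using M' \<theta>[of x] by (simp add: hh_def norm_mult norm_divide)
    also have "\<dots> \<le> 1 * (M' * 1)"
      using M' \<theta>[of x] by (intro mult_mono) (auto simp: divide_le_eq_1)
    finally show ?thesis by simp
  qed
  have hh_0: "hh n x = 0" if "R + 1 < norm x" for n x
    using that by (simp add: hh_def \<theta>_def)
  have hh_lim: "(\<lambda>n. hh n x) \<longlonglongrightarrow> h x" if "x \<notin> N" for x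
  proof -
    have "(\<lambda>n. hh n x) \<longlonglongrightarrow> complex_of_real (\<theta> x * (M' / max M' (norm (h x)))) * h x"
      unfolding hh_def using M' by (intro tendsto_intros lim that) auto
    moreover have "complex_of_real (\<theta> x * (M' / max M' (norm (h x)))) * h x = h x"
      using M[of x] M' R[of x] by (cases "R < norm x") (auto simp: \<theta>_def max_def)
    ultimately show ?thesis by simp
  qed
  have lim_int: "(\<lambda>n. LINT x|lborel. f x * cnj (hh n x)) \<longlonglongrightarrow> (LINT x|lborel. f x * cnj (h x))"
  proof (rule integral_dominated_convergence[where w = "\<lambda>x. norm (f x) * M'"])
    show "integrable lborel (\<lambda>x. norm (f x) * M')"
      using f by simp
    show "AE x in lborel. (\<lambda>n. f x * cnj (hh n x)) \<longlonglongrightarrow> f x * cnj (h x)"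
      using AE_N by eventually_elim (intro tendsto_intros hh_lim)
    show "AE x in lborel. norm (f x * cnj (hh n x)) \<le> norm (f x) * M'" for n
      using hh_le by (auto simp: norm_mult intro!: mult_left_mono)
  qed measurable
  have lim_norm: "(\<lambda>n. LINT x|lborel. norm (hh n x) powr s) \<longlonglongrightarrow> (LINT x|lborel. norm (h x) powr s)"
  proof (rule integral_dominated_convergence[where w = "\<lambda>x. M' powr s * indicator (cball 0 (R + 1)) x"])
    show "integrable lborel (\<lambda>x::'a. M' powr s * indicator (cball 0 (R + 1)) x)"
      by (intro integrable_mult_right integrable_real_indicator) (auto simp: emeasure_lborel_cball_finite[unfolded infinity_ennreal_def])
    show "AE x in lborel. (\<lambda>n. norm (hh n x) powr s) \<longlonglongrightarrow> norm (h x) powr s"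
      using AE_N
    proof eventually_elim
      case (elim x)
      then show ?case
        using s by (intro tendsto_powr2 tendsto_intros hh_lim) auto
    qed
    show "AE x in lborel. norm (norm (hh n x) powr s) \<le> M' powr s * indicator (cball 0 (R + 1)) x" for n
    proof (rule AE_I2)
      fix x
      show "norm (norm (hh n x) powr s) \<le> M' powr s * indicator (cball 0 (R + 1)) x"
        using hh_le[of n x] hh_0[of x n] s by (cases "norm x \<le> R + 1") (auto intro!: powr_mono2)
    qed
  qed measurable
  have int_hh: "integrable lborel (\<lambda>x. norm (hh n x) powr s)" for n
  proof -
    have "integrable lborel (\<lambda>x. complex_of_real (norm (hh n x) powr s))"
      using hh_le s M' by (intro integrable_bounded_support[where M = "M' powr s" and R = "R + 1"])
        (auto simp: hh_0 intro!: powr_mono2)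
    then show ?thesis
      by (simp only: complex_of_real_integrable_eq)
  qed
  have int_h: "integrable lborel (\<lambda>x. norm (h x) powr s)"
  proof -
    have "integrable lborel (\<lambda>x. complex_of_real (norm (h x) powr s))"
      using M s by (intro integrable_bounded_support[where M = "M powr s" and R = R])
        (auto simp: R intro!: powr_mono2)
    then show ?thesis
      by (simp only: complex_of_real_integrable_eq)
  qed
  have h_int1: "(LINT x|lborel. norm (h x) powr s) \<le> 1"
    using h1 Lp_norm_le_iff[of s 1 h] s nn_integral_eq_integral[OF int_h] by simp
  \<comment> \<open>The approximants need not have norm at most 1, but the integrals of their s-th
    powers converge to that of h. From some n on they are below (1 + \<eta>)^s, and division by 1 +
    \<eta> makes the approximants admissible in \<open>bound\<close>.\<close>
  have "norm (LINT x|lborel. f x * cnj (h x)) \<le> (1 + \<eta>) * K" if \<eta>: "0 < \<eta>" for \<eta>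
  proof -
    define c where "c = 1 / (1 + \<eta>)"
    have c: "0 < c" "c * (1 + \<eta>) = 1" "c \<le> 1"
      using \<eta> by (auto simp: c_def)
    have "1 < (1 + \<eta>) powr s"
      using \<eta> s by (intro gr_one_powr) auto
    then have "eventually (\<lambda>n. (LINT x|lborel. norm (hh n x) powr s) < (1 + \<eta>) powr s) sequentially"
      using lim_norm h_int1 by (intro order_tendstoD(2)[OF lim_norm]) auto
    then have "eventually (\<lambda>n. norm (LINT x|lborel. f x * cnj (hh n x)) \<le> (1 + \<eta>) * K) sequentially"
    proof eventually_elim
      case (elim n)
      have "(\<integral>\<^sup>+x. ennreal (norm (hh n x) powr s) \<partial>lborel) \<le> ennreal ((1 + \<eta>) powr s)"
        using elim nn_integral_eq_integral[OF int_hh] by (simp add: ennreal_leI)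
      then have "Lp_norm (ennreal s) (hh n) \<le> ennreal (1 + \<eta>)"
        using Lp_norm_le_iff[of s "1 + \<eta>" "hh n"] s \<eta> by simp
      then have "ennreal (c) * Lp_norm (ennreal s) (hh n) \<le> ennreal (c) * ennreal (1 + \<eta>)"
        by (intro mult_left_mono) auto
      then have n1: "Lp_norm (ennreal s) (\<lambda>x. complex_of_real (c) * hh n x) \<le> 1"
        using s \<eta> c by (subst Lp_norm_scale) (auto simp: ennreal_mult[symmetric] simp del: ennreal_plus)
      have "norm (LINT x|lborel. f x * cnj (complex_of_real (c) * hh n x)) \<le> K"
      proof (rule bound[where M = M' and R = "R + 1", OF _ _ _ n1])
        show "continuous_on UNIV (\<lambda>x. complex_of_real (c) * hh n x)"
          by (intro continuous_intros hh_cont)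
        show "norm (complex_of_real (c) * hh n x) \<le> M'" for x
          using mult_mono[of "c" 1 "norm (hh n x)" M'] hh_le[of n x] c M'
          by (simp add: norm_mult)
      qed (simp add: hh_0)
      also have "(LINT x|lborel. f x * cnj (complex_of_real (c) * hh n x))
          = (LINT x|lborel. complex_of_real (c) * (f x * cnj (hh n x)))"
        by (simp add: mult_ac)
      also have "\<dots> = complex_of_real (c) * (LINT x|lborel. f x * cnj (hh n x))"
        by (rule integral_mult_right_zero)
      finally show ?case
        using c \<eta> mult_left_mono[of "c * norm (LINT x|lborel. f x * cnj (hh n x))" K "1 + \<eta>"]
        by (simp add: norm_mult mult.assoc[symmetric] mult.commute[of "1 + \<eta>"])
    qed
    then show ?thesis
      using tendsto_norm[OF lim_int] by (intro tendsto_upperbound[OF tendsto_norm[OF lim_int]]) auto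
  qed
  note * = this
  show ?thesis
  proof (rule field_le_epsilon)
    fix e :: real assume e: "0 < e"
    have "norm (LINT x|lborel. f x * cnj (h x)) \<le> (1 + e / (K + 1)) * K"
      using e K by (intro *) auto
    also have "\<dots> \<le> K + e"
      using e K by (simp add: field_simps)
    finally show "norm (LINT x|lborel. f x * cnj (h x)) \<le> K + e" .
  qed
qed


lemma mult_cnj_sgn: "z * cnj (sgn z) = complex_of_real (norm z)"
proof (cases "z = 0")
  case False
  have "z * cnj (sgn z) = (z * cnj z) / complex_of_real (norm z)"
    by (simp add: sgn_div_norm scaleR_conv_of_real divide_inverse mult_ac)
  also have "\<dots> = complex_of_real (norm z)"
    using False by (simp add: complex_norm_square[symmetric] power2_eq_square)
  finally show ?thesis .
qed simp

text \<open>The extremiser of Hoelder's inequality, a multiple of |f|^(Q-1) sgn f, is cut to the set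
  \<open>E n\<close>, where it is bounded with bounded support. Pairing with it gives the truncated
  norm, and Fatou's lemma lets n tend to infinity.\<close>

lemma Lp_norm_le_by_pairing_finite:
  fixes f :: "'a::euclidean_space \<Rightarrow> complex" and K Q s :: real
  assumes [measurable]: "f \<in> borel_measurable borel" and Q: "1 < Q" and s: "s = Q / (Q - 1)" and K: "0 \<le> K"
    and bound: "\<And>h M R. h \<in> borel_measurable borel \<Longrightarrow> (\<And>x. norm (h x) \<le> M) \<Longrightarrow> (\<And>x. R < norm x \<Longrightarrow> h x = 0) \<Longrightarrow>
      Lp_norm (ennreal s) h \<le> 1 \<Longrightarrow> norm (LINT x|lborel. f x * cnj (h x)) \<le> K"
  shows "Lp_norm (ennreal Q) f \<le> ennreal K"
proof -
  have s1: "1 < s" "(Q - 1) * s = Q" "1 - 1 / s = 1 / Q"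
    using Q by (auto simp: s field_simps)
  define E where "E n = {x. norm x \<le> real n \<and> norm (f x) \<le> real n}" for n :: nat
  have [measurable]: "E n \<in> sets borel" for n
    unfolding E_def by measurable
  define F where "F n x = (if x \<in> E n then norm (f x) powr Q else 0)" for n x
  have [measurable]: "F n \<in> borel_measurable borel" for n
    unfolding F_def by measurable
  have int: "integrable lborel (F n)" for n
  proof -
    have "integrable lborel (\<lambda>x. complex_of_real (F n x))"
      using Q by (intro integrable_bounded_support[where M = "real n powr Q" and R = "real n"])
        (auto simp: F_def E_def intro!: powr_mono2)
    then show ?thesis
      by (simp only: complex_of_real_integrable_eq)
  qed
  have F_le: "(\<integral>\<^sup>+x. ennreal (F n x) \<partial>lborel) \<le> ennreal (K powr Q)" for n
  proof -
    define i where "i = (LINT x|lborel. F n x)"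
    have i0: "0 \<le> i"
      unfolding i_def by (intro Bochner_Integration.integral_nonneg) (auto simp: F_def)
    have eq: "(\<integral>\<^sup>+x. ennreal (F n x) \<partial>lborel) = ennreal i"
      unfolding i_def by (intro nn_integral_eq_integral int) (simp add: F_def)
    have "i \<le> K powr Q"
    proof (cases "i = 0")
      case False
      with i0 have i: "0 < i" by simp
      \<comment> \<open>c normalises the test function: |h|^s equals \<open>F n\<close> / i, which
        has integral 1, and the pairing becomes c i = i^(1/Q).\<close>
      define c where "c = 1 / i powr (1 / s)"
      have c: "0 < c" "c powr s = 1 / i"
        using i s1 by (auto simp: c_def powr_divide powr_powr)
      define h where "h x = (if x \<in> E n then complex_of_real (c * norm (f x) powr (Q - 1)) * sgn (f x) else 0)" for x
      have nh: "norm (h x) = (if x \<in> E n then c * norm (f x) powr (Q - 1) else 0)" for x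
        using c by (auto simp: h_def norm_mult norm_sgn)
      have hf: "f x * cnj (h x) = complex_of_real (c * F n x)" for x
      proof (cases "x \<in> E n")
        case True
        have "f x * cnj (h x) = complex_of_real (c * norm (f x) powr (Q - 1)) * (f x * cnj (sgn (f x)))"
          using True by (simp add: h_def mult_ac)
        also have "\<dots> = complex_of_real (c * (norm (f x) * norm (f x) powr (Q - 1)))"
          by (simp add: mult_cnj_sgn)
        also have "norm (f x) * norm (f x) powr (Q - 1) = norm (f x) powr Q"
          using powr_mult_base[of "norm (f x)" "Q - 1"] by simp
        finally show ?thesis
          using True by (simp add: F_def)
      qed (simp add: h_def F_def)
      have "norm (LINT x|lborel. f x * cnj (h x)) \<le> K"
      proof (rule bound[where M = "c * real n powr (Q - 1)" and R = "real n"])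
        show "h \<in> borel_measurable borel"
          unfolding h_def by measurable
        show "norm (h x) \<le> c * real n powr (Q - 1)" for x
          using c Q by (auto simp: nh E_def intro!: mult_left_mono powr_mono2)
        show "h x = 0" if "real n < norm x" for x
          using that by (auto simp: h_def E_def)
        have "(\<integral>\<^sup>+x. ennreal (norm (h x) powr s) \<partial>lborel) = (\<integral>\<^sup>+x. ennreal (1 / i) * ennreal (F n x) \<partial>lborel)"
        proof (intro nn_integral_cong)
          fix x
          have "norm (h x) powr s = 1 / i * F n x"
            using c s1 i by (auto simp: nh F_def powr_mult powr_powr)
          then show "ennreal (norm (h x) powr s) = ennreal (1 / i) * ennreal (F n x)"
            using i by (simp add: ennreal_mult[symmetric] F_def)
        qed
        also have "\<dots> = ennreal (1 / i) * ennreal i"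
          by (subst nn_integral_cmult) (auto simp: eq)
        also have "\<dots> = 1"
          using i by (simp add: ennreal_mult[symmetric])
        finally show "Lp_norm (ennreal s) h \<le> 1"
          using Lp_norm_le_iff[of s 1 h] s1 by simp
      qed
      also have "(LINT x|lborel. f x * cnj (h x)) = complex_of_real (c * i)"
        unfolding hf integral_complex_of_real i_def by simp
      also have "norm (complex_of_real (c * i)) = i powr (1 / Q)"
        using c i by (simp only: norm_of_real s1(3)[symmetric]) (simp add: c_def powr_diff)
      finally have "(i powr (1 / Q)) powr Q \<le> K powr Q"
        using Q by (intro powr_mono2) auto
      then show ?thesis
        using Q i by (simp add: powr_powr)
    qed simp
    then show ?thesis
      unfolding eq by (rule ennreal_leI)
  qed
  have lim: "(\<lambda>n. ennreal (F n x)) \<longlonglongrightarrow> ennreal (norm (f x) powr Q)" for x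
  proof (rule tendsto_eventually)
    obtain m :: nat where m: "max (norm x) (norm (f x)) \<le> real m"
      using real_arch_simple by blast
    show "eventually (\<lambda>n. ennreal (F n x) = ennreal (norm (f x) powr Q)) sequentially"
      using eventually_ge_at_top[of m] by eventually_elim (use m in \<open>auto simp: F_def E_def\<close>)
  qed
  have "(\<integral>\<^sup>+x. ennreal (norm (f x) powr Q) \<partial>lborel) = (\<integral>\<^sup>+x. liminf (\<lambda>n. ennreal (F n x)) \<partial>lborel)"
    by (intro nn_integral_cong lim_imp_Liminf[OF sequentially_bot lim, symmetric])
  also have "\<dots> \<le> liminf (\<lambda>n. \<integral>\<^sup>+x. ennreal (F n x) \<partial>lborel)"
    by (intro nn_integral_liminf) measurable
  also have "\<dots> \<le> liminf (\<lambda>n::nat. ennreal (K powr Q))"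
    by (intro Liminf_mono always_eventually allI F_le)
  also have "\<dots> = ennreal (K powr Q)"
    by (simp add: Liminf_const)
  finally show ?thesis
    using Q K by (subst Lp_norm_le_iff) auto
qed

text \<open>If |f| \<ge> K + 1/(n+1) held on a bounded set of positive measure, pairing f with sgn f
  on this set, divided by the measure, would give more than K.\<close>

lemma Lp_norm_le_by_pairing_inf:
  fixes f :: "'a::euclidean_space \<Rightarrow> complex" and K :: real
  assumes f: "integrable lborel f" and K: "0 \<le> K"
    and bound: "\<And>h M R. h \<in> borel_measurable borel \<Longrightarrow> (\<And>x. norm (h x) \<le> M) \<Longrightarrow> (\<And>x. R < norm x \<Longrightarrow> h x = 0) \<Longrightarrow>
      Lp_norm (ennreal 1) h \<le> 1 \<Longrightarrow> norm (LINT x|lborel. f x * cnj (h x)) \<le> K"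
  shows "Lp_norm top f \<le> ennreal K"
proof -
  have [measurable]: "f \<in> borel_measurable borel"
    using f by simp
  define k where "k n = K + 1 / real (Suc n)" for n
  define E where "E n = {x. norm x \<le> real n \<and> k n \<le> norm (f x)}" for n :: nat
  have [measurable]: "E n \<in> sets borel" for n
    unfolding E_def by measurable
  have null: "E n \<in> null_sets lborel" for n
  proof (rule ccontr)
    assume "E n \<notin> null_sets lborel"
    moreover have fin: "emeasure lborel (E n) < \<infinity>"
    proof -
      have "emeasure lborel (E n) \<le> emeasure lborel (cball (0::'a) (real n))"
        by (intro emeasure_mono) (auto simp: E_def)
      then show ?thesis
        using emeasure_lborel_cball_finite[of "0::'a" "real n"] by (rule order_le_less_trans)
    qed
    ultimately obtain e where e: "emeasure lborel (E n) = ennreal e" "0 < e"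
      by (cases "emeasure lborel (E n)") (auto simp: null_sets_def less_le)
    define h where "h x = (if x \<in> E n then complex_of_real (1 / e) * sgn (f x) else 0)" for x
    define L where "L = (LINT x|lborel. norm (f x) * indicator (E n) x)"
    have le: "norm (LINT x|lborel. f x * cnj (h x)) \<le> K"
    proof (rule bound[where M = "1 / e" and R = "real n"])
      show "h \<in> borel_measurable borel"
        unfolding h_def by measurable
      show "norm (h x) \<le> 1 / e" for x
        using e by (auto simp: h_def norm_mult norm_sgn norm_divide)
      show "h x = 0" if "real n < norm x" for x
        using that by (auto simp: h_def E_def)
      have "(\<integral>\<^sup>+x. ennreal (norm (h x) powr 1) \<partial>lborel) \<le> (\<integral>\<^sup>+x. ennreal (1 / e) * indicator (E n) x \<partial>lborel)"
        using e by (intro nn_integral_mono) (auto simp: h_def norm_mult norm_sgn norm_divide)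
      also have "\<dots> = 1"
        using e by (subst nn_integral_cmult_indicator) (auto simp: ennreal_mult[symmetric])
      finally show "Lp_norm (ennreal 1) h \<le> 1"
        using Lp_norm_le_iff[of 1 1 h] by simp
    qed
    have "f x * cnj (h x) = complex_of_real (1 / e * (norm (f x) * indicator (E n) x))" for x
      using mult_cnj_sgn[of "f x"] by (auto simp: h_def)
    then have "(LINT x|lborel. f x * cnj (h x)) = complex_of_real (1 / e * L)"
      by (simp only: integral_complex_of_real integral_mult_right_zero L_def)
    then have "\<bar>1 / e * L\<bar> \<le> K"
      using le by (simp only: norm_of_real)
    then have "L \<le> K * e"
      using e by (simp add: abs_mult divide_simps)
    moreover have "k n * e \<le> L"
    proof -
      have "k n * e = (LINT x|lborel. k n * indicator (E n) x)"
        using e by (simp add: measure_def)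
      also have "\<dots> \<le> (LINT x|lborel. norm (f x) * indicator (E n) x)"
      proof (intro integral_mono)
        show "integrable lborel (\<lambda>x. k n * indicator (E n) x)"
          using fin by (intro integrable_mult_right integrable_real_indicator) auto
        show "integrable lborel (\<lambda>x. norm (f x) * indicator (E n) x)"
          using f by (intro integrable_real_mult_indicator) auto
      qed (auto simp: E_def indicator_def)
      finally show ?thesis
        by (simp add: L_def)
    qed
    ultimately have "k n * e \<le> K * e"
      by simp
    then show False
      using e by (simp add: k_def)
  qed
  have "AE x in lborel. \<forall>n. x \<notin> E n"
    using AE_not_in[OF null] by (simp add: AE_all_countable)
  then have "AE x in lborel. ennreal (norm (f x)) \<le> ennreal K"
  proof eventually_elim
    case (elim x)
    have "norm (f x) \<le> K + e" if e: "0 < e" for e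
    proof -
      obtain m :: nat where m: "norm x \<le> real m"
        using real_arch_simple by blast
      obtain m' :: nat where m': "1 / real (Suc m') < e"
        using e nat_approx_posE by blast
      define n where "n = max m m'"
      have "norm x \<le> real n"
        using m by (simp add: n_def)
      then have "norm (f x) < k n"
        using elim[rule_format, of n] by (auto simp: E_def)
      also have "k n \<le> K + 1 / real (Suc m')"
        by (simp add: k_def n_def frac_le)
      finally show ?thesis
        using m' by simp
    qed
    then show ?case
      by - (rule ennreal_leI, rule field_le_epsilon, simp)
  qed
  then show ?thesis
    by (subst Lp_norm_inf_le_iff) auto
qed

text \<open>The case \<open>\<beta> = 0\<close> is the Hausdorff--Young inequality for the inverse transform.\<close>

theorem Pitt_inequality:
  fixes p q :: ennreal and \<beta> :: real
  assumes p: "1 \<le> p" and q: "2 \<le> q"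
    and \<beta>: "0 \<le> \<beta>" "\<beta> = DIM('a) * (1 - recip q - recip p)"
    and pq: "\<beta> = 0 \<or> p \<le> q \<and> q < \<infinity>"
  shows "\<exists>C>0. \<forall>f::'a::euclidean_space \<Rightarrow> complex. integrable lborel f \<longrightarrow>
    Lp_norm q f \<le> ennreal C * Lp_norm p (\<lambda>\<xi>. fourier f \<xi> * complex_of_real (norm \<xi> powr \<beta>))"
proof -
  have q1: "1 \<le> q"
    using q by (meson one_le_numeral order_trans)
  define p' q' where "p' = exponent (1 - recip p)" and "q' = exponent (1 - recip q)"
  have p': "1 \<le> p'" "recip p' = 1 - recip p"
    unfolding p'_def using recip_nonneg[of p] recip_le_1[OF p] by (intro exponent; simp)+
  have q': "1 \<le> q'" "recip q' = 1 - recip q"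
    unfolding q'_def using recip_nonneg[of q] recip_le_1[OF q1] by (intro exponent; simp)+
  have "recip q \<le> 1 / 2"
    using recip_antimono[of 2 q] q recip_ennreal[of 2] by simp
  then have "0 < recip q'"
    using q' by simp
  then obtain s where s: "q' = ennreal s" "1 \<le> s" "recip q' = 1 / s"
    by - (rule exponent_cases[OF q'(1)], auto)
  obtain C where C: "0 < C" "\<And>h::'a \<Rightarrow> complex. integrable lborel h \<Longrightarrow> Lp_norm q' h \<le> 1 \<Longrightarrow>
    Lp_norm p' (\<lambda>\<xi>. fourier h \<xi> * complex_of_real (norm \<xi> powr (- \<beta>))) \<le> ennreal C"
    using Pitt_dual[OF p q p' q' \<beta> pq] by blast
  show ?thesis
  proof (intro exI[of _ C] conjI allI impI C)
    fix f :: "'a \<Rightarrow> complex"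
    assume f: "integrable lborel f"
    have [measurable]: "f \<in> borel_measurable borel"
      using f by simp
    define A where "A = Lp_norm p (\<lambda>\<xi>. fourier f \<xi> * complex_of_real (norm \<xi> powr \<beta>))"
    show "Lp_norm q f \<le> ennreal C * A"
    proof (cases A)
      case top
      then show ?thesis
        using C(1) by (simp add: ennreal_mult_top)
    next
      case (real a)
      define K where "K = C * a"
      have K: "0 \<le> K" "ennreal K = ennreal C * A"
        using real C(1) by (auto simp: K_def ennreal_mult)
      have pair_cont: "norm (LINT x|lborel. f x * cnj (g x)) \<le> K"
        if g: "continuous_on UNIV g" "\<And>x. norm (g x) \<le> M" "\<And>x. R < norm x \<Longrightarrow> g x = 0" and g1: "Lp_norm (ennreal s) g \<le> 1"
        for g :: "'a \<Rightarrow> complex" and M R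
      proof -
        have [measurable]: "g \<in> borel_measurable borel"
          using g by (intro borel_measurable_continuous_onI)
        have gi: "integrable lborel g"
          using g by (intro integrable_bounded_support[of g M R]) auto
        have bnd: "norm (LINT x|lborel. f x * cnj (LINT y|lborel. g y * heat \<epsilon> (x - y))) \<le> K" if \<epsilon>: "0 < \<epsilon>" for \<epsilon>
        proof -
          have "ennreal (norm (LINT x|lborel. f x * cnj (LINT y|lborel. g y * heat \<epsilon> (x - y))))
            = ennreal (norm (LINT \<xi>|lborel. fourier f \<xi> * (cnj (fourier g \<xi>) * gauss \<epsilon> \<xi>)))"
            by (subst fourier_parseval_gauss[OF f gi \<epsilon>]) simp
          also have "\<dots> \<le> (\<integral>\<^sup>+\<xi>. ennreal (norm (fourier f \<xi> * (cnj (fourier g \<xi>) * gauss \<epsilon> \<xi>))) \<partial>lborel)"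
            by (rule ennreal_norm_integral_le)
          also have "\<dots> = Lp_norm 1 (\<lambda>\<xi>. fourier f \<xi> * (cnj (fourier g \<xi>) * gauss \<epsilon> \<xi>))"
            by (simp only: Lp_norm_1)
          \<comment> \<open>The weights |\<xi>|^\<beta> and |\<xi>|^(-\<beta>) are inserted to
            prepare Hoelder's inequality. They cancel except at the origin, where
            \<open>powr\<close> makes both vanish or equal 0, hence an almost everywhere
            comparison.\<close>
          also have "\<dots> \<le> Lp_norm 1 (\<lambda>\<xi>. (fourier f \<xi> * complex_of_real (norm \<xi> powr \<beta>)) * (fourier g \<xi> * complex_of_real (norm \<xi> powr (- \<beta>))))"
          proof (rule Lp_norm_AE_mono)
            show "AE \<xi> in lborel. norm (fourier f \<xi> * (cnj (fourier g \<xi>) * gauss \<epsilon> \<xi>))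
              \<le> norm ((fourier f \<xi> * complex_of_real (norm \<xi> powr \<beta>)) * (fourier g \<xi> * complex_of_real (norm \<xi> powr (- \<beta>))))"
              using AE_lborel_singleton[of "0::'a"]
            proof eventually_elim
              case (elim \<xi>)
              have "norm (gauss \<epsilon> \<xi>) \<le> 1"
                using \<epsilon> by (simp add: norm_gauss)
              then have "norm (fourier f \<xi>) * norm (fourier g \<xi>) * norm (gauss \<epsilon> \<xi>) \<le> norm (fourier f \<xi>) * norm (fourier g \<xi>) * 1"
                by (intro mult_left_mono) auto
              moreover have "norm \<xi> powr \<beta> * norm \<xi> powr (- \<beta>) = 1"
                using elim by (simp flip: powr_add)
              ultimately show ?case
                by (simp add: norm_mult mult.assoc mult.left_commute[of "norm \<xi> powr \<beta>"])
            qed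
          qed auto
          also have "\<dots> \<le> A * Lp_norm p' (\<lambda>\<xi>. fourier g \<xi> * complex_of_real (norm \<xi> powr (- \<beta>)))"
            unfolding A_def using p p' recip_ennreal[of 1] by (intro Lp_norm_Holder) auto
          also have "\<dots> \<le> A * ennreal C"
            using C(2)[OF gi] g1 s by (intro mult_left_mono) auto
          finally have "ennreal (norm (LINT x|lborel. f x * cnj (LINT y|lborel. g y * heat \<epsilon> (x - y)))) \<le> ennreal K"
            by (simp only: K(2) mult.commute)
          then show ?thesis
            using K(1) by simp
        qed
        show ?thesis
          using bnd by (intro tendsto_upperbound[OF tendsto_norm[OF heat_conv_tendsto[OF f g(1,2)]]]) auto
      qed
      have pair: "norm (LINT x|lborel. f x * cnj (h x)) \<le> K"
        if "h \<in> borel_measurable borel" "\<And>x. norm (h x) \<le> M" "\<And>x. R < norm x \<Longrightarrow> h x = 0" "Lp_norm (ennreal s) h \<le> 1"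
        for h :: "'a \<Rightarrow> complex" and M R
        using that by (intro pairing_bound_extend[OF f s(2) K(1) pair_cont])
      show ?thesis
      proof (cases rule: exponent_cases[OF q1])
        case 1
        then have "s = 1"
          using s q' by simp
        then show ?thesis
          unfolding 1 K(2)[symmetric] using pair by (intro Lp_norm_le_by_pairing_inf f K) auto
      next
        case (2 Q)
        have "1 / Q \<le> 1 / 2" and e: "1 / s = 1 - 1 / Q"
          using 2(3) q'(2) s(3) \<open>recip q \<le> 1 / 2\<close> by auto
        then have Q: "1 < Q"
          using 2(1) by (simp add: field_simps)
        have "s = 1 / (1 / s)"
          by simp
        also have "\<dots> = Q / (Q - 1)"
          unfolding e using Q by (simp add: field_simps)
        finally have "s = Q / (Q - 1)" .
        with Q show ?thesis
          unfolding 2 K(2)[symmetric] using pair by (intro Lp_norm_le_by_pairing_finite[where s = s] K) auto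
      qed
    qed
  qed
qed

section \<open>The strict case\<close>

lemma Lp_norm_less_top_iff:
  assumes "1 \<le> P"
  shows "Lp_norm (ennreal P) f < top \<longleftrightarrow> (\<integral>\<^sup>+x. ennreal (norm (f x) powr P) \<partial>lborel) < top"
proof
  assume "Lp_norm (ennreal P) f < top"
  then obtain c where "0 \<le> c" "Lp_norm (ennreal P) f = ennreal c"
    by (cases "Lp_norm (ennreal P) f") auto
  then have "(\<integral>\<^sup>+x. ennreal (norm (f x) powr P) \<partial>lborel) \<le> ennreal (c powr P)"
    using Lp_norm_le_iff[OF assms, of c f] by simp
  then show "(\<integral>\<^sup>+x. ennreal (norm (f x) powr P) \<partial>lborel) < top"
    using ennreal_less_top order_le_less_trans by blast
next
  assume "(\<integral>\<^sup>+x. ennreal (norm (f x) powr P) \<partial>lborel) < top"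
  then obtain i where i: "0 \<le> i" "(\<integral>\<^sup>+x. ennreal (norm (f x) powr P) \<partial>lborel) = ennreal i"
    by (cases "\<integral>\<^sup>+x. ennreal (norm (f x) powr P) \<partial>lborel") auto
  then have "Lp_norm (ennreal P) f \<le> ennreal (i powr (1 / P))"
    using assms by (subst Lp_norm_le_iff) (auto simp: powr_powr)
  then show "Lp_norm (ennreal P) f < top"
    using ennreal_less_top order_le_less_trans by blast
qed

lemma Lp_norm_less_topI:
  fixes f :: "'a::euclidean_space \<Rightarrow> complex"
  assumes p: "1 \<le> p" and f: "f \<in> borel_measurable borel" and M: "\<And>x. norm (f x) \<le> M"
    and int: "\<And>P. p = ennreal P \<Longrightarrow> 1 \<le> P \<Longrightarrow> (\<integral>\<^sup>+x. ennreal (norm (f x) powr P) \<partial>lborel) < top"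
  shows "Lp_norm p f < top"
  using p
proof (cases rule: exponent_cases)
  case inf
  have "Lp_norm top f \<le> ennreal M"
    using f M by (subst Lp_norm_inf_le_iff) (auto intro: ennreal_leI)
  then show ?thesis
    unfolding inf using ennreal_less_top order_le_less_trans by blast
next
  case (fin P)
  then show ?thesis
    using int[of P] by (simp add: Lp_norm_less_top_iff)
qed

definition unit_ind :: "'a::euclidean_space \<Rightarrow> complex" where
  "unit_ind x = (if norm x \<le> 1 then 1 else 0)"

lemma borel_measurable_unit_ind [measurable]: "unit_ind \<in> borel_measurable borel"
  unfolding unit_ind_def by measurable

lemma Lp_norm_unit_ind:
  assumes "1 \<le> p"
  shows "Lp_norm p (unit_ind :: 'a::euclidean_space \<Rightarrow> complex) < top"
proof (rule Lp_norm_less_topI[OF assms])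
  show "norm (unit_ind x) \<le> 1" for x :: 'a
    by (simp add: unit_ind_def)
  fix P :: real
  have "(\<integral>\<^sup>+x. ennreal (norm (unit_ind (x::'a) :: complex) powr P) \<partial>lborel) = (\<integral>\<^sup>+x. indicator (cball (0::'a) 1) x \<partial>lborel)"
    by (intro nn_integral_cong) (auto simp: unit_ind_def indicator_def)
  also have "\<dots> < top"
    by (simp add: emeasure_lborel_cball_finite[unfolded infinity_ennreal_def])
  finally show "(\<integral>\<^sup>+x. ennreal (norm (unit_ind (x::'a) :: complex) powr P) \<partial>lborel) < top" .
qed measurable

section \<open>Low and high frequencies by means of heat convolutions\<close>

definition heat_conv :: "real \<Rightarrow> ('a::euclidean_space \<Rightarrow> complex) \<Rightarrow> 'a \<Rightarrow> complex" where
  "heat_conv \<epsilon> f x = (LINT y|lborel. f y * heat \<epsilon> (x - y))"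

lemma borel_measurable_heat_conv [measurable]:
  assumes [measurable]: "f \<in> borel_measurable borel"
  shows "heat_conv \<epsilon> f \<in> borel_measurable borel"
proof -
  have "(\<lambda>x. LINT y|lborel. f y * heat \<epsilon> (x - y)) \<in> borel_measurable lborel"
    by measurable
  then show ?thesis
    by (simp add: heat_conv_def[abs_def])
qed

lemma heat_conv:
  fixes f :: "'a::euclidean_space \<Rightarrow> complex"
  assumes f: "integrable lborel f" and \<epsilon>: "0 < \<epsilon>"
  shows integrable_heat_conv: "integrable lborel (heat_conv \<epsilon> f)"
    and fourier_heat_conv: "fourier (heat_conv \<epsilon> f) \<xi> = fourier f \<xi> * gauss \<epsilon> \<xi>"
proof -
  have [measurable]: "f \<in> borel_measurable borel"
    using f by simp
  have shift: "integrable lborel (\<lambda>x. heat \<epsilon> (x - y))" for y :: 'a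
    using integrable_heat_shift[OF \<epsilon>, of y] by (simp add: heat_minus)
  have n1: "(LINT x|lborel. norm (heat \<epsilon> (x - y))) = 1" for y :: 'a
  proof -
    have "ennreal (LINT x|lborel. norm (heat \<epsilon> (x - y))) = (\<integral>\<^sup>+x. ennreal (norm (heat \<epsilon> (x - y))) \<partial>lborel)"
      using shift by (intro nn_integral_eq_integral[symmetric]) auto
    also have "\<dots> = 1"
      using nn_integral_lborel_minus(1)[of "\<lambda>x. ennreal (norm (heat \<epsilon> (x::'a)))" y] nn_integral_heat[OF \<epsilon>, where 'a = 'a] by simp
    finally show ?thesis
      by simp
  qed
  have int: "integrable (lborel \<Otimes>\<^sub>M lborel) (\<lambda>(y, x). f y * heat \<epsilon> (x - y) * chi (x \<bullet> \<xi>))" for \<xi>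
  proof (rule lborel_pair.Fubini_integrable)
    have "(LINT x|lborel. norm (case (y, x) of (y, x) \<Rightarrow> f y * heat \<epsilon> (x - y) * chi (x \<bullet> \<xi>))) = norm (f y)" for y
      by (simp add: norm_mult n1)
    then show "integrable lborel (\<lambda>y. LINT x|lborel. norm (case (y, x) of (y, x) \<Rightarrow> f y * heat \<epsilon> (x - y) * chi (x \<bullet> \<xi>)))"
      using f by simp
    show "AE y in lborel. integrable lborel (\<lambda>x. case (y, x) of (y, x) \<Rightarrow> f y * heat \<epsilon> (x - y) * chi (x \<bullet> \<xi>))"
      using integrable_mult_chi[OF integrable_mult_right[OF shift]] by simp
  qed measurable
  show "integrable lborel (heat_conv \<epsilon> f)"
    using lborel_pair.integrable_snd[OF int[of 0]] by (simp add: heat_conv_def[abs_def])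
  have "fourier (heat_conv \<epsilon> f) \<xi> = (LINT x|lborel. LINT y|lborel. f y * heat \<epsilon> (x - y) * chi (x \<bullet> \<xi>))"
    by (subst fourier_eq) (simp_all add: heat_conv_def)
  also have "\<dots> = (LINT y|lborel. LINT x|lborel. f y * heat \<epsilon> (x - y) * chi (x \<bullet> \<xi>))"
    by (rule lborel_pair.Fubini_integral[OF int])
  also have "\<dots> = (LINT y|lborel. f y * chi (y \<bullet> \<xi>) * gauss \<epsilon> \<xi>)"
  proof (rule Bochner_Integration.integral_cong[OF refl])
    fix y :: 'a
    have "(LINT x|lborel. f y * heat \<epsilon> (x - y) * chi (x \<bullet> \<xi>)) = of_real (\<bar>1\<bar> ^ DIM('a)) * (LINT x|lborel. f y * heat \<epsilon> ((y + 1 *\<^sub>R x) - y) * chi ((y + 1 *\<^sub>R x) \<bullet> \<xi>))"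
      by (rule integral_lborel_affine) auto
    also have "\<dots> = (LINT x|lborel. f y * chi (y \<bullet> \<xi>) * (heat \<epsilon> x * chi (x \<bullet> \<xi>)))"
      by (simp add: inner_add_left chi_add mult_ac)
    also have "\<dots> = f y * chi (y \<bullet> \<xi>) * fourier (heat \<epsilon>) \<xi>"
      by (subst integral_mult_right_zero) (simp add: fourier_eq)
    also have "fourier (heat \<epsilon>) \<xi> = gauss \<epsilon> \<xi>"
    proof -
      have "fourier (heat \<epsilon>) \<xi> = complex_of_real (\<epsilon> powr (- real DIM('a) / 2)) * fourier (gauss (1 / \<epsilon>)) \<xi>"
        by (simp add: fourier_eq heat_def mult.assoc)
      then show ?thesis
        using \<epsilon> by (simp add: fourier_gauss powr_divide powr_minus_divide mult.assoc[symmetric] flip: of_real_mult)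
    qed
    finally show "(LINT x|lborel. f y * heat \<epsilon> (x - y) * chi (x \<bullet> \<xi>)) = f y * chi (y \<bullet> \<xi>) * gauss \<epsilon> \<xi>" .
  qed
  also have "\<dots> = fourier f \<xi> * gauss \<epsilon> \<xi>"
    by (subst integral_mult_left_zero) (simp add: fourier_eq)
  finally show "fourier (heat_conv \<epsilon> f) \<xi> = fourier f \<xi> * gauss \<epsilon> \<xi>" .
qed

lemma Lp_norm_heat:
  fixes q :: ennreal
  assumes q: "1 \<le> q" and \<epsilon>: "0 < \<epsilon>"
  shows "\<exists>H\<ge>0. \<forall>x. Lp_norm q (\<lambda>y::'a::euclidean_space. heat \<epsilon> (x - y)) \<le> ennreal H"
  using q
proof (cases rule: exponent_cases)
  case inf
  have "Lp_norm top (\<lambda>y::'a. heat \<epsilon> (x - y)) \<le> ennreal (\<epsilon> powr (- real DIM('a) / 2))" for x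
    using norm_heat_le[OF \<epsilon>] by (subst Lp_norm_inf_le_iff) (auto intro!: AE_I2 ennreal_leI)
  then show ?thesis
    unfolding inf by (intro exI[of _ "\<epsilon> powr (- real DIM('a) / 2)"]) auto
next
  case (fin Q)
  define c where "c = (\<epsilon> powr (- real DIM('a) / 2)) powr Q"
  have "norm (heat \<epsilon> (x::'a)) powr Q = c * exp (- (pi * Q / \<epsilon>) * (norm x)\<^sup>2)" for x
    by (simp add: heat_def norm_mult norm_gauss powr_mult c_def exp_powr_real mult_ac)
  then have "(\<integral>\<^sup>+x. ennreal (norm (heat \<epsilon> (x::'a)) powr Q) \<partial>lborel)
      = (\<integral>\<^sup>+x. ennreal c * ennreal (exp (- (pi * Q / \<epsilon>) * (norm (x::'a))\<^sup>2)) \<partial>lborel)"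
    by (simp add: ennreal_mult c_def)
  also have "\<dots> = ennreal c * (\<integral>\<^sup>+x. ennreal (exp (- (pi * Q / \<epsilon>) * (norm (x::'a))\<^sup>2)) \<partial>lborel)"
    by (rule nn_integral_cmult) measurable
  also have "(\<integral>\<^sup>+x. ennreal (exp (- (pi * Q / \<epsilon>) * (norm (x::'a))\<^sup>2)) \<partial>lborel)
      = (\<integral>\<^sup>+x. ennreal (norm x powr 0 * exp (- (pi * Q / \<epsilon>) * (norm (x::'a))\<^sup>2)) \<partial>lborel)"
    using AE_lborel_singleton[of "0::'a"] by (intro nn_integral_cong_AE) (auto elim!: eventually_mono)
  also have "ennreal c * \<dots> < top"
    using nn_integral_norm_powr_gauss[of 0 "pi * Q / \<epsilon>", where 'a = 'a] \<epsilon> fin by (simp add: ennreal_mult_less_top)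
  finally obtain i where i: "0 \<le> i" "(\<integral>\<^sup>+x. ennreal (norm (heat \<epsilon> (x::'a)) powr Q) \<partial>lborel) = ennreal i"
    by (cases "\<integral>\<^sup>+x. ennreal (norm (heat \<epsilon> (x::'a)) powr Q) \<partial>lborel") auto
  have "Lp_norm q (\<lambda>y::'a. heat \<epsilon> (x - y)) \<le> ennreal (i powr (1 / Q))" for x
    unfolding fin using fin i nn_integral_lborel_minus(2)[of "\<lambda>z. ennreal (norm (heat \<epsilon> (z::'a)) powr Q)" x]
    by (subst Lp_norm_le_iff) (auto simp: powr_powr)
  then show ?thesis
    by (intro exI[of _ "i powr (1 / Q)"]) auto
qed

text \<open>The factor 1 - \<open>gauss \<tau>\<close> vanishes to second order at 0, so its k-th
  power with 2k \<ge> \<beta> offsets the singularity of |\<xi>|^(-\<beta>). At infinity the power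
  is at most 1, and integrability is the condition \<beta> > d/r.\<close>

lemma Lp_norm_multiplier:
  fixes r :: ennreal and \<beta> \<tau> :: real
  assumes r: "1 \<le> r" and \<beta>: "0 < \<beta>" "DIM('a) * recip r < \<beta>" and k: "\<beta> \<le> 2 * real k" and \<tau>: "0 < \<tau>"
  shows "Lp_norm r (\<lambda>\<xi>::'a::euclidean_space. (1 - gauss \<tau> \<xi>) ^ k * complex_of_real (norm \<xi> powr (- \<beta>))) < top"
proof -
  define m where "m \<xi> = (1 - gauss \<tau> \<xi>) ^ k * complex_of_real (norm \<xi> powr (- \<beta>))" for \<xi> :: 'a
  define K where "K = max 1 ((pi * \<tau>) ^ k)"
  have K: "1 \<le> K"
    by (simp add: K_def)
  have nm: "norm (m \<xi>) = (1 - exp (- pi * \<tau> * (norm \<xi>)\<^sup>2)) ^ k * norm \<xi> powr (- \<beta>)" for \<xi>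
  proof -
    have "norm (1 - gauss \<tau> \<xi> :: complex) = \<bar>1 - exp (- pi * \<tau> * (norm \<xi>)\<^sup>2)\<bar>"
    proof -
      have "1 - gauss \<tau> \<xi> = complex_of_real (1 - exp (- pi * \<tau> * (norm \<xi>)\<^sup>2))"
        by (simp add: gauss_def)
      then show ?thesis
        by (simp only: norm_of_real)
    qed
    then show ?thesis
      using \<tau> by (simp add: m_def norm_mult norm_power)
  qed
  have in_le: "norm (m \<xi>) \<le> K" if "norm \<xi> \<le> 1" for \<xi>
  proof (cases "\<xi> = 0")
    case False
    have "norm (m \<xi>) \<le> (pi * \<tau> * (norm \<xi>)\<^sup>2) ^ k * norm \<xi> powr (- \<beta>)"
      unfolding nm using exp_ge_add_one_self[of "- pi * \<tau> * (norm \<xi>)\<^sup>2"] \<tau>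
      by (intro mult_right_mono power_mono) auto
    also have "\<dots> = (pi * \<tau>) ^ k * (norm \<xi> powr (2 * real k) * norm \<xi> powr (- \<beta>))"
    proof -
      have "norm \<xi> powr (2 * real k) = ((norm \<xi>)\<^sup>2) ^ k"
        using False powr_realpow[of "norm \<xi>" "2 * k"] by (simp add: power_mult)
      then show ?thesis
        by (simp only: power_mult_distrib mult.assoc)
    qed
    also have "norm \<xi> powr (2 * real k) * norm \<xi> powr (- \<beta>) = norm \<xi> powr (2 * real k - \<beta>)"
      by (simp flip: powr_add)
    also have "(pi * \<tau>) ^ k * norm \<xi> powr (2 * real k - \<beta>) \<le> K * 1"
      using that k \<tau> by (intro mult_mono powr_le1) (auto simp: K_def)
    finally show ?thesis by simp
  qed (use \<beta> K in \<open>simp add: nm\<close>)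
  have out_le: "norm (m \<xi>) \<le> norm \<xi> powr (- \<beta>)" for \<xi>
  proof -
    have "norm (m \<xi>) \<le> 1 ^ k * norm \<xi> powr (- \<beta>)"
      unfolding nm using \<tau> by (intro mult_right_mono power_mono) auto
    then show ?thesis by simp
  qed
  have [measurable]: "m \<in> borel_measurable borel"
    unfolding m_def by measurable
  have "Lp_norm r m < top"
  proof (rule Lp_norm_less_topI[OF r, where M = K])
    show "norm (m \<xi>) \<le> K" for \<xi>
    proof (cases "norm \<xi> \<le> 1")
      case False
      then have "norm \<xi> powr (- \<beta>) \<le> 1"
        using powr_mono2'[of "- \<beta>" 1 "norm \<xi>"] \<beta> by simp
      then show ?thesis
        using out_le[of \<xi>] K by simp
    qed (rule in_le)
    fix R assume R: "r = ennreal R" "1 \<le> R"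
    have "DIM('a) < \<beta> * R"
      using \<beta> R by (simp add: recip_ennreal field_simps)
    moreover have "norm (m x) powr R \<le> K powr R * norm x powr (- (\<beta> * R))" if "1 \<le> norm x" for x
    proof -
      have "norm (m x) powr R \<le> (norm x powr (- \<beta>)) powr R"
        using R by (intro powr_mono2 out_le) auto
      also have "\<dots> = 1 * norm x powr (- (\<beta> * R))"
        by (simp add: powr_powr)
      also have "\<dots> \<le> K powr R * norm x powr (- (\<beta> * R))"
        using K R by (intro mult_right_mono ge_one_powr_ge_zero) auto
      finally show ?thesis .
    qed
    moreover have "norm (m x) powr R \<le> K powr R * norm x powr 0" if "norm x \<le> 1" "x \<noteq> 0" for x
      using in_le[OF that(1)] R that by (auto intro!: powr_mono2)
    ultimately have "(\<integral>\<^sup>+x. ennreal (norm (m x) powr R) \<partial>lborel) < \<infinity>"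
      by (intro nn_integral_dominated_radial[where b = 0 and \<gamma> = "\<beta> * R" and K = "K powr R"]) auto
    then show "(\<integral>\<^sup>+x. ennreal (norm (m x) powr R) \<partial>lborel) < top"
      by simp
  qed measurable
  then show ?thesis
    by (simp add: m_def[abs_def])
qed


text \<open>With g = \<open>gauss \<tau> \<xi>\<close>, the complement of the high-frequency
  multiplier becomes a finite combination of Gaussians, so the low-frequency part is a combination
  of heat convolutions with parameters j \<tau>.\<close>

lemma binomial_one_minus:
  fixes g :: complex
  shows "(1 - g) ^ k = 1 - (\<Sum>j=1..k. complex_of_real ((- 1) ^ (j + 1) * real (k choose j)) * g ^ j)"
proof -
  have "(1 - g) ^ k = (\<Sum>j\<le>k. of_nat (k choose j) * (- g) ^ j * 1 ^ (k - j))"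
    using binomial_ring[of "- g" 1 k] by simp
  also have "\<dots> = (\<Sum>j\<in>insert 0 {1..k}. of_nat (k choose j) * (- g) ^ j)"
    by (intro sum.cong) auto
  also have "\<dots> = 1 - (\<Sum>j=1..k. - (of_nat (k choose j) * (- g) ^ j))"
    by (subst sum.insert) (auto simp: sum_negf)
  also have "(\<Sum>j=1..k. - (of_nat (k choose j) * (- g) ^ j)) = (\<Sum>j=1..k. complex_of_real ((- 1) ^ (j + 1) * real (k choose j)) * g ^ j)"
    by (intro sum.cong refl) (simp add: power_minus[of g] mult_ac)
  finally show ?thesis .
qed

lemma gauss_power: "gauss \<tau> \<xi> ^ j = gauss (real j * \<tau>) \<xi>"
  by (simp add: gauss_def exp_of_nat_mult[symmetric] mult_ac flip: of_real_power)

text \<open>Inside the unit ball the kernel is bounded by its maximum, outside one has 1 \<le>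
  |y|^\<alpha> and applies Hoelder's inequality. The coefficient of the local mass is small for
  large \<tau>; this is the smallness that permits absorption.\<close>

lemma heat_conv_bound:
  fixes f :: "'a::euclidean_space \<Rightarrow> complex" and q q' :: ennreal
  assumes [measurable]: "f \<in> borel_measurable borel" and q: "1 \<le> q" "1 \<le> q'" "recip q + recip q' = 1"
    and \<tau>: "0 < \<tau>" "\<tau> \<le> \<epsilon>" and \<alpha>: "0 < \<alpha>"
    and H: "\<And>x::'a. Lp_norm q' (\<lambda>y. heat \<epsilon> (x - y)) \<le> ennreal H"
  shows "ennreal (norm (heat_conv \<epsilon> f x)) \<le> ennreal (\<tau> powr (- real DIM('a) / 2)) * Lp_norm 1 (\<lambda>y. f y * unit_ind y)
    + Lp_norm q (\<lambda>y. f y * complex_of_real (norm y powr \<alpha>)) * ennreal H"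
proof -
  let ?c = "\<tau> powr (- real DIM('a) / 2)"
  have h_le: "norm (heat \<epsilon> z) \<le> ?c" for z :: 'a
  proof -
    have "norm (heat \<epsilon> z) \<le> \<epsilon> powr (- real DIM('a) / 2)"
      using \<tau> by (intro norm_heat_le) simp
    also have "\<dots> \<le> ?c"
      using \<tau> by (intro powr_mono2') auto
    finally show ?thesis .
  qed
  have "ennreal (norm (heat_conv \<epsilon> f x)) \<le> (\<integral>\<^sup>+y. ennreal (norm (f y * heat \<epsilon> (x - y))) \<partial>lborel)"
    unfolding heat_conv_def by (rule ennreal_norm_integral_le)
  also have "\<dots> \<le> (\<integral>\<^sup>+y. ennreal ?c * ennreal (norm (f y * unit_ind y))
      + ennreal (norm (f y * complex_of_real (norm y powr \<alpha>) * heat \<epsilon> (x - y))) \<partial>lborel)"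
  proof (intro nn_integral_mono)
    fix y :: 'a
    show "ennreal (norm (f y * heat \<epsilon> (x - y))) \<le> ennreal ?c * ennreal (norm (f y * unit_ind y))
      + ennreal (norm (f y * complex_of_real (norm y powr \<alpha>) * heat \<epsilon> (x - y)))"
    proof (cases "norm y \<le> 1")
      case True
      have "norm (f y * heat \<epsilon> (x - y)) \<le> ?c * norm (f y * unit_ind y)"
        using True mult_left_mono[OF h_le[of "x - y"], of "norm (f y)"] by (simp add: norm_mult unit_ind_def mult.commute)
      then have "ennreal (norm (f y * heat \<epsilon> (x - y))) \<le> ennreal ?c * ennreal (norm (f y * unit_ind y))"
        by (simp add: ennreal_mult[symmetric] ennreal_leI)
      then show ?thesis
        by (rule add_increasing2[rotated]) simp
    next
      case False
      then have "1 \<le> norm y powr \<alpha>"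
        using \<alpha> by (intro ge_one_powr_ge_zero) auto
      then have "norm (f y) * norm (heat \<epsilon> (x - y)) * 1 \<le> norm (f y) * norm (heat \<epsilon> (x - y)) * norm y powr \<alpha>"
        by (intro mult_left_mono) auto
      then have "norm (f y * heat \<epsilon> (x - y)) \<le> norm (f y * complex_of_real (norm y powr \<alpha>) * heat \<epsilon> (x - y))"
        by (simp add: norm_mult mult_ac)
      then have "ennreal (norm (f y * heat \<epsilon> (x - y))) \<le> ennreal (norm (f y * complex_of_real (norm y powr \<alpha>) * heat \<epsilon> (x - y)))"
        by (rule ennreal_leI)
      then show ?thesis
        by (rule add_increasing[rotated]) simp
    qed
  qed
  also have "\<dots> = ennreal ?c * Lp_norm 1 (\<lambda>y. f y * unit_ind y)
      + Lp_norm 1 (\<lambda>y. f y * complex_of_real (norm y powr \<alpha>) * heat \<epsilon> (x - y))"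
    unfolding Lp_norm_1 by (subst nn_integral_add) (simp_all add: nn_integral_cmult)
  also have "Lp_norm 1 (\<lambda>y. f y * complex_of_real (norm y powr \<alpha>) * heat \<epsilon> (x - y))
    \<le> Lp_norm q (\<lambda>y. f y * complex_of_real (norm y powr \<alpha>)) * Lp_norm q' (\<lambda>y. heat \<epsilon> (x - y))"
    using q recip_ennreal[of 1] by (intro Lp_norm_Holder) auto
  also have "\<dots> \<le> Lp_norm q (\<lambda>y. f y * complex_of_real (norm y powr \<alpha>)) * ennreal H"
    by (intro mult_left_mono H) auto
  finally show ?thesis
    by (simp add: add_left_mono)
qed

theorem uncertainty_strict:
  fixes p q :: ennreal and \<alpha> \<beta> t :: real
  assumes p: "1 \<le> p" and q: "1 \<le> q" and \<alpha>: "0 < \<alpha>" and \<beta>: "0 < \<beta>"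
    and t: "0 \<le> t" "t \<le> 1 / 2" "t \<le> recip q" "t \<le> 1 - recip p" and \<beta>t: "DIM('a) * (1 - t - recip p) < \<beta>"
  shows "\<exists>C>0. \<forall>f::'a::euclidean_space \<Rightarrow> complex. integrable lborel f \<longrightarrow>
    Lp_norm q f \<le> ennreal C * (Lp_norm q (\<lambda>x. f x * complex_of_real (norm x powr \<alpha>))
      + Lp_norm p (\<lambda>\<xi>. fourier f \<xi> * complex_of_real (norm \<xi> powr \<beta>)))"
proof -
  let ?d = "real DIM('a)"
  define k where "k = nat \<lceil>\<beta>\<rceil>"
  have k: "\<beta> \<le> 2 * real k"
    using \<beta> by (simp add: k_def) linarith
  define s where "s = exponent t"
  have s: "1 \<le> s" "recip s = t"
    unfolding s_def using t by (auto intro!: exponent)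
  define s' where "s' = exponent (1 - t)"
  have s': "1 \<le> s'" "recip s' = 1 - t"
    unfolding s'_def using t by (auto intro!: exponent)
  \<comment> \<open>r pays for the passage from L^s to L^q on the unit ball, and r' below for the
    passage from L^p to L^s' in frequency. Their reciprocals are nonnegative precisely by the last
    two bounds on t.\<close>
  define r where "r = exponent (recip q - t)"
  have r: "1 \<le> r" "recip r = recip q - t"
    unfolding r_def using t recip_le_1[OF q] by (auto intro!: exponent)
  define r' where "r' = exponent (1 - t - recip p)"
  have r': "1 \<le> r'" "recip r' = 1 - t - recip p"
    unfolding r'_def using t recip_nonneg[of p] by (auto intro!: exponent)
  define q' where "q' = exponent (1 - recip q)"
  have q': "1 \<le> q'" "recip q' = 1 - recip q"
    unfolding q'_def using recip_nonneg[of q] recip_le_1[OF q] by (auto intro!: exponent)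
  have s2: "2 \<le> s"
    using recip_le_iff[of 2 s] s t recip_ennreal[of 2] by simp
  obtain C0 where C0: "0 < C0" "\<And>g::'a \<Rightarrow> complex. integrable lborel g \<Longrightarrow>
    Lp_norm s g \<le> ennreal C0 * Lp_norm s' (\<lambda>\<xi>. fourier g \<xi> * complex_of_real (norm \<xi> powr 0))"
    using Pitt_inequality[OF s'(1) s2, of 0, where 'a = 'a] s s' by auto
  have ex_real: "\<exists>c\<ge>0. u = ennreal c" if "u < top" for u
    using that by (cases u) auto
  obtain Vq where Vq: "0 \<le> Vq" "Lp_norm q (unit_ind :: 'a \<Rightarrow> complex) = ennreal Vq"
    using ex_real[OF Lp_norm_unit_ind[OF q]] by blast
  obtain Vq' where Vq': "0 \<le> Vq'" "Lp_norm q' (unit_ind :: 'a \<Rightarrow> complex) = ennreal Vq'"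
    using ex_real[OF Lp_norm_unit_ind[OF q'(1)]] by blast
  obtain Vr where Vr: "0 \<le> Vr" "Lp_norm r (unit_ind :: 'a \<Rightarrow> complex) = ennreal Vr"
    using ex_real[OF Lp_norm_unit_ind[OF r(1)]] by blast
  \<comment> \<open>\<tau> is defined so that \<open>\<tau> powr (- d / 2)\<close> is 1 / Y; the
    coefficient \<kappa> Vq Vq' of the absorbed term is then at most 1/2. The summand 1 keeps Y
    positive.\<close>
  define Y where "Y = 2 * 2 ^ k * (Vq * Vq' + 1)"
  have Y: "0 < Y" "2 * (2 ^ k * (Vq * Vq')) \<le> Y"
    using Vq Vq' by (auto simp: Y_def add_nonneg_pos)
  define \<tau> where "\<tau> = Y powr (2 / ?d)"
  have \<tau>: "0 < \<tau>"
    using Y by (simp add: \<tau>_def)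
  define \<kappa> where "\<kappa> = 2 ^ k * \<tau> powr (- ?d / 2)"
  have \<kappa>: "0 \<le> \<kappa>" "\<kappa> * (Vq * Vq') \<le> 1 / 2"
  proof -
    have "\<tau> powr (- ?d / 2) = 1 / Y"
      using Y by (simp add: \<tau>_def powr_powr powr_minus_divide)
    then have "\<kappa> * (Vq * Vq') = 2 ^ k * (Vq * Vq') / Y"
      by (simp add: \<kappa>_def)
    also have "\<dots> \<le> 1 / 2"
      using Y by (simp add: divide_le_eq)
    finally show "\<kappa> * (Vq * Vq') \<le> 1 / 2" .
  qed (simp add: \<kappa>_def)
  obtain W where W: "0 \<le> W" "Lp_norm r' (\<lambda>\<xi>::'a. (1 - gauss \<tau> \<xi>) ^ k * complex_of_real (norm \<xi> powr (- \<beta>))) = ennreal W"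
    using ex_real[OF Lp_norm_multiplier[OF r'(1) \<beta> _ k \<tau>, where 'a = 'a]] \<beta>t r' by auto
  have "\<exists>H\<ge>0. \<forall>x. Lp_norm q' (\<lambda>y::'a. heat (real j * \<tau>) (x - y)) \<le> ennreal H" if "j \<in> {1..k}" for j
    using that \<tau> by (intro Lp_norm_heat q') auto
  then obtain H where H: "\<And>j. j \<in> {1..k} \<Longrightarrow> 0 \<le> H j"
    "\<And>j x. j \<in> {1..k} \<Longrightarrow> Lp_norm q' (\<lambda>y::'a. heat (real j * \<tau>) (x - y)) \<le> ennreal (H j)"
    by metis
  define c where "c j = (- 1) ^ (j + 1) * real (k choose j)" for j
  define Ht where "Ht = (\<Sum>j=1..k. real (k choose j) * H j)"
  have Ht: "0 \<le> Ht"
    unfolding Ht_def using H by (intro sum_nonneg) auto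
  have abs_c: "\<bar>c j\<bar> = real (k choose j)" for j
    by (simp add: c_def abs_mult)
  have sum_c: "(\<Sum>j=1..k. real (k choose j)) \<le> 2 ^ k"
  proof -
    have "(\<Sum>j=1..k. real (k choose j)) \<le> (\<Sum>j\<le>k. real (k choose j))"
      by (intro sum_mono2) auto
    also have "\<dots> = 2 ^ k"
      using choose_row_sum[of k] by (metis of_nat_numeral of_nat_power of_nat_sum)
    finally show ?thesis .
  qed
  define D where "D = 2 * (1 + C0 * W * Vr + Vq * Ht)"
  have D: "0 < D"
    using C0 W Vr Vq Ht by (simp add: D_def add_pos_nonneg)
  show ?thesis
  proof (intro exI[of _ D] conjI allI impI D)
    fix f :: "'a \<Rightarrow> complex"
    assume f: "integrable lborel f"
    have [measurable]: "f \<in> borel_measurable borel"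
      using f by simp
    define A where "A = Lp_norm q (\<lambda>x. f x * complex_of_real (norm x powr \<alpha>))"
    define B where "B = Lp_norm p (\<lambda>\<xi>. fourier f \<xi> * complex_of_real (norm \<xi> powr \<beta>))"
    show "Lp_norm q f \<le> ennreal D * (A + B)"
    proof (cases "A = top \<or> B = top")
      case True
      then show ?thesis
        using D by (auto simp: ennreal_mult_top)
    next
      case False
      then obtain a b where a: "0 \<le> a" "A = ennreal a" and b: "0 \<le> b" "B = ennreal b"
        using ex_real[of A] ex_real[of B] by (auto simp: less_top)
      \<comment> \<open>By the binomial expansion the multiplier of \<open>low\<close> is 1 - (1 -
        gauss)^k, so that \<open>high\<close> has the multiplier (1 - gauss)^k, to which
        \<open>Lp_norm_multiplier\<close> applies.\<close>
      define low where "low x = (\<Sum>j=1..k. complex_of_real (c j) * heat_conv (real j * \<tau>) f x)" for x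
      define high where "high x = f x - low x" for x
      have low_int: "integrable lborel low"
        unfolding low_def[abs_def] using \<tau> by (intro Bochner_Integration.integrable_sum integrable_mult_right integrable_heat_conv f) auto
      have high_int: "integrable lborel high"
        unfolding high_def[abs_def] by (intro Bochner_Integration.integrable_diff f low_int)
      have [measurable]: "low \<in> borel_measurable borel" "high \<in> borel_measurable borel"
        using low_int high_int by auto
      have four_high: "fourier high \<xi> = fourier f \<xi> * (1 - gauss \<tau> \<xi>) ^ k" for \<xi>
      proof -
        have "fourier low \<xi> = (LINT x|lborel. (\<Sum>j=1..k. complex_of_real (c j) * (heat_conv (real j * \<tau>) f x * chi (x \<bullet> \<xi>))))"
          by (subst fourier_eq) (simp_all add: low_def sum_distrib_right mult.assoc)
        also have "\<dots> = (\<Sum>j=1..k. complex_of_real (c j) * fourier (heat_conv (real j * \<tau>) f) \<xi>)"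
          using \<tau> by (subst Bochner_Integration.integral_sum)
            (auto simp: fourier_eq intro!: integrable_mult_right integrable_mult_chi integrable_heat_conv f)
        also have "\<dots> = (\<Sum>j=1..k. complex_of_real (c j) * (fourier f \<xi> * gauss (real j * \<tau>) \<xi>))"
          using \<tau> by (intro sum.cong refl) (simp add: fourier_heat_conv[OF f])
        also have "\<dots> = fourier f \<xi> * (\<Sum>j=1..k. complex_of_real (c j) * gauss \<tau> \<xi> ^ j)"
          by (simp add: gauss_power sum_distrib_left mult_ac)
        finally have "fourier low \<xi> = fourier f \<xi> * (1 - (1 - gauss \<tau> \<xi>) ^ k)"
          unfolding c_def binomial_one_minus by simp
        moreover have "fourier high \<xi> = fourier f \<xi> - fourier low \<xi>"
          by (simp add: fourier_eq high_def left_diff_distrib Bochner_Integration.integral_diff integrable_mult_chi f low_int)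
        ultimately show ?thesis
          by (simp add: right_diff_distrib)
      qed
      define N1 where "N1 = Lp_norm 1 (\<lambda>y. f y * unit_ind y)"
      have "N1 \<le> Lp_norm 1 f"
        unfolding N1_def by (intro Lp_norm_mono) (auto simp: unit_ind_def)
      also have "\<dots> < top"
        using f unfolding Lp_norm_1 by (simp add: integrable_iff_bounded)
      finally obtain n where n: "0 \<le> n" "N1 = ennreal n"
        using ex_real by blast
      have low_le: "norm (low x) \<le> \<kappa> * n + Ht * a" for x
      proof -
        have hb: "norm (heat_conv (real j * \<tau>) f x) \<le> \<tau> powr (- ?d / 2) * n + a * H j" if j: "j \<in> {1..k}" for j
        proof -
          have "\<tau> \<le> real j * \<tau>"
            using j \<tau> by simp
          then have "ennreal (norm (heat_conv (real j * \<tau>) f x)) \<le> ennreal (\<tau> powr (- ?d / 2)) * N1 + A * ennreal (H j)"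
            unfolding N1_def A_def using q q' \<tau> \<alpha> H(2)[OF j]
            by (intro heat_conv_bound[where q' = q' and f = f and \<tau> = \<tau> and \<epsilon> = "real j * \<tau>" and q = q and \<alpha> = \<alpha> and H = "H j"]) auto
          also have "\<dots> = ennreal (\<tau> powr (- ?d / 2) * n + a * H j)"
            using n a H(1)[OF j] by (simp add: ennreal_mult)
          finally show ?thesis
            using n a H(1)[OF j] by (subst (asm) ennreal_le_iff) auto
        qed
        have "norm (low x) \<le> (\<Sum>j=1..k. norm (complex_of_real (c j) * heat_conv (real j * \<tau>) f x))"
          unfolding low_def by (rule norm_sum)
        also have "\<dots> \<le> (\<Sum>j=1..k. real (k choose j) * (\<tau> powr (- ?d / 2) * n + a * H j))"
          using hb by (intro sum_mono) (auto simp: norm_mult abs_c intro!: mult_left_mono)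
        also have "\<dots> = (\<Sum>j=1..k. real (k choose j)) * (\<tau> powr (- ?d / 2) * n) + Ht * a"
          by (simp add: Ht_def distrib_left sum.distrib sum_distrib_right sum_distrib_left mult_ac)
        also have "\<dots> \<le> 2 ^ k * (\<tau> powr (- ?d / 2) * n) + Ht * a"
          using sum_c n by (intro add_right_mono mult_right_mono) auto
        finally show ?thesis
          by (simp add: \<kappa>_def mult.assoc)
      qed
      have L1: "Lp_norm q (\<lambda>x. low x * unit_ind x) \<le> ennreal ((\<kappa> * n + Ht * a) * Vq)"
      proof -
        have nn: "0 \<le> \<kappa> * n + Ht * a"
          using \<kappa> n a Ht by simp
        have "Lp_norm q (\<lambda>x. low x * unit_ind x) \<le> Lp_norm q (\<lambda>x::'a. complex_of_real (\<kappa> * n + Ht * a) * unit_ind x)"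
        proof (rule Lp_norm_mono[OF q])
          fix x
          show "norm (low x * unit_ind x) \<le> norm (complex_of_real (\<kappa> * n + Ht * a) * unit_ind x)"
            unfolding norm_mult norm_of_real using low_le[of x] by (intro mult_right_mono) auto
        qed measurable
        also have "\<dots> = ennreal ((\<kappa> * n + Ht * a) * Vq)"
          using nn Vq by (subst Lp_norm_scale[OF q]) (auto simp: ennreal_mult simp del: of_real_add ennreal_plus of_real_mult)
        finally show ?thesis .
      qed
      have L2: "Lp_norm q (\<lambda>x. high x * unit_ind x) \<le> ennreal (C0 * W * Vr * b)"
      proof -
        have "Lp_norm s' (\<lambda>\<xi>. fourier high \<xi> * complex_of_real (norm \<xi> powr 0))
          \<le> Lp_norm s' (\<lambda>\<xi>. (fourier f \<xi> * complex_of_real (norm \<xi> powr \<beta>)) * ((1 - gauss \<tau> \<xi>) ^ k * complex_of_real (norm \<xi> powr (- \<beta>))))"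
        proof (rule Lp_norm_AE_mono[OF s'(1)])
          show "AE \<xi> in lborel. norm (fourier high \<xi> * complex_of_real (norm \<xi> powr 0))
            \<le> norm ((fourier f \<xi> * complex_of_real (norm \<xi> powr \<beta>)) * ((1 - gauss \<tau> \<xi>) ^ k * complex_of_real (norm \<xi> powr (- \<beta>))))"
            using AE_lborel_singleton[of "0::'a"]
          proof eventually_elim
            case (elim \<xi>)
            have "complex_of_real (norm \<xi> powr \<beta>) * complex_of_real (norm \<xi> powr (- \<beta>)) = 1"
              using elim by (simp flip: powr_add of_real_mult)
            then have "(fourier f \<xi> * complex_of_real (norm \<xi> powr \<beta>)) * ((1 - gauss \<tau> \<xi>) ^ k * complex_of_real (norm \<xi> powr (- \<beta>))) = fourier high \<xi>"
              unfolding four_high by (metis (no_types, lifting) mult.assoc mult.commute mult.right_neutral)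
            then show ?case
              using elim by simp
          qed
        qed measurable
        also have "\<dots> \<le> B * ennreal W"
          unfolding B_def W(2)[symmetric] using s' p r' by (intro Lp_norm_Holder) auto
        finally have hs: "Lp_norm s high \<le> ennreal C0 * (B * ennreal W)"
          using C0(2)[OF high_int] by (meson mult_left_mono order_trans zero_le)
        have "Lp_norm q (\<lambda>x. high x * unit_ind x) \<le> Lp_norm s high * ennreal Vr"
          unfolding Vr(2)[symmetric] using q s r by (intro Lp_norm_Holder) auto
        also have "\<dots> \<le> ennreal C0 * (B * ennreal W) * ennreal Vr"
          by (intro mult_right_mono hs) auto
        also have "\<dots> = ennreal (C0 * W * Vr * b)"
          using C0 W Vr b by (simp add: ennreal_mult[symmetric] mult_ac)
        finally show ?thesis .
      qed
      have L3: "Lp_norm q (\<lambda>x. f x * (1 - unit_ind x)) \<le> A"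
        unfolding A_def
      proof (rule Lp_norm_mono[OF q])
        fix x
        show "norm (f x * (1 - unit_ind x)) \<le> norm (f x * complex_of_real (norm x powr \<alpha>))"
        proof (cases "norm x \<le> 1")
          case False
          then have "1 \<le> norm x powr \<alpha>"
            using \<alpha> by (intro ge_one_powr_ge_zero) auto
          then show ?thesis
            using False mult_left_mono[of 1 "norm x powr \<alpha>" "norm (f x)"] by (simp add: unit_ind_def norm_mult)
        qed (simp add: unit_ind_def)
      qed measurable
      have "Lp_norm q f = Lp_norm q (\<lambda>x. f x * (1 - unit_ind x) + (high x * unit_ind x + low x * unit_ind x))"
        by (simp add: high_def algebra_simps)
      also have "\<dots> \<le> Lp_norm q (\<lambda>x. f x * (1 - unit_ind x)) + Lp_norm q (\<lambda>x. high x * unit_ind x + low x * unit_ind x)"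
        by (intro Lp_norm_triangle q) measurable
      also have "\<dots> \<le> Lp_norm q (\<lambda>x. f x * (1 - unit_ind x)) + (Lp_norm q (\<lambda>x. high x * unit_ind x) + Lp_norm q (\<lambda>x. low x * unit_ind x))"
        by (intro add_left_mono Lp_norm_triangle q) measurable
      also have "\<dots> \<le> ennreal a + (ennreal (C0 * W * Vr * b) + ennreal ((\<kappa> * n + Ht * a) * Vq))"
        using L1 L2 L3 a by (intro add_mono) auto
      also have "\<dots> = ennreal (a + C0 * W * Vr * b + (\<kappa> * n + Ht * a) * Vq)"
        using a b C0 W Vr \<kappa> n Ht Vq by (simp add: add.assoc)
      finally have X_le: "Lp_norm q f \<le> ennreal (a + C0 * W * Vr * b + (\<kappa> * n + Ht * a) * Vq)" .
      \<comment> \<open>Absorption needs the norm to be finite beforehand. It is, because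
        \<open>X_le\<close> involves only the mass n of f on the unit ball, finite for integrable f.
        Afterwards n is bounded by x Vq' and contributes at most x / 2.\<close>
      then have "Lp_norm q f < top"
        using ennreal_less_top order_le_less_trans by blast
      then obtain x where x: "0 \<le> x" "Lp_norm q f = ennreal x"
        using ex_real by blast
      have "N1 \<le> Lp_norm q f * Lp_norm q' (unit_ind :: 'a \<Rightarrow> complex)"
        unfolding N1_def using q q' recip_ennreal[of 1] by (intro Lp_norm_Holder) auto
      then have n_le: "n \<le> x * Vq'"
        unfolding n x Vq' using x Vq' by (simp add: ennreal_mult[symmetric])
      have x_le: "x \<le> a + C0 * W * Vr * b + (\<kappa> * n + Ht * a) * Vq"
        using X_le a b C0 W Vr \<kappa> n Ht Vq unfolding x(2) by (subst (asm) ennreal_le_iff) auto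
      have "\<kappa> * n * Vq \<le> \<kappa> * (x * Vq') * Vq"
        using n_le \<kappa> Vq by (intro mult_right_mono mult_left_mono) auto
      also have "\<dots> = (\<kappa> * (Vq * Vq')) * x"
        by (simp add: mult_ac)
      also have "\<dots> \<le> 1 / 2 * x"
        using \<kappa> x by (intro mult_right_mono) auto
      finally have "x \<le> 2 * (a + C0 * W * Vr * b + Ht * a * Vq)"
        using x_le by (simp add: distrib_right)
      also have "\<dots> \<le> D * (a + b)"
        using a b C0 W Vr Ht Vq by (simp add: D_def algebra_simps)
      finally have "ennreal x \<le> ennreal (D * (a + b))"
        by (rule ennreal_leI)
      then show ?thesis
        unfolding x a b using D a b by (simp add: ennreal_mult)
    qed
  qed
qed

section \<open>Scaling\<close>

lemma Lp_norm_dilate_le: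
  fixes f :: "'a::euclidean_space \<Rightarrow> complex"
  assumes p: "1 \<le> p" and [measurable]: "f \<in> borel_measurable borel" and c: "0 < c"
  shows "Lp_norm p (\<lambda>x. f (c *\<^sub>R x)) \<le> ennreal (c powr (- real DIM('a) * recip p)) * Lp_norm p f"
proof (cases "Lp_norm p f")
  case top
  then show ?thesis
    using c by (simp add: ennreal_mult_top)
next
  case (real r)
  from p show ?thesis
  proof (cases rule: exponent_cases)
    case inf
    have "AE x in lborel. ennreal (norm (f x)) \<le> Lp_norm top f"
      using Lp_norm_inf_le_iff[of f "Lp_norm top f"] by simp
    then have "AE x in density (distr lborel borel (\<lambda>x. 0 + c *\<^sub>R x)) (\<lambda>_. ennreal (\<bar>c\<bar> ^ DIM('a))). ennreal (norm (f x)) \<le> Lp_norm top f"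
      using c by (subst lborel_affine[symmetric]) auto
    then have "AE x in lborel. ennreal (norm (f (c *\<^sub>R x))) \<le> Lp_norm top f"
      using c by (subst (asm) AE_density) (auto simp: AE_distr_iff)
    then show ?thesis
      unfolding inf using c by (subst Lp_norm_inf_le_iff) auto
  next
    case (fin P)
    have "(\<integral>\<^sup>+x. ennreal (norm (f x) powr P) \<partial>lborel) \<le> ennreal (r powr P)"
      using real fin Lp_norm_le_iff[of P r f] by simp
    moreover have "(\<integral>\<^sup>+x. ennreal (norm (f x) powr P) \<partial>lborel)
      = ennreal (\<bar>c\<bar> ^ DIM('a)) * (\<integral>\<^sup>+x. ennreal (norm (f (0 + c *\<^sub>R x)) powr P) \<partial>lborel)"
      using c by (intro nn_integral_lborel_affine) auto
    ultimately have "ennreal (c powr (- real DIM('a))) * (ennreal (c powr real DIM('a)) * (\<integral>\<^sup>+x. ennreal (norm (f (c *\<^sub>R x)) powr P) \<partial>lborel))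
      \<le> ennreal (c powr (- real DIM('a))) * ennreal (r powr P)"
      using c by (intro mult_left_mono) (auto simp: powr_realpow)
    also have "ennreal (c powr (- real DIM('a))) * (ennreal (c powr real DIM('a)) * (\<integral>\<^sup>+x. ennreal (norm (f (c *\<^sub>R x)) powr P) \<partial>lborel))
      = (\<integral>\<^sup>+x. ennreal (norm (f (c *\<^sub>R x)) powr P) \<partial>lborel)"
      using c by (simp add: mult.assoc[symmetric] ennreal_mult[symmetric] powr_add[symmetric])
    also have "ennreal (c powr (- real DIM('a))) * ennreal (r powr P) = ennreal ((c powr (- real DIM('a) / P) * r) powr P)"
      using real c fin by (simp add: ennreal_mult[symmetric] powr_mult powr_powr)
    finally have "Lp_norm (ennreal P) (\<lambda>x. f (c *\<^sub>R x)) \<le> ennreal (c powr (- real DIM('a) / P) * r)"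
      using fin real by (subst Lp_norm_le_iff) auto
    then show ?thesis
      unfolding real using fin real by (simp add: ennreal_mult)
  qed
qed

text \<open>One inequality for all dilations suffices: applied to the factor 1/c it yields the
  reverse one.\<close>

lemma Lp_norm_dilate:
  fixes f :: "'a::euclidean_space \<Rightarrow> complex"
  assumes p: "1 \<le> p" and f[measurable]: "f \<in> borel_measurable borel" and c: "0 < c"
  shows "Lp_norm p (\<lambda>x. f (c *\<^sub>R x)) = ennreal (c powr (- real DIM('a) * recip p)) * Lp_norm p f"
proof (rule antisym[OF Lp_norm_dilate_le[OF assms]])
  have "Lp_norm p (\<lambda>x. f (c *\<^sub>R ((1 / c) *\<^sub>R x))) \<le> ennreal ((1 / c) powr (- real DIM('a) * recip p)) * Lp_norm p (\<lambda>x. f (c *\<^sub>R x))"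
    using c by (intro Lp_norm_dilate_le p) auto
  then have "ennreal (c powr (- real DIM('a) * recip p)) * Lp_norm p f \<le>
      ennreal (c powr (- real DIM('a) * recip p)) * (ennreal ((1 / c) powr (- real DIM('a) * recip p)) * Lp_norm p (\<lambda>x. f (c *\<^sub>R x)))"
    using c by (intro mult_left_mono) auto
  also have "\<dots> = Lp_norm p (\<lambda>x. f (c *\<^sub>R x))"
    using c by (simp add: mult.assoc[symmetric] ennreal_mult[symmetric] powr_divide)
  finally show "ennreal (c powr (- real DIM('a) * recip p)) * Lp_norm p f \<le> Lp_norm p (\<lambda>x. f (c *\<^sub>R x))" .
qed

lemma Lp_norm_dilate_weight:
  fixes f :: "'a::euclidean_space \<Rightarrow> complex"
  assumes p: "1 \<le> p" and f[measurable]: "f \<in> borel_measurable borel" and c: "0 < c"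
  shows "Lp_norm p (\<lambda>x. f (c *\<^sub>R x) * complex_of_real (norm x powr a)) =
    ennreal (c powr (- a - real DIM('a) * recip p)) * Lp_norm p (\<lambda>x. f x * complex_of_real (norm x powr a))"
proof -
  have *: "f (c *\<^sub>R x) * complex_of_real (norm x powr a)
    = complex_of_real (c powr (- a)) * (f (c *\<^sub>R x) * complex_of_real (norm (c *\<^sub>R x) powr a))" for x
    using c by (simp add: powr_mult powr_minus)
  have "Lp_norm p (\<lambda>x. f (c *\<^sub>R x) * complex_of_real (norm x powr a))
    = Lp_norm p (\<lambda>x. complex_of_real (c powr (- a)) * (f (c *\<^sub>R x) * complex_of_real (norm (c *\<^sub>R x) powr a)))"
    by (rule Lp_norm_cong_norm) (simp only: *)
  also have "\<dots> = ennreal (norm (complex_of_real (c powr (- a)))) * Lp_norm p (\<lambda>x. f (c *\<^sub>R x) * complex_of_real (norm (c *\<^sub>R x) powr a))"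
    by (intro Lp_norm_scale p) measurable
  also have "\<dots> = ennreal (c powr (- a)) * (ennreal (c powr (- real DIM('a) * recip p)) * Lp_norm p (\<lambda>x. f x * complex_of_real (norm x powr a)))"
    using Lp_norm_dilate[OF p, of "\<lambda>x. f x * complex_of_real (norm x powr a)" c] c by simp
  also have "\<dots> = ennreal (c powr (- a - real DIM('a) * recip p)) * Lp_norm p (\<lambda>x. f x * complex_of_real (norm x powr a))"
    by (simp add: mult.assoc[symmetric] ennreal_mult[symmetric] powr_add[symmetric])
  finally show ?thesis .
qed

lemma fourier_dilate:
  fixes f :: "'a::euclidean_space \<Rightarrow> complex"
  assumes [measurable]: "f \<in> borel_measurable borel" and c: "0 < c"
  shows "fourier (\<lambda>x. f (c *\<^sub>R x)) \<xi> = complex_of_real (c powr (- real DIM('a))) * fourier f ((1 / c) *\<^sub>R \<xi>)"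
proof -
  have "fourier f ((1 / c) *\<^sub>R \<xi>) = (LINT x|lborel. f x * chi (x \<bullet> ((1 / c) *\<^sub>R \<xi>)))"
    by (rule fourier_eq) measurable
  also have "\<dots> = of_real (\<bar>c\<bar> ^ DIM('a)) * (LINT x|lborel. f (0 + c *\<^sub>R x) * chi ((0 + c *\<^sub>R x) \<bullet> ((1 / c) *\<^sub>R \<xi>)))"
    using c by (intro integral_lborel_affine) auto
  also have "\<dots> = of_real (c powr real DIM('a)) * fourier (\<lambda>x. f (c *\<^sub>R x)) \<xi>"
    using c by (subst fourier_eq) (auto simp: powr_realpow)
  finally show ?thesis
    using c by (simp add: mult.assoc[symmetric] powr_add[symmetric] flip: of_real_mult)
qed

lemma Lp_norm_gauss_weight:
  fixes a \<kappa> :: real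
  assumes p: "1 \<le> p" and a: "0 \<le> a" and \<kappa>: "0 < \<kappa>"
  shows "Lp_norm p (\<lambda>x::'a::euclidean_space. gauss \<kappa> x * complex_of_real (norm x powr a)) < top"
proof (rule Lp_norm_less_topI[OF p, where M = "exp (a\<^sup>2 / (4 * (pi * \<kappa>)))"])
  have n: "norm (gauss \<kappa> x * complex_of_real (norm x powr a)) = norm x powr a * exp (- (pi * \<kappa>) * (norm x)\<^sup>2)" for x :: 'a
    by (simp add: norm_mult norm_gauss mult_ac)
  show "norm (gauss \<kappa> x * complex_of_real (norm x powr a)) \<le> exp (a\<^sup>2 / (4 * (pi * \<kappa>)))" for x :: 'a
    unfolding n using a \<kappa> by (intro powr_mult_exp_le) auto
  fix P :: real assume P: "1 \<le> P"
  have "norm (gauss \<kappa> x * complex_of_real (norm x powr a)) powr P = norm x powr (a * P) * exp (- (pi * \<kappa> * P) * (norm x)\<^sup>2)" for x :: 'a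
    unfolding n by (simp add: powr_mult powr_powr exp_powr_real mult_ac)
  moreover have "- real DIM('a) < a * P"
    using a P by (meson DIM_positive less_le_trans mult_nonneg_nonneg neg_less_0_iff_less of_nat_0_less_iff order_trans zero_le_one)
  ultimately show "(\<integral>\<^sup>+x. ennreal (norm (gauss \<kappa> (x::'a) * complex_of_real (norm x powr a)) powr P) \<partial>lborel) < top"
    using nn_integral_norm_powr_gauss[of "a * P" "pi * \<kappa> * P", where 'a = 'a] \<kappa> P by simp
qed measurable

lemma Lp_norm_gauss:
  assumes p: "1 \<le> p" and \<kappa>: "0 < \<kappa>"
  obtains G where "0 < G" "Lp_norm p (gauss \<kappa> :: 'a::euclidean_space \<Rightarrow> complex) = ennreal G"
proof -
  have "Lp_norm p (gauss \<kappa> :: 'a \<Rightarrow> complex) \<le> Lp_norm p (\<lambda>x::'a. gauss \<kappa> x * complex_of_real (norm x powr 0))"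
  proof (intro Lp_norm_AE_mono p)
    show "AE x in lborel. norm (gauss \<kappa> (x::'a)) \<le> norm (gauss \<kappa> x * complex_of_real (norm x powr 0))"
      using AE_lborel_singleton[of "0::'a"] by eventually_elim (simp add: norm_mult)
  qed measurable
  also have "\<dots> < top"
    using p \<kappa> by (intro Lp_norm_gauss_weight) auto
  finally obtain G where G: "0 \<le> G" "Lp_norm p (gauss \<kappa> :: 'a \<Rightarrow> complex) = ennreal G"
    by (cases "Lp_norm p (gauss \<kappa> :: 'a \<Rightarrow> complex)") auto
  moreover have "G \<noteq> 0"
  proof
    assume "G = 0"
    then have "AE x in lborel. gauss \<kappa> (x::'a) = 0"
      using G by (intro Lp_norm_eq_0_AE[OF p]) auto
    then have "AE x in (lborel :: 'a measure). False"
      by (auto simp: gauss_def)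
    then have "(\<integral>\<^sup>+x. 1 \<partial>(lborel :: 'a measure)) = (\<integral>\<^sup>+x. 0 \<partial>(lborel :: 'a measure))"
      by (intro nn_integral_cong_AE) (rule eventually_mono, assumption, blast)
    then show False
      by simp
  qed
  ultimately show ?thesis
    using that[of G] by simp
qed

text \<open>Once N^(e-r) exceeds (|a| + |b|) / G, the left side wins, the constant a being at most
  |a| N^r. Both counterexamples with N summands end in this comparison.\<close>

lemma powr_growth_contradiction:
  fixes a b e r G :: real
  assumes le: "\<And>N::nat. 1 \<le> N \<Longrightarrow> real N powr e * G \<le> a + b * real N powr r"
    and r: "0 \<le> r" "r < e" and G: "0 < G"
  shows False
proof -
  define X where "X = (\<bar>a\<bar> + \<bar>b\<bar>) / G + 1"
  have X: "0 < X"
    using G by (simp add: X_def add_nonneg_pos)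
  obtain N0 :: nat where N0: "X powr (1 / (e - r)) \<le> real N0"
    using real_arch_simple by blast
  define N where "N = max 1 N0"
  have "(X powr (1 / (e - r))) powr (e - r) \<le> real N powr (e - r)"
    using N0 r by (intro powr_mono2) (auto simp: N_def)
  then have N: "(\<bar>a\<bar> + \<bar>b\<bar>) / G + 1 \<le> real N powr (e - r)" "1 \<le> N"
    using X r by (auto simp: powr_powr X_def N_def)
  have "real N powr e * G \<le> a + b * real N powr r"
    by (rule le[OF N(2)])
  also have "\<dots> \<le> \<bar>a\<bar> * real N powr r + \<bar>b\<bar> * real N powr r"
  proof -
    have "1 \<le> real N powr r"
      using N r by (intro ge_one_powr_ge_zero) auto
    then have "a \<le> \<bar>a\<bar> * real N powr r"
      using mult_left_mono[of 1 "real N powr r" "\<bar>a\<bar>"] by simp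
    then show ?thesis
      by (intro add_mono mult_right_mono) auto
  qed
  also have "real N powr e = real N powr (e - r) * real N powr r"
    by (simp flip: powr_add)
  finally have "(real N powr (e - r) * G) * real N powr r \<le> (\<bar>a\<bar> + \<bar>b\<bar>) * real N powr r"
    by (simp add: algebra_simps)
  then have "real N powr (e - r) * G \<le> \<bar>a\<bar> + \<bar>b\<bar>"
    using N by simp
  moreover have "\<bar>a\<bar> + \<bar>b\<bar> < real N powr (e - r) * G"
  proof -
    have "\<bar>a\<bar> + \<bar>b\<bar> < ((\<bar>a\<bar> + \<bar>b\<bar>) / G + 1) * G"
      using G by (simp add: distrib_right[of "(\<bar>a\<bar> + \<bar>b\<bar>) / G"])
    also have "\<dots> \<le> real N powr (e - r) * G"
      using N(1) G by (intro mult_right_mono) auto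
    finally show ?thesis .
  qed
  ultimately show False
    by simp
qed

text \<open>The assumed inequality with a fixed constant, from which the necessary conditions are
  drawn. It is stated for Borel functions, and the argument \<open>ty\<close> fixes the underlying
  space.\<close>

locale uncertainty =
  fixes p q :: ennreal and \<alpha> \<beta> C :: real and d :: real and ty :: "'a::euclidean_space itself"
  assumes p: "1 \<le> p" and q: "1 \<le> q" and \<alpha>: "0 < \<alpha>" and \<beta>: "0 < \<beta>" and C: "0 < C"
    and d: "d = real DIM('a)"
    and ineq: "\<And>f :: 'a \<Rightarrow> complex. integrable lborel f \<Longrightarrow>
      Lp_norm q f \<le> ennreal C * (Lp_norm q (\<lambda>x. f x * complex_of_real (norm x powr \<alpha>))
        + Lp_norm p (\<lambda>\<xi>. fourier f \<xi> * complex_of_real (norm \<xi> powr \<beta>)))"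
begin

lemma d_pos: "0 < d"
  by (simp add: d)

text \<open>The inequality for x \<mapsto> f (l x), divided by the scaling factor of the left side.
  The parameter l trades the two terms against each other: a large l suppresses the spatial term, at
  the cost of the other power of l.\<close>

lemma scaled_inequality:
  fixes f :: "'a \<Rightarrow> complex"
  assumes f: "integrable lborel f" and l: "0 < l"
  shows "Lp_norm q f \<le> ennreal C * (ennreal (l powr (- \<alpha>)) * Lp_norm q (\<lambda>x. f x * complex_of_real (norm x powr \<alpha>))
        + ennreal (l powr (\<beta> - d * (1 - recip q - recip p))) * Lp_norm p (\<lambda>\<xi>. fourier f \<xi> * complex_of_real (norm \<xi> powr \<beta>)))"
proof -
  have [measurable]: "f \<in> borel_measurable borel"
    using f by simp
  let ?A = "Lp_norm q (\<lambda>x. f x * complex_of_real (norm x powr \<alpha>))"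
  let ?B = "Lp_norm p (\<lambda>\<xi>. fourier f \<xi> * complex_of_real (norm \<xi> powr \<beta>))"
  let ?c = "l powr (d * recip q)"
  have int: "integrable lborel (\<lambda>x. f (l *\<^sub>R x))"
    using integrable_lborel_affine[OF f, of l 0] l by simp
  have 1: "Lp_norm q (\<lambda>x. f (l *\<^sub>R x)) = ennreal (l powr (- d * recip q)) * Lp_norm q f"
    unfolding d using l by (intro Lp_norm_dilate q) auto
  have 2: "Lp_norm q (\<lambda>x. f (l *\<^sub>R x) * complex_of_real (norm x powr \<alpha>)) = ennreal (l powr (- \<alpha> - d * recip q)) * ?A"
    unfolding d using l by (intro Lp_norm_dilate_weight q) auto
  have 3: "Lp_norm p (\<lambda>\<xi>. fourier (\<lambda>x. f (l *\<^sub>R x)) \<xi> * complex_of_real (norm \<xi> powr \<beta>)) = ennreal (l powr (- d + \<beta> + d * recip p)) * ?B"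
  proof -
    have "Lp_norm p (\<lambda>\<xi>. fourier (\<lambda>x. f (l *\<^sub>R x)) \<xi> * complex_of_real (norm \<xi> powr \<beta>))
      = Lp_norm p (\<lambda>\<xi>. complex_of_real (l powr (- d)) * (fourier f ((1 / l) *\<^sub>R \<xi>) * complex_of_real (norm \<xi> powr \<beta>)))"
      using l by (simp add: fourier_dilate d mult.assoc)
    also have "\<dots> = ennreal (norm (complex_of_real (l powr (- d)))) * Lp_norm p (\<lambda>\<xi>. fourier f ((1 / l) *\<^sub>R \<xi>) * complex_of_real (norm \<xi> powr \<beta>))"
      by (intro Lp_norm_scale p) measurable
    also have "Lp_norm p (\<lambda>\<xi>. fourier f ((1 / l) *\<^sub>R \<xi>) * complex_of_real (norm \<xi> powr \<beta>)) = ennreal ((1 / l) powr (- \<beta> - d * recip p)) * ?B"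
      unfolding d using l by (intro Lp_norm_dilate_weight p) auto
    also have "(1 / l) powr (- \<beta> - d * recip p) = l powr (\<beta> + d * recip p)"
      using l by (simp add: powr_divide powr_minus_divide powr_diff powr_add)
    also have "ennreal (norm (complex_of_real (l powr (- d)))) * (ennreal (l powr (\<beta> + d * recip p)) * ?B) = ennreal (l powr (- d + \<beta> + d * recip p)) * ?B"
      by (simp add: mult.assoc[symmetric] ennreal_mult[symmetric] powr_add[symmetric] algebra_simps)
    finally show ?thesis .
  qed
  have "ennreal (l powr (- d * recip q)) * Lp_norm q f \<le> ennreal C * (ennreal (l powr (- \<alpha> - d * recip q)) * ?A + ennreal (l powr (- d + \<beta> + d * recip p)) * ?B)"
    using ineq[OF int] unfolding 1 2 3 .
  then have "ennreal ?c * (ennreal (l powr (- d * recip q)) * Lp_norm q f)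
    \<le> ennreal ?c * (ennreal C * (ennreal (l powr (- \<alpha> - d * recip q)) * ?A + ennreal (l powr (- d + \<beta> + d * recip p)) * ?B))"
    by (rule mult_left_mono) simp
  also have "ennreal ?c * (ennreal (l powr (- d * recip q)) * Lp_norm q f) = Lp_norm q f"
    using l by (simp add: mult.assoc[symmetric] ennreal_mult[symmetric] powr_add[symmetric])
  also have "ennreal ?c * (ennreal C * (ennreal (l powr (- \<alpha> - d * recip q)) * ?A + ennreal (l powr (- d + \<beta> + d * recip p)) * ?B))
    = ennreal C * ((ennreal ?c * ennreal (l powr (- \<alpha> - d * recip q))) * ?A + (ennreal ?c * ennreal (l powr (- d + \<beta> + d * recip p))) * ?B)"
    by (simp add: distrib_left mult_ac)
  also have "ennreal ?c * ennreal (l powr (- \<alpha> - d * recip q)) = ennreal (l powr (- \<alpha>))"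
    by (simp add: ennreal_mult[symmetric] powr_add[symmetric])
  also have "ennreal ?c * ennreal (l powr (- d + \<beta> + d * recip p)) = ennreal (l powr (\<beta> - d * (1 - recip q - recip p)))"
    by (simp add: ennreal_mult[symmetric] powr_add[symmetric] algebra_simps)
  finally show ?thesis .
qed

text \<open>Otherwise both powers of l in the scaled inequality for a Gaussian are negative, and
  letting l tend to infinity makes the right side vanish.\<close>

lemma beta_ge: "d * (1 - recip q - recip p) \<le> \<beta>"
proof (rule ccontr)
  assume "\<not> ?thesis"
  then have \<gamma>: "\<beta> - d * (1 - recip q - recip p) < 0" (is "?\<gamma> < 0")
    by simp
  obtain G where G: "0 < G" "Lp_norm q (gauss 1 :: 'a \<Rightarrow> complex) = ennreal G"
    using Lp_norm_gauss[OF q, of 1] by auto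
  obtain A where A: "0 \<le> A" "Lp_norm q (\<lambda>x::'a. gauss 1 x * complex_of_real (norm x powr \<alpha>)) = ennreal A"
    using Lp_norm_gauss_weight[OF q, of \<alpha> 1, where 'a = 'a] \<alpha>
    by (cases "Lp_norm q (\<lambda>x::'a. gauss 1 x * complex_of_real (norm x powr \<alpha>))") auto
  obtain B where B: "0 \<le> B" "Lp_norm p (\<lambda>\<xi>::'a. fourier (gauss 1) \<xi> * complex_of_real (norm \<xi> powr \<beta>)) = ennreal B"
    using Lp_norm_gauss_weight[OF p, of \<beta> 1, where 'a = 'a] \<beta>
    by (cases "Lp_norm p (\<lambda>\<xi>::'a. gauss 1 \<xi> * complex_of_real (norm \<xi> powr \<beta>))") (auto simp: fourier_gauss)
  have "ennreal G \<le> ennreal (C * (l powr (- \<alpha>) * A + l powr ?\<gamma> * B))" if "0 < l" for l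
    using scaled_inequality[OF integrable_gauss[of 1] that] A B C
    unfolding G(2) A(2) B(2) by (simp add: ennreal_mult)
  then have le: "G \<le> C * (l powr (- \<alpha>) * A + l powr ?\<gamma> * B)" if "0 < l" for l
    using that A B C by (subst (asm) ennreal_le_iff) auto
  have "((\<lambda>l. C * (l powr (- \<alpha>) * A + l powr ?\<gamma> * B)) \<longlongrightarrow> C * (0 * A + 0 * B)) at_top"
    using \<alpha> \<gamma> by (intro tendsto_intros tendsto_neg_powr filterlim_ident) auto
  then have "G \<le> C * (0 * A + 0 * B)"
    by (rule tendsto_lowerbound) (use le in \<open>auto intro!: eventually_mono[OF eventually_gt_at_top[of 0]]\<close>)
  then show False
    using G by simp
qed

end

section \<open>Lacunary sums of Gaussians\<close>

lemma powr_divide_two_power: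
  assumes "0 \<le> t"
  shows "(t / 2 ^ j) powr c = t powr c * 2 powr (- c * real j)"
proof -
  have "(2 ^ j :: real) = 2 powr real j"
    by (rule powr_realpow[symmetric]) simp
  then show ?thesis
    using assms by (simp only: powr_divide powr_powr) (simp add: powr_minus_divide mult.commute)
qed

text \<open>Each term is dominated by an increment of the bounded increasing function \<psi> between
  t / 2^(j+1) and t / 2^j, so the sum telescopes. There is no need to locate the scale at which the
  terms peak.\<close>

lemma lacunary_telescope:
  fixes c \<kappa> :: real
  assumes c: "0 < c" and \<kappa>: "0 < \<kappa>"
  obtains M where "0 < M" "\<And>N t. 0 \<le> t \<Longrightarrow>
    (\<Sum>j=1..N. (t / 2 ^ j) powr c * exp (- \<kappa> * (t / 2 ^ j)\<^sup>2)) \<le> M"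
proof -
  define \<theta> where "\<theta> = 2 powr (- c)"
  have \<theta>: "0 < \<theta>" "\<theta> < 1"
    using c powr_less_mono[of "- c" 0 2] by (auto simp: \<theta>_def)
  define \<psi> where "\<psi> t = t powr c / (1 + t powr c)" for t :: real
  \<comment> \<open>With s = t^c the increment of \<psi> is (1 - \<theta>) s / ((1 + s) (1 +
    \<theta> s)), at least (1 - \<theta>) s / (1 + s)^2. The numerator of M bounds (1 + s)^2 exp
    (-\<kappa> t^2).\<close>
  define M where "M = 2 * (1 + exp ((2 * c)\<^sup>2 / (4 * \<kappa>))) / (1 - \<theta>)"
  have M: "0 < M"
    unfolding M_def using \<theta> by (intro divide_pos_pos mult_pos_pos add_pos_pos) auto
  have \<psi>01: "0 \<le> \<psi> t" "\<psi> t \<le> 1" for t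
    by (auto simp: \<psi>_def divide_le_eq_1 add_pos_nonneg)
  have step: "t powr c * exp (- \<kappa> * t\<^sup>2) \<le> M * (\<psi> t - \<psi> (t / 2))" if t: "0 \<le> t" for t
  proof -
    define s where "s = t powr c"
    have s: "0 \<le> s"
      by (simp add: s_def)
    have half: "(t / 2) powr c = \<theta> * s"
      using t by (simp add: s_def \<theta>_def powr_divide powr_minus_divide)
    have diff: "\<psi> t - \<psi> (t / 2) = (1 - \<theta>) * s / ((1 + s) * (1 + \<theta> * s))"
    proof -
      have "0 < 1 + s" "0 < 1 + \<theta> * s"
        using s \<theta> by (auto simp: add_pos_nonneg)
      then show ?thesis
        unfolding \<psi>_def half s_def[symmetric] by (simp add: field_simps)
    qed
    have "(1 + s)\<^sup>2 * exp (- \<kappa> * t\<^sup>2) \<le> 2 * (1 + exp ((2 * c)\<^sup>2 / (4 * \<kappa>)))"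
    proof -
      have "s\<^sup>2 * exp (- \<kappa> * t\<^sup>2) = t powr (2 * c) * exp (- \<kappa> * t\<^sup>2)"
        unfolding s_def by (simp add: power2_eq_square powr_add[symmetric])
      also have "\<dots> \<le> exp ((2 * c)\<^sup>2 / (4 * \<kappa>))"
        using t c \<kappa> by (intro powr_mult_exp_le) auto
      finally have a: "s\<^sup>2 * exp (- \<kappa> * t\<^sup>2) \<le> exp ((2 * c)\<^sup>2 / (4 * \<kappa>))" .
      have b: "exp (- \<kappa> * t\<^sup>2) \<le> 1"
        using \<kappa> by simp
      have "(1 + s)\<^sup>2 \<le> 2 * (1 + s\<^sup>2)"
        using zero_le_power2[of "1 - s"] by (simp add: power2_eq_square algebra_simps)
      then have "(1 + s)\<^sup>2 * exp (- \<kappa> * t\<^sup>2) \<le> 2 * (1 + s\<^sup>2) * exp (- \<kappa> * t\<^sup>2)"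
        by (rule mult_right_mono) simp
      also have "\<dots> = 2 * (exp (- \<kappa> * t\<^sup>2) + s\<^sup>2 * exp (- \<kappa> * t\<^sup>2))"
        by (simp add: algebra_simps)
      also have "\<dots> \<le> 2 * (1 + exp ((2 * c)\<^sup>2 / (4 * \<kappa>)))"
        by (intro mult_left_mono add_mono a b) auto
      finally show ?thesis .
    qed
    then have "(1 + s)\<^sup>2 * exp (- \<kappa> * t\<^sup>2) \<le> M * (1 - \<theta>)"
      using \<theta> by (simp add: M_def)
    moreover have "(1 + s) * (1 + \<theta> * s) \<le> (1 + s)\<^sup>2"
      using s \<theta> unfolding power2_eq_square by (intro mult_left_mono) (auto simp: mult_left_le_one_le)
    then have "(1 + s) * (1 + \<theta> * s) * exp (- \<kappa> * t\<^sup>2) \<le> (1 + s)\<^sup>2 * exp (- \<kappa> * t\<^sup>2)"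
      by (rule mult_right_mono) simp
    ultimately have "(1 + s) * (1 + \<theta> * s) * exp (- \<kappa> * t\<^sup>2) \<le> M * (1 - \<theta>)"
      by linarith
    then have "s * ((1 + s) * (1 + \<theta> * s) * exp (- \<kappa> * t\<^sup>2)) \<le> s * (M * (1 - \<theta>))"
      using s by (rule mult_left_mono)
    moreover have "0 < (1 + s) * (1 + \<theta> * s)"
      using s \<theta> by (intro mult_pos_pos) (auto simp: add_pos_nonneg)
    ultimately show ?thesis
      unfolding diff s_def[symmetric] by (simp add: pos_le_divide_eq mult_ac)
  qed
  have tele: "(\<Sum>j=1..N. \<psi> (t / 2 ^ j) - \<psi> (t / 2 ^ j / 2)) = \<psi> (t / 2) - \<psi> (t / 2 ^ (Suc N))" for N t
    by (induction N) (auto simp: mult.commute)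
  show ?thesis
  proof (rule that[OF M])
    fix N and t :: real assume t: "0 \<le> t"
    have "(\<Sum>j=1..N. (t / 2 ^ j) powr c * exp (- \<kappa> * (t / 2 ^ j)\<^sup>2)) \<le> (\<Sum>j=1..N. M * (\<psi> (t / 2 ^ j) - \<psi> (t / 2 ^ j / 2)))"
      using t by (intro sum_mono step) auto
    also have "\<dots> = M * (\<psi> (t / 2) - \<psi> (t / 2 ^ (Suc N)))"
      by (simp only: sum_distrib_left[symmetric] tele)
    also have "\<dots> \<le> M * 1"
    proof (rule mult_left_mono)
      show "\<psi> (t / 2) - \<psi> (t / 2 ^ Suc N) \<le> 1"
        using \<psi>01(2)[of "t / 2"] \<psi>01(1)[of "t / 2 ^ Suc N"] by linarith
    qed (use M in simp)
    finally show "(\<Sum>j=1..N. (t / 2 ^ j) powr c * exp (- \<kappa> * (t / 2 ^ j)\<^sup>2)) \<le> M"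
      by simp
  qed
qed

text \<open>Modulus or majorant of the transforms of the test functions: the j-th term has height
  2^(-c j) and lives at scale 2^j. For dilated Gaussians c = d (1 - 1/q), for chirps c =
  d/2.\<close>

definition lacunary :: "real \<Rightarrow> real \<Rightarrow> nat \<Rightarrow> 'a::euclidean_space \<Rightarrow> real" where
  "lacunary c \<kappa> N \<xi> = (\<Sum>j=1..N. 2 powr (- c * real j) * exp (- pi * \<kappa> * (norm \<xi> / 2 ^ j)\<^sup>2))"

lemma borel_measurable_lacunary [measurable]: "lacunary c \<kappa> N \<in> borel_measurable borel"
  unfolding lacunary_def by measurable

lemma lacunary_nonneg: "0 \<le> lacunary c \<kappa> N \<xi>"
  unfolding lacunary_def by (intro sum_nonneg) auto

lemma norm_powr_lacunary:
  "norm \<xi> powr c * lacunary c \<kappa> N \<xi> = (\<Sum>j=1..N. (norm \<xi> / 2 ^ j) powr c * exp (- (pi * \<kappa>) * (norm \<xi> / 2 ^ j)\<^sup>2))"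
  unfolding lacunary_def sum_distrib_left
  by (intro sum.cong refl) (simp add: powr_divide_two_power)

text \<open>Only about one of the \<open>N\<close> terms matters at each dyadic scale, so that the \<open>L\<^sup>p\<close> norm with the
  critical weight grows like \<open>N powr (1/p)\<close>.\<close>

lemma Lp_norm_lacunary_critical:
  fixes c \<kappa> :: real and p :: ennreal
  assumes p: "1 \<le> p" and c: "0 < c" and \<kappa>: "0 < \<kappa>"
  shows "\<exists>K\<ge>0. \<forall>N. Lp_norm p (\<lambda>\<xi>::'a::euclidean_space. complex_of_real (norm \<xi> powr (c - DIM('a) * recip p) * lacunary c \<kappa> N \<xi>))
    \<le> ennreal (K * real N powr recip p)"
proof -
  obtain M where M: "0 < M" "\<And>N t. 0 \<le> t \<Longrightarrow>
    (\<Sum>j=1..N. (t / 2 ^ j) powr c * exp (- (pi * \<kappa>) * (t / 2 ^ j)\<^sup>2)) \<le> M"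
    by (rule lacunary_telescope[OF c mult_pos_pos[OF pi_gt_zero \<kappa>]]) blast
  have le_M: "norm \<xi> powr c * lacunary c \<kappa> N \<xi> \<le> M" for \<xi> :: 'a and N
    unfolding norm_powr_lacunary by (intro M) auto
  from p show ?thesis
  proof (cases rule: exponent_cases)
    case inf
    show ?thesis
    proof (intro exI[of _ M] conjI allI)
      fix N
      show "Lp_norm p (\<lambda>\<xi>::'a. complex_of_real (norm \<xi> powr (c - DIM('a) * recip p) * lacunary c \<kappa> N \<xi>)) \<le> ennreal (M * real N powr recip p)"
      \<comment> \<open>Here 1/p = 0 and \<open>0 powr 0 = 0\<close>, so the bound claims 0 for N =
        0; it holds because the sum is empty.\<close>
      proof (cases "N = 0")
        case True
        have "Lp_norm p (\<lambda>\<xi>::'a. complex_of_real (norm \<xi> powr (c - DIM('a) * recip p) * lacunary c \<kappa> N \<xi>)) = 0"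
          using True by (intro Lp_norm_AE_0 p) (auto simp: lacunary_def)
        then show ?thesis
          by simp
      next
        case False
        then show ?thesis
          unfolding inf using le_M lacunary_nonneg[of c \<kappa> N, where 'a = 'a]
          by (subst Lp_norm_inf_le_iff) (auto intro!: AE_I2 ennreal_leI simp: norm_mult abs_of_nonneg)
      qed
    qed (use M in simp)
  next
    case (fin P)
    define \<phi> where "\<phi> \<xi> = norm \<xi> powr (c - DIM('a)) * exp (- (pi * \<kappa>) * (norm \<xi>)\<^sup>2)" for \<xi> :: 'a
    have "(\<integral>\<^sup>+\<xi>. ennreal (\<phi> \<xi>) \<partial>lborel) < \<infinity>"
      unfolding \<phi>_def using c \<kappa> by (intro nn_integral_norm_powr_gauss) auto
    then obtain I where I: "0 \<le> I" "(\<integral>\<^sup>+\<xi>. ennreal (\<phi> \<xi>) \<partial>lborel) = ennreal I"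
      by (cases "\<integral>\<^sup>+\<xi>. ennreal (\<phi> \<xi>) \<partial>lborel") auto
    have [measurable]: "\<phi> \<in> borel_measurable borel"
      unfolding \<phi>_def by measurable
    define K where "K = (M powr (P - 1) * I) powr (1 / P)"
    show ?thesis
    proof (intro exI[of _ K] conjI allI)
      fix N
      have pw: "norm (complex_of_real (norm \<xi> powr (c - DIM('a) * recip p) * lacunary c \<kappa> N \<xi>)) powr P
        \<le> (\<Sum>j=1..N. M powr (P - 1) * (2 powr (- real DIM('a) * real j) * \<phi> ((1 / 2 ^ j) *\<^sub>R \<xi>)))" if "\<xi> \<noteq> 0" for \<xi> :: 'a
      proof -
        define w where "w = norm \<xi> powr c * lacunary c \<kappa> N \<xi>"
        have w: "0 \<le> w" "w \<le> M"
          using le_M lacunary_nonneg[of c \<kappa> N \<xi>] by (auto simp: w_def)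
        have "norm (complex_of_real (norm \<xi> powr (c - DIM('a) * recip p) * lacunary c \<kappa> N \<xi>)) = norm \<xi> powr (- DIM('a) * recip p) * w"
          using lacunary_nonneg[of c \<kappa> N \<xi>] by (simp add: w_def powr_diff powr_minus_divide norm_mult norm_divide)
        then have "norm (complex_of_real (norm \<xi> powr (c - DIM('a) * recip p) * lacunary c \<kappa> N \<xi>)) powr P = norm \<xi> powr (- real DIM('a)) * w powr P"
          using w fin by (simp add: powr_mult powr_powr)
        \<comment> \<open>Since w \<le> M, all but one factor w is estimated by M. The remaining w
          is a sum of N terms whose integrals are all equal by dilation, whence N in the P-th
          power.\<close>
        also have "w powr P = w * w powr (P - 1)"
          using w fin powr_mult_base[of w "P - 1"] by simp
        also have "norm \<xi> powr (- real DIM('a)) * (w * w powr (P - 1)) \<le> norm \<xi> powr (- real DIM('a)) * (w * M powr (P - 1))"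
          using w fin by (intro mult_left_mono powr_mono2) auto
        also have "\<dots> = (\<Sum>j=1..N. M powr (P - 1) * (norm \<xi> powr (- real DIM('a)) * ((norm \<xi> / 2 ^ j) powr c * exp (- (pi * \<kappa>) * (norm \<xi> / 2 ^ j)\<^sup>2))))"
          unfolding w_def norm_powr_lacunary by (simp add: sum_distrib_left sum_distrib_right mult_ac)
        also have "\<dots> = (\<Sum>j=1..N. M powr (P - 1) * (2 powr (- real DIM('a) * real j) * \<phi> ((1 / 2 ^ j) *\<^sub>R \<xi>)))"
        proof (rule sum.cong[OF refl])
          fix j
          have "norm \<xi> powr (- real DIM('a)) = 2 powr (- real DIM('a) * real j) * (norm \<xi> / 2 ^ j) powr (- real DIM('a))"
            using that by (simp add: powr_divide_two_power mult_ac powr_add[symmetric])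
          then have "norm \<xi> powr (- real DIM('a)) * (norm \<xi> / 2 ^ j) powr c = 2 powr (- real DIM('a) * real j) * (norm \<xi> / 2 ^ j) powr (c - DIM('a))"
            by (simp add: powr_add[symmetric] mult.assoc)
          then show "M powr (P - 1) * (norm \<xi> powr (- real DIM('a)) * ((norm \<xi> / 2 ^ j) powr c * exp (- (pi * \<kappa>) * (norm \<xi> / 2 ^ j)\<^sup>2)))
            = M powr (P - 1) * (2 powr (- real DIM('a) * real j) * \<phi> ((1 / 2 ^ j) *\<^sub>R \<xi>))"
            by (simp add: \<phi>_def mult.assoc[symmetric])
        qed
        finally show ?thesis .
      qed
      have "(\<integral>\<^sup>+\<xi>. ennreal (norm (complex_of_real (norm \<xi> powr (c - DIM('a) * recip p) * lacunary c \<kappa> N (\<xi>::'a))) powr P) \<partial>lborel)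
        \<le> (\<integral>\<^sup>+\<xi>. ennreal (\<Sum>j=1..N. M powr (P - 1) * (2 powr (- real DIM('a) * real j) * \<phi> ((1 / 2 ^ j) *\<^sub>R \<xi>))) \<partial>lborel)"
      proof (rule nn_integral_mono_AE)
        show "AE \<xi> in lborel. ennreal (norm (complex_of_real (norm \<xi> powr (c - DIM('a) * recip p) * lacunary c \<kappa> N (\<xi>::'a))) powr P)
          \<le> ennreal (\<Sum>j=1..N. M powr (P - 1) * (2 powr (- real DIM('a) * real j) * \<phi> ((1 / 2 ^ j) *\<^sub>R \<xi>)))"
          using AE_lborel_singleton[of "0::'a"] by eventually_elim (rule ennreal_leI, rule pw)
      qed
      also have "\<dots> = (\<integral>\<^sup>+\<xi>. (\<Sum>j=1..N. ennreal (M powr (P - 1)) * (ennreal (2 powr (- real DIM('a) * real j)) * ennreal (\<phi> ((1 / 2 ^ j) *\<^sub>R \<xi>)))) \<partial>lborel)"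
        by (simp add: sum_ennreal[symmetric] ennreal_mult \<phi>_def)
      also have "\<dots> = (\<Sum>j=1..N. ennreal (M powr (P - 1)) * (ennreal (2 powr (- real DIM('a) * real j)) * (\<integral>\<^sup>+\<xi>. ennreal (\<phi> ((1 / 2 ^ j) *\<^sub>R \<xi>)) \<partial>lborel)))"
        by (subst nn_integral_sum) (simp_all add: nn_integral_cmult)
      also have "\<dots> = (\<Sum>j=1..N. ennreal (M powr (P - 1) * I))"
      proof (rule sum.cong[OF refl])
        fix j :: nat
        have "(\<integral>\<^sup>+\<xi>. ennreal (\<phi> \<xi>) \<partial>lborel) = ennreal (\<bar>1 / 2 ^ j\<bar> ^ DIM('a)) * (\<integral>\<^sup>+\<xi>. ennreal (\<phi> (0 + (1 / 2 ^ j) *\<^sub>R \<xi>)) \<partial>lborel)"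
          by (intro nn_integral_lborel_affine) auto
        also have "\<bar>1 / 2 ^ j :: real\<bar> ^ DIM('a) = 2 powr (- real DIM('a) * real j)"
          using powr_divide_two_power[of 1 j "real DIM('a)"] by (simp add: powr_realpow)
        finally have "ennreal (2 powr (- real DIM('a) * real j)) * (\<integral>\<^sup>+\<xi>. ennreal (\<phi> ((1 / 2 ^ j) *\<^sub>R \<xi>)) \<partial>lborel) = ennreal I"
          using I by simp
        then show "ennreal (M powr (P - 1)) * (ennreal (2 powr (- real DIM('a) * real j)) * (\<integral>\<^sup>+\<xi>. ennreal (\<phi> ((1 / 2 ^ j) *\<^sub>R \<xi>)) \<partial>lborel)) = ennreal (M powr (P - 1) * I)"
          using I by (simp add: ennreal_mult)
      qed
      also have "\<dots> = ennreal (real N * (M powr (P - 1) * I))"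
        using I by (simp add: ennreal_mult ennreal_of_nat_eq_real_of_nat)
      also have "real N * (M powr (P - 1) * I) = (K * real N powr recip p) powr P"
        using fin I by (simp add: K_def powr_mult powr_powr)
      finally show "Lp_norm p (\<lambda>\<xi>::'a. complex_of_real (norm \<xi> powr (c - DIM('a) * recip p) * lacunary c \<kappa> N \<xi>)) \<le> ennreal (K * real N powr recip p)"
        unfolding fin(2) using fin by (subst Lp_norm_le_iff) (auto simp: K_def)
    qed (simp add: K_def)
  qed
qed

lemma sum_two_powr_le:
  fixes c :: real
  assumes c: "0 < c"
  shows "(\<Sum>j=1..N. 2 powr (- c * real j)) \<le> 1 / (2 powr c - 1)"
proof -
  have c1: "1 < 2 powr c"
    using c by (simp add: gr_one_powr)
  have "(\<Sum>j=1..N. 2 powr (- c * real j)) = (1 - 2 powr (- c * real N)) / (2 powr c - 1)"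
  proof (induction N)
    case (Suc N)
    define x y z where "x = 2 powr (- c * real N)" and "y = 2 powr (- c * real (Suc N))" and "z = 2 powr c"
    have "y * z = x" "1 < z"
      using c1 by (auto simp: x_def y_def z_def powr_add[symmetric] algebra_simps)
    then have "(1 - x) / (z - 1) + y = (1 - y) / (z - 1)"
      by (simp add: field_simps)
    then show ?case
      using Suc by (simp add: x_def y_def z_def)
  qed simp
  also have "\<dots> \<le> 1 / (2 powr c - 1)"
    using c1 by (intro divide_right_mono) auto
  finally show ?thesis .
qed

lemma lacunary_le:
  assumes c: "0 < c" and \<kappa>: "0 < \<kappa>"
  shows "lacunary c \<kappa> N \<xi> \<le> 1 / (2 powr c - 1)"
proof -
  have "lacunary c \<kappa> N \<xi> \<le> (\<Sum>j=1..N. 2 powr (- c * real j))"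
    unfolding lacunary_def using \<kappa> by (intro sum_mono) (auto simp: mult_left_le)
  then show ?thesis
    using sum_two_powr_le[OF c, of N] by simp
qed

text \<open>Outside the unit ball the weight is at most the critical one. Inside, the weight is at
  most 1 and the sum is bounded by a geometric series; this constant is absorbed because N^(1/p)
  \<ge> 1.\<close>

lemma Lp_norm_lacunary:
  fixes c \<kappa> b :: real and p :: ennreal
  assumes p: "1 \<le> p" and c: "0 < c" and \<kappa>: "0 < \<kappa>" and b: "0 < b" "b \<le> c - DIM('a) * recip p"
  shows "\<exists>K\<ge>0. \<forall>N\<ge>1. Lp_norm p (\<lambda>\<xi>::'a::euclidean_space. complex_of_real (lacunary c \<kappa> N \<xi>) * complex_of_real (norm \<xi> powr b))
    \<le> ennreal (K * real N powr recip p)"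
proof -
  let ?b = "c - DIM('a) * recip p"
  obtain K where K: "0 \<le> K" "\<And>N. Lp_norm p (\<lambda>\<xi>::'a. complex_of_real (norm \<xi> powr ?b * lacunary c \<kappa> N \<xi>)) \<le> ennreal (K * real N powr recip p)"
    using Lp_norm_lacunary_critical[OF p c \<kappa>] by blast
  obtain V where V: "0 \<le> V" "Lp_norm p (unit_ind :: 'a \<Rightarrow> complex) = ennreal V"
    using Lp_norm_unit_ind[OF p, where 'a = 'a] by (cases "Lp_norm p (unit_ind :: 'a \<Rightarrow> complex)") auto
  define S where "S = 1 / (2 powr c - 1)"
  have S: "0 < S"
    using c by (simp add: S_def gr_one_powr)
  show ?thesis
  proof (intro exI[of _ "S * V + K"] conjI allI impI)
    fix N :: nat assume N: "1 \<le> N"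
    let ?w = "\<lambda>\<xi>::'a. complex_of_real (lacunary c \<kappa> N \<xi>)"
    have "Lp_norm p (\<lambda>\<xi>. ?w \<xi> * complex_of_real (norm \<xi> powr b))
      \<le> Lp_norm p (\<lambda>\<xi>::'a. complex_of_real S * unit_ind \<xi> + complex_of_real (norm \<xi> powr ?b * lacunary c \<kappa> N \<xi>))"
    proof (rule Lp_norm_mono[OF p])
      fix \<xi> :: 'a
      have eq: "norm (complex_of_real S * unit_ind \<xi> + complex_of_real (norm \<xi> powr ?b * lacunary c \<kappa> N \<xi>))
        = (if norm \<xi> \<le> 1 then S else 0) + norm \<xi> powr ?b * lacunary c \<kappa> N \<xi>"
      proof -
        have "complex_of_real S * unit_ind \<xi> + complex_of_real (norm \<xi> powr ?b * lacunary c \<kappa> N \<xi>)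
          = complex_of_real ((if norm \<xi> \<le> 1 then S else 0) + norm \<xi> powr ?b * lacunary c \<kappa> N \<xi>)"
          by (simp add: unit_ind_def)
        then show ?thesis
          using S lacunary_nonneg[of c \<kappa> N \<xi>] by (simp only: norm_of_real) auto
      qed
      have "lacunary c \<kappa> N \<xi> * norm \<xi> powr b \<le> (if norm \<xi> \<le> 1 then S else 0) + norm \<xi> powr ?b * lacunary c \<kappa> N \<xi>"
      proof (cases "norm \<xi> \<le> 1")
        case True
        then have "lacunary c \<kappa> N \<xi> * norm \<xi> powr b \<le> S * 1"
          using lacunary_le[OF c \<kappa>, of N \<xi>] b S lacunary_nonneg[of c \<kappa> N \<xi>]
          by (intro mult_mono powr_le1) (auto simp: S_def)
        then show ?thesis
          using True lacunary_nonneg[of c \<kappa> N \<xi>] by (simp add: add_increasing2)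
      next
        case False
        then have "lacunary c \<kappa> N \<xi> * norm \<xi> powr b \<le> lacunary c \<kappa> N \<xi> * norm \<xi> powr ?b"
          using b lacunary_nonneg[of c \<kappa> N \<xi>] by (intro mult_left_mono powr_mono) auto
        then show ?thesis
          using False by (simp add: mult.commute)
      qed
      then show "norm (?w \<xi> * complex_of_real (norm \<xi> powr b))
        \<le> norm (complex_of_real S * unit_ind \<xi> + complex_of_real (norm \<xi> powr ?b * lacunary c \<kappa> N \<xi>))"
        unfolding eq using lacunary_nonneg[of c \<kappa> N \<xi>] by (simp add: norm_mult)
    qed measurable
    also have "\<dots> \<le> Lp_norm p (\<lambda>\<xi>::'a. complex_of_real S * unit_ind \<xi>) + Lp_norm p (\<lambda>\<xi>::'a. complex_of_real (norm \<xi> powr ?b * lacunary c \<kappa> N \<xi>))"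
      by (intro Lp_norm_triangle p) measurable
    also have "Lp_norm p (\<lambda>\<xi>::'a. complex_of_real S * unit_ind \<xi>) = ennreal (S * V)"
      using S V by (subst Lp_norm_scale[OF p]) (auto simp: ennreal_mult)
    also have "ennreal (S * V) + Lp_norm p (\<lambda>\<xi>::'a. complex_of_real (norm \<xi> powr ?b * lacunary c \<kappa> N \<xi>))
      \<le> ennreal (S * V * real N powr recip p) + ennreal (K * real N powr recip p)"
    proof (intro add_mono K ennreal_leI)
      have "1 \<le> real N powr recip p"
        using N recip_nonneg[of p] by (intro ge_one_powr_ge_zero) auto
      then show "S * V \<le> S * V * real N powr recip p"
        using S V mult_left_mono[of 1 "real N powr recip p" "S * V"] by simp
    qed
    also have "\<dots> = ennreal ((S * V + K) * real N powr recip p)"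
      using S V K by (simp add: ennreal_plus[symmetric] distrib_right del: ennreal_plus)
    finally show "Lp_norm p (\<lambda>\<xi>. ?w \<xi> * complex_of_real (norm \<xi> powr b)) \<le> ennreal ((S * V + K) * real N powr recip p)" .
  qed (use S V K in simp)
qed


lemma sum_powr_le:
  fixes a :: "'i \<Rightarrow> real"
  assumes "finite I" "\<And>i. i \<in> I \<Longrightarrow> 0 \<le> a i" "1 \<le> Q"
  shows "(\<Sum>i\<in>I. a i powr Q) \<le> (\<Sum>i\<in>I. a i) powr Q"
proof -
  let ?s = "\<Sum>i\<in>I. a i"
  have s: "0 \<le> ?s"
    using assms by (intro sum_nonneg) auto
  have "(\<Sum>i\<in>I. a i powr Q) \<le> (\<Sum>i\<in>I. a i * ?s powr (Q - 1))"
  proof (rule sum_mono)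
    fix i assume i: "i \<in> I"
    have "a i powr Q = a i * a i powr (Q - 1)"
      using assms i powr_mult_base[of "a i" "Q - 1"] by simp
    also have "\<dots> \<le> a i * ?s powr (Q - 1)"
      using assms i by (intro mult_left_mono powr_mono2 member_le_sum) auto
    finally show "a i powr Q \<le> a i * ?s powr (Q - 1)" .
  qed
  also have "\<dots> = ?s powr Q"
    using s powr_mult_base[of ?s "Q - 1"] by (simp add: sum_distrib_right[symmetric])
  finally show ?thesis .
qed

section \<open>Necessity in the limiting case\<close>

context uncertainty
begin

text \<open>All terms are positive, so nothing cancels: for finite q the inequality between the l^q
  and l^1 norms gives at least N equal contributions to the q-th power of the norm, and for q =
  \<infinity> all N terms are large near the origin. The weight \<beta> is exactly critical for the
  transforms, which therefore grow only like N^(1/p).\<close>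

lemma beta_critical:
  assumes \<beta>eq: "\<beta> = d * (1 - recip q - recip p)"
  shows "p \<le> q \<and> q < \<infinity>"
proof (rule ccontr)
  assume neg: "\<not> ?thesis"
  define c where "c = d * (1 - recip q)"
  have c_eq: "c - d * recip p = \<beta>"
    by (simp add: c_def \<beta>eq algebra_simps)
  have "0 \<le> d * recip p"
    using d_pos recip_nonneg by simp
  then have c: "0 < c"
    using c_eq \<beta> by simp
  \<comment> \<open>The growth exponent of the left side. At q = \<infinity> it is 1 and not
    \<open>recip top\<close>, which is 0. It exceeds 1/p: for finite q because p > q, and for q =
    \<infinity> because \<beta> > 0 forces 1/p < 1.\<close>
  define e where "e = (if q = top then 1 else recip q)"
  have e: "recip p < e"
  proof (cases "q = top")
    case True
    then have "0 < d * (1 - recip p)"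
      using \<beta> \<beta>eq by simp
    then show ?thesis
      using True d_pos by (simp add: e_def zero_less_mult_iff)
  next
    case False
    then have "\<not> p \<le> q"
      using neg by (simp add: less_top)
    then show ?thesis
      using False recip_le_iff[OF p q] by (simp add: e_def)
  qed
  obtain A where A: "0 \<le> A" "Lp_norm q (\<lambda>x::'a. gauss 1 x * complex_of_real (norm x powr \<alpha>)) = ennreal A"
    using Lp_norm_gauss_weight[OF q, of \<alpha> 1, where 'a = 'a] \<alpha>
    by (cases "Lp_norm q (\<lambda>x::'a. gauss 1 x * complex_of_real (norm x powr \<alpha>))") auto
  obtain K where K: "0 \<le> K" "\<And>N. 1 \<le> N \<Longrightarrow>
    Lp_norm p (\<lambda>\<xi>::'a. complex_of_real (lacunary c 1 N \<xi>) * complex_of_real (norm \<xi> powr \<beta>)) \<le> ennreal (K * real N powr recip p)"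
    using Lp_norm_lacunary[OF p c, of 1 \<beta>, where 'a = 'a] \<beta> c_eq d by auto
  define f where "f N x = (\<Sum>j=1..N. complex_of_real (2 powr (d * recip q * real j)) * gauss 1 ((2 ^ j) *\<^sub>R x))" for N and x :: 'a
  have gint: "integrable lborel (\<lambda>x::'a. gauss 1 ((2 ^ j) *\<^sub>R x))" for j
    using integrable_lborel_affine[OF integrable_gauss[of 1, where 'a = 'a], of "2 ^ j" 0] by simp
  have fint: "integrable lborel (f N)" for N
    unfolding f_def by (intro Bochner_Integration.integrable_sum integrable_mult_right gint)
  have [measurable]: "f N \<in> borel_measurable borel" for N
    using fint[of N] by simp
  have norm_f: "norm (f N x) = (\<Sum>j=1..N. 2 powr (d * recip q * real j) * norm (gauss 1 ((2 ^ j) *\<^sub>R x)))" for N x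
  proof -
    have "f N x = complex_of_real (\<Sum>j=1..N. 2 powr (d * recip q * real j) * exp (- pi * 1 * (norm ((2 ^ j) *\<^sub>R x))\<^sup>2))"
      by (simp only: f_def gauss_def of_real_sum of_real_mult)
    then have "norm (f N x) = \<bar>\<Sum>j=1..N. 2 powr (d * recip q * real j) * exp (- pi * 1 * (norm ((2 ^ j) *\<^sub>R x))\<^sup>2)\<bar>"
      by (simp only: norm_of_real)
    also have "\<dots> = (\<Sum>j=1..N. 2 powr (d * recip q * real j) * exp (- pi * 1 * (norm ((2 ^ j) *\<^sub>R x))\<^sup>2))"
      by (intro abs_of_nonneg sum_nonneg) auto
    finally show ?thesis
      by (simp only: norm_gauss)
  qed
  have ff: "fourier (f N) \<xi> = complex_of_real (lacunary c 1 N \<xi>)" for N \<xi>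
  proof -
    have "fourier (f N) \<xi> = (LINT x|lborel. (\<Sum>j=1..N. complex_of_real (2 powr (d * recip q * real j)) * (gauss 1 ((2 ^ j) *\<^sub>R x) * chi (x \<bullet> \<xi>))))"
      by (subst fourier_eq) (simp_all add: f_def sum_distrib_right mult.assoc)
    also have "\<dots> = (\<Sum>j=1..N. complex_of_real (2 powr (d * recip q * real j)) * fourier (\<lambda>x. gauss 1 ((2 ^ j) *\<^sub>R x)) \<xi>)"
      by (subst Bochner_Integration.integral_sum) (auto simp: fourier_eq intro!: integrable_mult_right integrable_mult_chi gint)
    also have "\<dots> = (\<Sum>j=1..N. complex_of_real (2 powr (- c * real j) * exp (- pi * 1 * (norm \<xi> / 2 ^ j)\<^sup>2)))"
    proof (rule sum.cong[OF refl])
      fix j :: nat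
      have "fourier (\<lambda>x. gauss 1 ((2 ^ j) *\<^sub>R x)) \<xi> = complex_of_real ((2 ^ j) powr (- d)) * fourier (gauss 1) ((1 / 2 ^ j) *\<^sub>R \<xi>)"
        unfolding d by (rule fourier_dilate) auto
      also have "fourier (gauss 1) ((1 / 2 ^ j) *\<^sub>R \<xi>) = complex_of_real (exp (- pi * 1 * (norm \<xi> / 2 ^ j)\<^sup>2))"
        by (subst fourier_gauss) (auto simp: gauss_def)
      also have "(2 ^ j :: real) powr (- d) = 2 powr (- d * real j)"
        by (simp add: powr_powr mult.commute flip: powr_realpow[of 2 j])
      finally have "complex_of_real (2 powr (d * recip q * real j)) * fourier (\<lambda>x. gauss 1 ((2 ^ j) *\<^sub>R x)) \<xi>
        = complex_of_real ((2 powr (d * recip q * real j) * 2 powr (- d * real j)) * exp (- pi * 1 * (norm \<xi> / 2 ^ j)\<^sup>2))"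
        by (simp only: of_real_mult mult.assoc)
      also have "2 powr (d * recip q * real j) * 2 powr (- d * real j) = 2 powr (- c * real j)"
        by (simp add: powr_add[symmetric] c_def algebra_simps)
      finally show "complex_of_real (2 powr (d * recip q * real j)) * fourier (\<lambda>x. gauss 1 ((2 ^ j) *\<^sub>R x)) \<xi>
        = complex_of_real (2 powr (- c * real j) * exp (- pi * 1 * (norm \<xi> / 2 ^ j)\<^sup>2))" .
    qed
    finally show ?thesis
      by (simp only: lacunary_def of_real_sum)
  qed
  \<comment> \<open>The j-th summand contributes 2^(-\<alpha> j) A to the spatial term, so a
    geometric series bounds this term uniformly in N.\<close>
  define S where "S = 1 / (2 powr \<alpha> - 1)"
  have S: "0 < S"
    using \<alpha> by (simp add: S_def gr_one_powr)
  have f\<alpha>: "Lp_norm q (\<lambda>x. f N x * complex_of_real (norm x powr \<alpha>)) \<le> ennreal (S * A)" for N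
  proof -
    have "Lp_norm q (\<lambda>x. f N x * complex_of_real (norm x powr \<alpha>))
      = Lp_norm q (\<lambda>x::'a. \<Sum>j=1..N. complex_of_real (2 powr (d * recip q * real j)) * (gauss 1 ((2 ^ j) *\<^sub>R x) * complex_of_real (norm x powr \<alpha>)))"
      by (simp add: f_def sum_distrib_right mult.assoc)
    also have "\<dots> \<le> (\<Sum>j=1..N. Lp_norm q (\<lambda>x::'a. complex_of_real (2 powr (d * recip q * real j)) * (gauss 1 ((2 ^ j) *\<^sub>R x) * complex_of_real (norm x powr \<alpha>))))"
      by (intro Lp_norm_sum q) auto
    also have "\<dots> = (\<Sum>j=1..N. ennreal (2 powr (- \<alpha> * real j) * A))"
    proof (rule sum.cong[OF refl])
      fix j :: nat
      have "Lp_norm q (\<lambda>x::'a. complex_of_real (2 powr (d * recip q * real j)) * (gauss 1 ((2 ^ j) *\<^sub>R x) * complex_of_real (norm x powr \<alpha>)))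
        = ennreal (norm (complex_of_real (2 powr (d * recip q * real j)))) * Lp_norm q (\<lambda>x::'a. gauss 1 ((2 ^ j) *\<^sub>R x) * complex_of_real (norm x powr \<alpha>))"
        by (intro Lp_norm_scale q) measurable
      also have "Lp_norm q (\<lambda>x::'a. gauss 1 ((2 ^ j) *\<^sub>R x) * complex_of_real (norm x powr \<alpha>)) = ennreal ((2 ^ j) powr (- \<alpha> - d * recip q)) * ennreal A"
        unfolding A(2)[symmetric] d by (intro Lp_norm_dilate_weight q) auto
      also have "(2 ^ j :: real) powr (- \<alpha> - d * recip q) = 2 powr ((- \<alpha> - d * recip q) * real j)"
        by (simp add: powr_powr mult.commute flip: powr_realpow[of 2 j])
      also have "ennreal (norm (complex_of_real (2 powr (d * recip q * real j)))) * (ennreal (2 powr ((- \<alpha> - d * recip q) * real j)) * ennreal A)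
        = ennreal ((2 powr (d * recip q * real j) * 2 powr ((- \<alpha> - d * recip q) * real j)) * A)"
        using A by (simp add: ennreal_mult mult.assoc)
      also have "2 powr (d * recip q * real j) * 2 powr ((- \<alpha> - d * recip q) * real j) = 2 powr (- \<alpha> * real j)"
        by (simp add: powr_add[symmetric] algebra_simps)
      finally show "Lp_norm q (\<lambda>x::'a. complex_of_real (2 powr (d * recip q * real j)) * (gauss 1 ((2 ^ j) *\<^sub>R x) * complex_of_real (norm x powr \<alpha>)))
        = ennreal (2 powr (- \<alpha> * real j) * A)" .
    qed
    also have "\<dots> = ennreal ((\<Sum>j=1..N. 2 powr (- \<alpha> * real j)) * A)"
      using A by (subst sum_ennreal) (auto simp: sum_distrib_right)
    also have "\<dots> \<le> ennreal (S * A)"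
      unfolding S_def using A sum_two_powr_le[OF \<alpha>, of N] by (intro ennreal_leI mult_right_mono) auto
    finally show ?thesis .
  qed
  have upper: "Lp_norm q (f N) \<le> ennreal (C * (S * A + K * real N powr recip p))" if N: "1 \<le> N" for N
  proof -
    have "Lp_norm q (f N) \<le> ennreal C * (ennreal (S * A) + ennreal (K * real N powr recip p))"
      using f\<alpha>[of N] K(2)[OF N] by (intro order_trans[OF ineq[OF fint]] mult_left_mono add_mono) (auto simp: ff)
    also have "\<dots> = ennreal (C * (S * A + K * real N powr recip p))"
      using C S A K by (simp add: ennreal_mult)
    finally show ?thesis .
  qed
  have nonneg: "0 \<le> C * (S * A + K * real N powr recip p)" for N
    using C S A K by simp
  have "\<exists>G>0. \<forall>N\<ge>1. real N powr e * G \<le> C * (S * A + K * real N powr recip p)"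
  proof (cases "q = top")
    case True
    have "real N powr e * exp (- pi) \<le> C * (S * A + K * real N powr recip p)" if N: "1 \<le> N" for N
    proof (rule ccontr)
      assume neg: "\<not> ?thesis"
      \<comment> \<open>On the ball of radius 2^(-N) every dilated argument has norm at most 1, so
        each of the N Gaussians is at least exp (-\<pi>) there.\<close>
      have low: "real N * exp (- pi) \<le> norm (f N x)" if x: "norm x \<le> 1 / 2 ^ N" for x
      proof -
        have "real N * exp (- pi) = (\<Sum>j=1..N. exp (- pi))"
          by simp
        also have "\<dots> \<le> (\<Sum>j=1..N. 2 powr (d * recip q * real j) * norm (gauss 1 ((2 ^ j) *\<^sub>R x)))"
        proof (rule sum_mono)
          fix j assume j: "j \<in> {1..N}"
          have "norm ((2 ^ j) *\<^sub>R x) = 2 ^ j * norm x"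
            by simp
          also have "\<dots> \<le> 2 ^ N * (1 / 2 ^ N)"
            using x j by (intro mult_mono) (auto intro: power_increasing)
          finally have "(norm ((2 ^ j) *\<^sub>R x))\<^sup>2 \<le> 1"
            by (simp add: power_le_one)
          then show "exp (- pi) \<le> 2 powr (d * recip q * real j) * norm (gauss 1 ((2 ^ j) *\<^sub>R x))"
            using True mult_left_mono[of "(norm ((2 ^ j) *\<^sub>R x))\<^sup>2" 1 pi] by (simp add: norm_gauss del: norm_scaleR)
        qed
        finally show ?thesis
          by (simp only: norm_f)
      qed
      have "AE x in lborel. ennreal (norm (f N x)) \<le> ennreal (C * (S * A + K * real N powr recip p))"
        using upper[OF N] unfolding True by (subst (asm) Lp_norm_inf_le_iff) auto
      then have "AE x in lborel. x \<notin> ball (0::'a) (1 / 2 ^ N)"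
      proof eventually_elim
        case (elim x)
        then show ?case
          using nonneg[of N] neg low[of x] True N by (auto simp: e_def not_le)
      qed
      then have "emeasure lborel (ball (0::'a) (1 / 2 ^ N)) = 0"
        by (subst (asm) AE_iff_measurable[of "ball (0::'a) (1 / 2 ^ N)"]) auto
      then show False
        by (simp add: emeasure_ball unit_ball_vol_pos ennreal_eq_0_iff)
           (metis less_irrefl mult_pos_pos of_nat_0_le_iff unit_ball_vol_pos zero_less_divide_1_iff zero_less_numeral zero_less_power not_le)
    qed
    then show ?thesis
      by (intro exI[of _ "exp (- pi)"]) auto
  next
    case False
    then obtain Q where Q: "1 \<le> Q" "q = ennreal Q" "recip q = 1 / Q"
      by - (rule exponent_cases[OF q], auto)
    obtain G where G: "0 < G" "Lp_norm q (gauss 1 :: 'a \<Rightarrow> complex) = ennreal G"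
      using Lp_norm_gauss[OF q, of 1] by auto
    have "real N powr e * G \<le> C * (S * A + K * real N powr recip p)" if N: "1 \<le> N" for N
    proof -
      let ?g = "\<integral>\<^sup>+x. ennreal (norm (gauss 1 (x::'a)) powr Q) \<partial>lborel"
      let ?u = "C * (S * A + K * real N powr recip p)"
      have "(\<integral>\<^sup>+x. (\<Sum>j=1..N. ennreal ((2 ^ j) powr d) * ennreal (norm (gauss 1 ((2 ^ j) *\<^sub>R (x::'a))) powr Q)) \<partial>lborel)
        \<le> (\<integral>\<^sup>+x. ennreal (norm (f N x) powr Q) \<partial>lborel)"
      proof (rule nn_integral_mono)
        fix x :: 'a
        have "(\<Sum>j=1..N. (2 ^ j) powr d * norm (gauss 1 ((2 ^ j) *\<^sub>R x)) powr Q)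
          = (\<Sum>j=1..N. (2 powr (d * recip q * real j) * norm (gauss 1 ((2 ^ j) *\<^sub>R x))) powr Q)"
          using Q by (intro sum.cong refl) (simp add: powr_mult powr_powr mult.commute flip: powr_realpow[of 2])
        also have "\<dots> \<le> norm (f N x) powr Q"
          unfolding norm_f using Q by (intro sum_powr_le) auto
        finally show "(\<Sum>j=1..N. ennreal ((2 ^ j) powr d) * ennreal (norm (gauss 1 ((2 ^ j) *\<^sub>R x)) powr Q)) \<le> ennreal (norm (f N x) powr Q)"
          by (simp add: ennreal_mult[symmetric] sum_ennreal ennreal_leI)
      qed
      also have "\<dots> \<le> ennreal (?u powr Q)"
        using upper[OF N] nonneg[of N] Q Lp_norm_le_iff[of Q ?u "f N"] by simp
      finally have "(\<Sum>j=1..N. ennreal ((2 ^ j) powr d) * (\<integral>\<^sup>+x. ennreal (norm (gauss 1 ((2 ^ j) *\<^sub>R (x::'a))) powr Q) \<partial>lborel)) \<le> ennreal (?u powr Q)"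
        by (subst (asm) nn_integral_sum) (simp_all add: nn_integral_cmult)
      moreover have "ennreal ((2 ^ j) powr d) * (\<integral>\<^sup>+x. ennreal (norm (gauss 1 ((2 ^ j) *\<^sub>R (x::'a))) powr Q) \<partial>lborel) = ?g" for j :: nat
        using nn_integral_lborel_affine[of "\<lambda>x::'a. ennreal (norm (gauss 1 x) powr Q)" "2 ^ j" 0]
        by (simp add: d powr_realpow)
      ultimately have Ng: "of_nat N * ?g \<le> ennreal (?u powr Q)"
        by simp
      \<comment> \<open>N times the Gaussian integral is read as the Q-th power integral of N^(1/Q)
        \<open>gauss 1\<close>, so that the root is taken by \<open>Lp_norm_le_iff\<close>.\<close>
      have "Lp_norm (ennreal Q) (\<lambda>x::'a. complex_of_real (real N powr (1 / Q)) * gauss 1 x) \<le> ennreal ?u"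
      proof (subst Lp_norm_le_iff[OF Q(1) nonneg])
        have "(\<integral>\<^sup>+x. ennreal (norm (complex_of_real (real N powr (1 / Q)) * gauss 1 (x::'a)) powr Q) \<partial>lborel) = of_nat N * ?g"
          using Q by (subst nn_integral_cmult[symmetric])
            (auto simp: norm_mult powr_mult powr_powr ennreal_mult ennreal_of_nat_eq_real_of_nat)
        then show "(\<integral>\<^sup>+x. ennreal (norm (complex_of_real (real N powr (1 / Q)) * gauss 1 (x::'a)) powr Q) \<partial>lborel) \<le> ennreal (?u powr Q)"
          using Ng by simp
      qed
      then have "ennreal (real N powr (1 / Q)) * ennreal G \<le> ennreal ?u"
        using Q q G by (subst (asm) Lp_norm_scale) auto
      then have "ennreal (real N powr (1 / Q) * G) \<le> ennreal ?u"
        using G by (simp add: ennreal_mult)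
      then show ?thesis
        using nonneg[of N] Q False by (subst (asm) ennreal_le_iff) (auto simp: e_def)
    qed
    then show ?thesis
      using G by blast
  qed
  then obtain G where G: "0 < G" "\<And>N. 1 \<le> N \<Longrightarrow> real N powr e * G \<le> C * (S * A) + C * K * real N powr recip p"
    by (auto simp: distrib_left mult.assoc)
  show False
    using powr_growth_contradiction[OF G(2) recip_nonneg e G(1)] .
qed

end

section \<open>Random sums of chirps\<close>

text \<open>A choice of signs is encoded by the set T of indices with sign +1. Expectations become
  finite sums over T in \<open>Pow A\<close>, and independence becomes the induction that adds one
  index.\<close>

definition rsign :: "nat set \<Rightarrow> nat \<Rightarrow> complex" where
  "rsign T j = (if j \<in> T then 1 else - 1)"

lemma norm_rsign [simp]: "norm (rsign T j) = 1"
  by (simp add: rsign_def)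

lemma sum_Pow_insert:
  fixes g :: "nat set \<Rightarrow> real"
  assumes "finite A" "a \<notin> A"
  shows "(\<Sum>T\<in>Pow (insert a A). g T) = (\<Sum>T\<in>Pow A. g T + g (insert a T))"
proof -
  have inj: "inj_on (insert a) (Pow A)"
    using assms by (auto simp: inj_on_def)
  have "(\<Sum>T\<in>Pow (insert a A). g T) = (\<Sum>T\<in>Pow A. g T) + (\<Sum>T\<in>insert a ` Pow A. g T)"
    unfolding Pow_insert using assms by (intro sum.union_disjoint) auto
  also have "(\<Sum>T\<in>insert a ` Pow A. g T) = (\<Sum>T\<in>Pow A. g (insert a T))"
    by (subst sum.reindex[OF inj]) simp
  finally show ?thesis
    by (simp add: sum.distrib)
qed

lemma rsign_sum_insert:
  assumes "finite A" "a \<notin> A" "T \<subseteq> A"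
  shows "(\<Sum>j\<in>insert a A. rsign T j * z j) = (\<Sum>j\<in>A. rsign T j * z j) - z a"
    and "(\<Sum>j\<in>insert a A. rsign (insert a T) j * z j) = (\<Sum>j\<in>A. rsign T j * z j) + z a"
proof -
  have "rsign T a = - 1" "rsign (insert a T) a = 1"
    using assms by (auto simp: rsign_def)
  moreover have "(\<Sum>j\<in>A. rsign (insert a T) j * z j) = (\<Sum>j\<in>A. rsign T j * z j)"
    using assms by (intro sum.cong refl) (auto simp: rsign_def)
  ultimately show "(\<Sum>j\<in>insert a A. rsign T j * z j) = (\<Sum>j\<in>A. rsign T j * z j) - z a"
    "(\<Sum>j\<in>insert a A. rsign (insert a T) j * z j) = (\<Sum>j\<in>A. rsign T j * z j) + z a"
    using assms by simp_all
qed

text \<open>With m = |S|^2 + |z|^2 and \<delta> = 2 (S \<bullet> z), the two squared norms are m -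
  \<delta> and m + \<delta>; the linear terms cancel and Cauchy--Schwarz bounds \<delta>^2. This is
  the averaging over one new sign in the moment inductions.\<close>

lemma norm_add_sub_powers:
  fixes S z :: complex
  shows "(norm (S - z))\<^sup>2 + (norm (S + z))\<^sup>2 = 2 * (norm S)\<^sup>2 + 2 * (norm z)\<^sup>2"
    and "(norm (S - z)) ^ 4 + (norm (S + z)) ^ 4 \<le> 2 * (norm S) ^ 4 + 12 * (norm S)\<^sup>2 * (norm z)\<^sup>2 + 2 * (norm z) ^ 4"
proof -
  define m \<delta> where "m = (norm S)\<^sup>2 + (norm z)\<^sup>2" and "\<delta> = 2 * (S \<bullet> z)"
  have u: "(norm (S + z))\<^sup>2 = m + \<delta>" and v: "(norm (S - z))\<^sup>2 = m - \<delta>"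
    by (simp_all add: m_def \<delta>_def power2_norm_eq_inner inner_add inner_diff inner_commute algebra_simps)
  show "(norm (S - z))\<^sup>2 + (norm (S + z))\<^sup>2 = 2 * (norm S)\<^sup>2 + 2 * (norm z)\<^sup>2"
    unfolding u v by (simp add: m_def)
  have "(S \<bullet> z)\<^sup>2 \<le> (norm S * norm z)\<^sup>2"
    using Cauchy_Schwarz_ineq2[of S z] by (intro abs_le_square_iff[THEN iffD1]) simp
  then have d: "\<delta>\<^sup>2 \<le> 4 * ((norm S)\<^sup>2 * (norm z)\<^sup>2)"
    by (simp add: \<delta>_def power_mult_distrib)
  have "(norm (S - z)) ^ 4 + (norm (S + z)) ^ 4 = ((norm (S - z))\<^sup>2)\<^sup>2 + ((norm (S + z))\<^sup>2)\<^sup>2"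
    by (simp flip: power_mult)
  also have "\<dots> = 2 * m\<^sup>2 + 2 * \<delta>\<^sup>2"
    unfolding u v by (simp add: power2_eq_square algebra_simps)
  also have "\<dots> \<le> 2 * m\<^sup>2 + 2 * (4 * ((norm S)\<^sup>2 * (norm z)\<^sup>2))"
    using d by simp
  also have "\<dots> = 2 * ((norm S)\<^sup>2)\<^sup>2 + 12 * (norm S)\<^sup>2 * (norm z)\<^sup>2 + 2 * ((norm z)\<^sup>2)\<^sup>2"
    by (simp add: m_def power2_eq_square algebra_simps)
  also have "\<dots> = 2 * (norm S) ^ 4 + 12 * (norm S)\<^sup>2 * (norm z)\<^sup>2 + 2 * (norm z) ^ 4"
    by (simp flip: power_mult)
  finally show "(norm (S - z)) ^ 4 + (norm (S + z)) ^ 4 \<le> 2 * (norm S) ^ 4 + 12 * (norm S)\<^sup>2 * (norm z)\<^sup>2 + 2 * (norm z) ^ 4" .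
qed

lemma rademacher_second_moment:
  assumes "finite A"
  shows "(\<Sum>T\<in>Pow A. (norm (\<Sum>j\<in>A. rsign T j * z j))\<^sup>2) = 2 ^ card A * (\<Sum>j\<in>A. (norm (z j))\<^sup>2)"
  using assms
proof (induction A rule: finite_induct)
  case (insert a A)
  have "(\<Sum>T\<in>Pow (insert a A). (norm (\<Sum>j\<in>insert a A. rsign T j * z j))\<^sup>2)
    = (\<Sum>T\<in>Pow A. 2 * (norm (\<Sum>j\<in>A. rsign T j * z j))\<^sup>2 + 2 * (norm (z a))\<^sup>2)"
    unfolding sum_Pow_insert[OF insert.hyps]
    by (intro sum.cong refl) (simp add: rsign_sum_insert[OF insert.hyps] norm_add_sub_powers(1) del: sum.insert)
  also have "\<dots> = 2 * (2 ^ card A * (\<Sum>j\<in>A. (norm (z j))\<^sup>2)) + 2 ^ card A * (2 * (norm (z a))\<^sup>2)"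
    using insert by (simp add: sum.distrib card_Pow flip: sum_distrib_left)
  finally show ?case
    using insert by (simp add: algebra_simps)
qed simp

text \<open>The constant 3 closes the induction: adding a term of squared modulus w to a sum s
  yields 6 s^2 + 12 s w + 2 w^2, at most 6 (s + w)^2, where the factor 6 = 3 * 2 accounts for the
  doubled number of sign choices.\<close>

lemma rademacher_fourth_moment:
  assumes "finite A"
  shows "(\<Sum>T\<in>Pow A. (norm (\<Sum>j\<in>A. rsign T j * z j)) ^ 4) \<le> 3 * 2 ^ card A * (\<Sum>j\<in>A. (norm (z j))\<^sup>2)\<^sup>2"
  using assms
proof (induction A rule: finite_induct)
  case (insert a A)
  define S where "S T = (\<Sum>j\<in>A. rsign T j * z j)" for T
  define s w where "s = (\<Sum>j\<in>A. (norm (z j))\<^sup>2)" and "w = (norm (z a))\<^sup>2"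
  have w: "0 \<le> w" "(norm (z a)) ^ 4 = w\<^sup>2"
    by (simp_all add: w_def flip: power_mult)
  have "(\<Sum>T\<in>Pow (insert a A). (norm (\<Sum>j\<in>insert a A. rsign T j * z j)) ^ 4)
    = (\<Sum>T\<in>Pow A. (norm (S T - z a)) ^ 4 + (norm (S T + z a)) ^ 4)"
    unfolding sum_Pow_insert[OF insert.hyps] S_def
    by (intro sum.cong refl) (simp add: rsign_sum_insert[OF insert.hyps] del: sum.insert)
  also have "\<dots> \<le> (\<Sum>T\<in>Pow A. 2 * (norm (S T)) ^ 4 + 12 * (norm (S T))\<^sup>2 * w + 2 * w\<^sup>2)"
  proof (rule sum_mono)
    fix T
    show "(norm (S T - z a)) ^ 4 + (norm (S T + z a)) ^ 4 \<le> 2 * (norm (S T)) ^ 4 + 12 * (norm (S T))\<^sup>2 * w + 2 * w\<^sup>2"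
      using norm_add_sub_powers(2)[of "S T" "z a"] unfolding w(2) w_def[symmetric] .
  qed
  also have "\<dots> = 2 * (\<Sum>T\<in>Pow A. (norm (S T)) ^ 4) + 12 * (\<Sum>T\<in>Pow A. (norm (S T))\<^sup>2) * w + 2 ^ card A * (2 * w\<^sup>2)"
    using insert.hyps by (simp add: sum.distrib card_Pow sum_distrib_left sum_distrib_right)
  also have "\<dots> \<le> 2 * (3 * 2 ^ card A * s\<^sup>2) + 12 * (2 ^ card A * s) * w + 2 ^ card A * (6 * w\<^sup>2)"
    using insert.IH rademacher_second_moment[OF insert.hyps(1), of z] by (intro add_mono) (auto simp: S_def s_def)
  also have "\<dots> = 3 * 2 ^ card (insert a A) * (s + w)\<^sup>2"
    using insert.hyps by (simp add: power2_eq_square algebra_simps)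
  also have "s + w = (\<Sum>j\<in>insert a A. (norm (z j))\<^sup>2)"
    using insert.hyps by (simp add: s_def w_def)
  finally show ?case .
qed simp

text \<open>Khinchine's inequality, from the second and fourth moments via
  \<open>t\<^sup>2 - t\<^sup>4 \<le> t\<^sup>Q \<le> 1 + t\<^sup>2\<close>.\<close>

lemma Khinchine:
  fixes z :: "nat \<Rightarrow> complex" and Q :: real
  assumes z: "\<And>j. norm (z j) = 1" and Q: "1 \<le> Q" "Q \<le> 2" and N: "1 \<le> N"
  shows "2 ^ N * real N powr (Q / 2) / 12 \<le> (\<Sum>T\<in>Pow {1..N}. norm (\<Sum>j=1..N. rsign T j * z j) powr Q)"
    and "(\<Sum>T\<in>Pow {1..N}. norm (\<Sum>j=1..N. rsign T j * z j) powr Q) \<le> 2 ^ N * 2 * real N powr (Q / 2)"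
proof -
  define S where "S T = norm (\<Sum>j=1..N. rsign T j * z j)" for T
  have S: "0 \<le> S T" for T
    by (simp add: S_def)
  have S2: "(\<Sum>T\<in>Pow {1..N}. (S T)\<^sup>2) = 2 ^ N * real N"
    using rademacher_second_moment[of "{1..N}" z] by (simp add: S_def z)
  have S4: "(\<Sum>T\<in>Pow {1..N}. (S T) ^ 4) \<le> 3 * 2 ^ N * (real N)\<^sup>2"
    using rademacher_fourth_moment[of "{1..N}" z] by (simp add: S_def z)
  have N0: "0 < real N"
    using N by simp
  \<comment> \<open>With m^2 = 6 N the averaged lower bound N / m^2 - 3 N^2 / m^4 equals 1/6 - 1/12
    = 1/12.\<close>
  define m where "m = sqrt (6 * real N)"
  have m: "0 < m" "m\<^sup>2 = 6 * real N" "m ^ 4 = 36 * (real N)\<^sup>2" "m powr Q = (6 * real N) powr (Q / 2)"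
  proof -
    show "0 < m" "m\<^sup>2 = 6 * real N"
      using N0 by (auto simp: m_def)
    have "m ^ 4 = (m\<^sup>2)\<^sup>2"
      by (simp flip: power_mult)
    then show "m ^ 4 = 36 * (real N)\<^sup>2"
      using \<open>m\<^sup>2 = 6 * real N\<close> by (simp add: power_mult_distrib)
    show "m powr Q = (6 * real N) powr (Q / 2)"
      using N0 by (simp add: m_def powr_half_sqrt[symmetric] powr_powr)
  qed
  have low: "t\<^sup>2 - t ^ 4 \<le> t powr Q" if t: "0 \<le> t" for t :: real
  proof (cases "t \<le> 1")
    case True
    have "t\<^sup>2 \<le> t powr Q"
      using t True Q powr_mono'[of Q 2 t] by (cases "t = 0") (auto simp: powr_numeral)
    moreover have "0 \<le> t ^ 4"
      by simp
    ultimately show ?thesis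
      by linarith
  next
    case False
    then have "t\<^sup>2 \<le> t ^ 4"
      by (intro power_increasing) auto
    moreover have "0 \<le> t powr Q"
      by simp
    ultimately show ?thesis
      by linarith
  qed
  have up: "t powr Q \<le> 1 + t\<^sup>2" if t: "0 \<le> t" for t :: real
  proof (cases "t \<le> 1")
    case True
    then have "t powr Q \<le> 1"
      using t Q by (intro powr_le1) auto
    then show ?thesis
      by (simp add: add_increasing2)
  next
    case False
    then have "t powr Q \<le> t powr 2"
      using Q by (intro powr_mono) auto
    then show ?thesis
      using t False by (simp add: powr_numeral)
  qed
  have "2 ^ N / 12 \<le> 2 ^ N * real N / m\<^sup>2 - 3 * 2 ^ N * (real N)\<^sup>2 / m ^ 4"
    unfolding m using N0 by (simp add: field_simps power2_eq_square)
  also have "\<dots> \<le> (\<Sum>T\<in>Pow {1..N}. (S T)\<^sup>2) / m\<^sup>2 - (\<Sum>T\<in>Pow {1..N}. (S T) ^ 4) / m ^ 4"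
    unfolding S2 using S4 m by (intro diff_mono divide_right_mono) auto
  also have "\<dots> = (\<Sum>T\<in>Pow {1..N}. (S T / m)\<^sup>2 - (S T / m) ^ 4)"
    by (simp add: sum_subtractf sum_divide_distrib power_divide)
  also have "\<dots> \<le> (\<Sum>T\<in>Pow {1..N}. (S T / m) powr Q)"
    using S m by (intro sum_mono low) auto
  also have "\<dots> = (\<Sum>T\<in>Pow {1..N}. S T powr Q) / m powr Q"
    by (simp add: powr_divide sum_divide_distrib)
  finally have sum_ge: "2 ^ N / 12 * m powr Q \<le> (\<Sum>T\<in>Pow {1..N}. S T powr Q)"
    using m(1) by (simp add: pos_le_divide_eq)
  have "2 ^ N * real N powr (Q / 2) / 12 = 2 ^ N / 12 * real N powr (Q / 2)"
    by simp
  also have "\<dots> \<le> 2 ^ N / 12 * m powr Q"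
    unfolding m(4) using Q by (intro mult_left_mono powr_mono2) auto
  also have "\<dots> \<le> (\<Sum>T\<in>Pow {1..N}. S T powr Q)"
    by (rule sum_ge)
  finally show "2 ^ N * real N powr (Q / 2) / 12 \<le> (\<Sum>T\<in>Pow {1..N}. norm (\<Sum>j=1..N. rsign T j * z j) powr Q)"
    by (simp only: S_def)
  define n where "n = sqrt (real N)"
  have n: "0 < n" "n\<^sup>2 = real N"
    using N0 by (auto simp: n_def)
  have n3: "n powr Q = real N powr (Q / 2)"
    using N0 by (simp add: n_def powr_half_sqrt[symmetric] powr_powr)
  have "(\<Sum>T\<in>Pow {1..N}. S T powr Q) = (\<Sum>T\<in>Pow {1..N}. (S T / n) powr Q) * n powr Q"
    using n by (simp add: powr_divide sum_distrib_right)
  also have "\<dots> \<le> (\<Sum>T\<in>Pow {1..N}. 1 + (S T / n)\<^sup>2) * n powr Q"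
    using S n by (intro mult_right_mono sum_mono up) auto
  also have "(\<Sum>T\<in>Pow {1..N}. 1 + (S T / n)\<^sup>2) = 2 ^ N + (\<Sum>T\<in>Pow {1..N}. (S T)\<^sup>2) / n\<^sup>2"
    by (simp add: sum.distrib card_Pow power_divide sum_divide_distrib)
  also have "\<dots> = 2 ^ N * 2"
    unfolding S2 n using N0 by simp
  finally show "(\<Sum>T\<in>Pow {1..N}. norm (\<Sum>j=1..N. rsign T j * z j) powr Q) \<le> 2 ^ N * 2 * real N powr (Q / 2)"
    by (simp add: S_def n3)
qed

text \<open>The quadratic phase has gradient B x, so a large B spreads the transform over
  frequencies up to order B while the modulus stays the same Gaussian. Hence Khinchine's inequality
  applies at every x with coefficients of modulus 1.\<close>

definition chirp :: "real \<Rightarrow> 'a::euclidean_space \<Rightarrow> complex" where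
  "chirp B x = gauss 1 x * chi (B * (norm x)\<^sup>2 / 2)"

lemma borel_measurable_chirp [measurable]: "chirp B \<in> borel_measurable borel"
  unfolding chirp_def by measurable

lemma norm_chirp: "norm (chirp B x) = norm (gauss 1 x)"
  by (simp add: chirp_def norm_mult)

lemma integrable_chirp: "integrable lborel (chirp B)"
  by (rule Bochner_Integration.integrable_bound[OF integrable_gauss[of 1]]) (auto simp: norm_chirp)

text \<open>The ambiguity function of a chirp is a real Gaussian up to a character, which reduces its
  Fourier transform to that of real Gaussians.\<close>

lemma chirp_autocorrelation:
  "chirp B (v + (1 / 2) *\<^sub>R u) * cnj (chirp B (v - (1 / 2) *\<^sub>R u)) = gauss (1 / 2) u * (gauss 2 v * chi (v \<bullet> (B *\<^sub>R u)))"
proof -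
  define a b where "a = v + (1 / 2) *\<^sub>R u" and "b = v - (1 / 2) *\<^sub>R u"
  have 1: "(norm a)\<^sup>2 + (norm b)\<^sup>2 = 2 * (norm v)\<^sup>2 + (norm u)\<^sup>2 / 2"
    by (simp add: a_def b_def power2_norm_eq_inner inner_add inner_diff inner_commute algebra_simps)
  have "(norm a)\<^sup>2 - (norm b)\<^sup>2 = 2 * (v \<bullet> u)"
    by (simp add: a_def b_def power2_norm_eq_inner inner_add inner_diff inner_commute algebra_simps)
  then have "B * ((norm a)\<^sup>2 - (norm b)\<^sup>2) / 2 = B * (v \<bullet> u)"
    by simp
  then have 2: "B * (norm a)\<^sup>2 / 2 + - (B * (norm b)\<^sup>2 / 2) = v \<bullet> (B *\<^sub>R u)"
    by (simp add: right_diff_distrib diff_divide_distrib)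
  have "chirp B a * cnj (chirp B b) = (gauss 1 a * gauss 1 b) * (chi (B * (norm a)\<^sup>2 / 2) * chi (- (B * (norm b)\<^sup>2 / 2)))"
    unfolding chirp_def chi_minus by (simp add: gauss_def mult_ac)
  also have "chi (B * (norm a)\<^sup>2 / 2) * chi (- (B * (norm b)\<^sup>2 / 2)) = chi (v \<bullet> (B *\<^sub>R u))"
    by (simp only: chi_add[symmetric] 2)
  also have "gauss 1 a * gauss 1 b = complex_of_real (exp (- pi * ((norm a)\<^sup>2 + (norm b)\<^sup>2)))"
    by (simp add: gauss_def exp_add[symmetric] distrib_left flip: of_real_mult)
  also have "\<dots> = gauss (1 / 2) u * gauss 2 v"
    unfolding 1 by (simp add: gauss_def exp_add[symmetric] algebra_simps flip: of_real_mult)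
  finally show ?thesis
    by (simp add: a_def b_def mult.assoc)
qed

text \<open>The squared modulus is the transform of an autocorrelation. Computing it in place of the
  transform itself leaves two Gaussian integrals with real parameters, first in the centre v and
  then in the difference u.\<close>

lemma norm_fourier_chirp_square:
  fixes \<xi> :: "'a::euclidean_space"
  shows "(norm (fourier (chirp B) \<xi>))\<^sup>2 = (1 + B\<^sup>2) powr (- real DIM('a) / 2) * exp (- pi * (2 / (1 + B\<^sup>2)) * (norm \<xi>)\<^sup>2)"
proof -
  let ?d = "real DIM('a)"
  define \<Phi> where "\<Phi> y u = chirp B (y + u) * cnj (chirp B y) * chi (u \<bullet> \<xi>)" for y u :: 'a
  have B1: "0 < 1 + B\<^sup>2"
    by (simp add: add_pos_nonneg)
  have shift: "integrable lborel (\<lambda>u. chirp B (y + u))" for y :: 'a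
    using integrable_lborel_affine[OF integrable_chirp, of 1 B y] by simp
  have int: "integrable (lborel \<Otimes>\<^sub>M lborel) (\<lambda>(y, u). \<Phi> y u)"
  proof (rule lborel_pair.Fubini_integrable)
    define G where "G = (LINT u|lborel. norm (chirp B (u::'a)))"
    have "(LINT u|lborel. norm (case (y, u) of (y, u) \<Rightarrow> \<Phi> y u)) = norm (chirp B y) * G" for y
    proof -
      have "complex_of_real G = (LINT u|lborel. complex_of_real (norm (chirp B (u::'a))))"
        unfolding G_def by simp
      also have "\<dots> = of_real (\<bar>1\<bar> ^ DIM('a)) * (LINT u|lborel. complex_of_real (norm (chirp B (y + 1 *\<^sub>R u))))"
        by (rule integral_lborel_affine) auto
      finally have "G = (LINT u|lborel. norm (chirp B (y + u)))"
        by simp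
      then show ?thesis
        by (simp add: \<Phi>_def norm_mult mult.commute)
    qed
    then show "integrable lborel (\<lambda>y. LINT u|lborel. norm (case (y, u) of (y, u) \<Rightarrow> \<Phi> y u))"
      using integrable_chirp[of B, where 'a = 'a] by simp
    show "AE y in lborel. integrable lborel (\<lambda>u. case (y, u) of (y, u) \<Rightarrow> \<Phi> y u)"
      using integrable_mult_chi[OF integrable_mult_left[OF shift]] by (simp add: \<Phi>_def)
  qed (simp add: \<Phi>_def)
  have "complex_of_real ((norm (fourier (chirp B) \<xi>))\<^sup>2) = fourier (chirp B) \<xi> * cnj (fourier (chirp B) \<xi>)"
    by (rule complex_norm_square)
  also have "cnj (fourier (chirp B) \<xi>) = (LINT y|lborel. cnj (chirp B y) * cnj (chi (y \<bullet> \<xi>)))"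
    by (simp add: fourier_eq flip: integral_cnj_complex)
  also have "fourier (chirp B) \<xi> * \<dots> = (LINT y|lborel. LINT u|lborel. \<Phi> y u)"
  proof -
    have "fourier (chirp B) \<xi> * (cnj (chirp B y) * cnj (chi (y \<bullet> \<xi>))) = (LINT u|lborel. \<Phi> y u)" for y
    proof -
      have "fourier (chirp B) \<xi> = (LINT x|lborel. chirp B x * chi (x \<bullet> \<xi>))"
        by (rule fourier_eq) measurable
      also have "\<dots> = of_real (\<bar>1\<bar> ^ DIM('a)) * (LINT u|lborel. chirp B (y + 1 *\<^sub>R u) * chi ((y + 1 *\<^sub>R u) \<bullet> \<xi>))"
        by (rule integral_lborel_affine) auto
      finally have "fourier (chirp B) \<xi> * (cnj (chirp B y) * cnj (chi (y \<bullet> \<xi>)))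
        = (LINT u|lborel. chirp B (y + u) * chi ((y + u) \<bullet> \<xi>) * (cnj (chirp B y) * cnj (chi (y \<bullet> \<xi>))))"
        by simp
      moreover have "chi ((y + u) \<bullet> \<xi>) * cnj (chi (y \<bullet> \<xi>)) = chi (u \<bullet> \<xi>)" for u
        by (simp add: chi_minus[symmetric] chi_add[symmetric] inner_add_left)
      then have "chirp B (y + u) * chi ((y + u) \<bullet> \<xi>) * (cnj (chirp B y) * cnj (chi (y \<bullet> \<xi>))) = \<Phi> y u" for u
        unfolding \<Phi>_def by (metis mult.assoc mult.commute)
      ultimately show ?thesis
        by simp
    qed
    then show ?thesis
      by (simp flip: integral_mult_right_zero)
  qed
  also have "\<dots> = (LINT u|lborel. LINT y|lborel. \<Phi> y u)"
    by (rule lborel_pair.Fubini_integral[symmetric]) (rule int)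
  also have "\<dots> = (LINT u|lborel. complex_of_real (2 powr (- ?d / 2)) * (gauss ((1 + B\<^sup>2) / 2) u * chi (u \<bullet> \<xi>)))"
  proof (rule Bochner_Integration.integral_cong[OF refl])
    fix u :: 'a
    \<comment> \<open>Centring y at -u/2 symmetrises the product, so that the autocorrelation
      formula factors it.\<close>
    have "(LINT y|lborel. \<Phi> y u) = of_real (\<bar>1\<bar> ^ DIM('a)) * (LINT v|lborel. \<Phi> (- ((1 / 2) *\<^sub>R u) + 1 *\<^sub>R v) u)"
      unfolding \<Phi>_def by (rule integral_lborel_affine) auto
    also have "\<dots> = (LINT v|lborel. \<Phi> (v - (1 / 2) *\<^sub>R u) u)"
      by simp
    also have "\<dots> = (LINT v|lborel. (gauss (1 / 2) u * chi (u \<bullet> \<xi>)) * (gauss 2 v * chi (v \<bullet> (B *\<^sub>R u))))"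
    proof (rule Bochner_Integration.integral_cong[OF refl])
      fix v :: 'a
      have hu: "(1 / 2) *\<^sub>R u + (1 / 2) *\<^sub>R u = u"
        by (simp flip: scaleR_left_distrib)
      have e: "v - (1 / 2) *\<^sub>R u + u = v + (1 / 2) *\<^sub>R u"
        by (subst (2) hu[symmetric]) (simp only: add.assoc[symmetric] diff_add_cancel)
      have "\<Phi> (v - (1 / 2) *\<^sub>R u) u = (chirp B (v + (1 / 2) *\<^sub>R u) * cnj (chirp B (v - (1 / 2) *\<^sub>R u))) * chi (u \<bullet> \<xi>)"
        by (simp only: \<Phi>_def e)
      then show "\<Phi> (v - (1 / 2) *\<^sub>R u) u = (gauss (1 / 2) u * chi (u \<bullet> \<xi>)) * (gauss 2 v * chi (v \<bullet> (B *\<^sub>R u)))"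
        unfolding chirp_autocorrelation by (simp only: mult_ac)
    qed
    also have "\<dots> = (gauss (1 / 2) u * chi (u \<bullet> \<xi>)) * fourier (gauss 2) (B *\<^sub>R u)"
      by (subst integral_mult_right_zero) (simp add: fourier_eq)
    also have "fourier (gauss 2) (B *\<^sub>R u) = complex_of_real (2 powr (- ?d / 2)) * gauss (1 / 2) (B *\<^sub>R u)"
      by (rule fourier_gauss) simp
    also have "(gauss (1 / 2) u * chi (u \<bullet> \<xi>)) * (complex_of_real (2 powr (- ?d / 2)) * gauss (1 / 2) (B *\<^sub>R u))
      = complex_of_real (2 powr (- ?d / 2)) * ((gauss (1 / 2) u * gauss (1 / 2) (B *\<^sub>R u)) * chi (u \<bullet> \<xi>))"
      by (simp only: mult_ac)
    also have "gauss (1 / 2) u * gauss (1 / 2) (B *\<^sub>R u) = gauss ((1 + B\<^sup>2) / 2) u"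
      by (simp add: gauss_def exp_add[symmetric] power_mult_distrib field_simps flip: of_real_mult)
    finally show "(LINT y|lborel. \<Phi> y u) = complex_of_real (2 powr (- ?d / 2)) * (gauss ((1 + B\<^sup>2) / 2) u * chi (u \<bullet> \<xi>))" .
  qed
  also have "\<dots> = complex_of_real (2 powr (- ?d / 2)) * fourier (gauss ((1 + B\<^sup>2) / 2)) \<xi>"
    by (subst integral_mult_right_zero) (simp add: fourier_eq)
  also have "fourier (gauss ((1 + B\<^sup>2) / 2)) \<xi> = complex_of_real (((1 + B\<^sup>2) / 2) powr (- ?d / 2)) * gauss (1 / ((1 + B\<^sup>2) / 2)) \<xi>"
    using B1 by (intro fourier_gauss) simp
  also have "complex_of_real (2 powr (- ?d / 2)) * (complex_of_real (((1 + B\<^sup>2) / 2) powr (- ?d / 2)) * gauss (1 / ((1 + B\<^sup>2) / 2)) \<xi>)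
    = complex_of_real ((2 powr (- ?d / 2) * ((1 + B\<^sup>2) / 2) powr (- ?d / 2)) * exp (- pi * (2 / (1 + B\<^sup>2)) * (norm \<xi>)\<^sup>2))"
    by (simp add: gauss_def)
  also have "2 powr (- ?d / 2) * ((1 + B\<^sup>2) / 2) powr (- ?d / 2) = (1 + B\<^sup>2) powr (- ?d / 2)"
  proof -
    have "2 * ((1 + B\<^sup>2) / 2) = 1 + B\<^sup>2"
      by simp
    then show ?thesis
      by (simp only: powr_mult[symmetric])
  qed
  finally show ?thesis
    by (simp only: of_real_eq_iff)
qed

text \<open>With B = 2^j one has B^2 \<le> 1 + B^2 \<le> 2 B^2, which puts the transform under the
  j-th term of \<open>lacunary\<close> with c = d/2 and \<kappa> = 1/2.\<close>

lemma norm_fourier_chirp_le: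
  fixes \<xi> :: "'a::euclidean_space"
  shows "norm (fourier (chirp (2 ^ j)) \<xi>) \<le> 2 powr (- (real DIM('a) / 2) * real j) * exp (- pi * (1 / 2) * (norm \<xi> / 2 ^ j)\<^sup>2)"
proof (rule power2_le_imp_le)
  let ?d = "real DIM('a)" and ?B = "2 ^ j :: real"
  have B: "1 \<le> ?B\<^sup>2" "0 < ?B"
    by (auto simp: one_le_power)
  have "(norm (fourier (chirp ?B) \<xi>))\<^sup>2 = (1 + ?B\<^sup>2) powr (- ?d / 2) * exp (- pi * (2 / (1 + ?B\<^sup>2)) * (norm \<xi>)\<^sup>2)"
    by (rule norm_fourier_chirp_square)
  also have "\<dots> \<le> (?B\<^sup>2) powr (- ?d / 2) * exp (- pi * (2 / (2 * ?B\<^sup>2)) * (norm \<xi>)\<^sup>2)"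
  proof (intro mult_mono)
    show "(1 + ?B\<^sup>2) powr (- ?d / 2) \<le> (?B\<^sup>2) powr (- ?d / 2)"
      using B by (intro powr_mono2') auto
    have "2 / (2 * ?B\<^sup>2) \<le> 2 / (1 + ?B\<^sup>2)"
      using B by (intro divide_left_mono mult_pos_pos) (auto simp: add_pos_nonneg)
    then have "pi * (norm \<xi>)\<^sup>2 * (2 / (2 * ?B\<^sup>2)) \<le> pi * (norm \<xi>)\<^sup>2 * (2 / (1 + ?B\<^sup>2))"
      by (intro mult_left_mono) auto
    then show "exp (- pi * (2 / (1 + ?B\<^sup>2)) * (norm \<xi>)\<^sup>2) \<le> exp (- pi * (2 / (2 * ?B\<^sup>2)) * (norm \<xi>)\<^sup>2)"
      by (simp add: mult_ac)
  qed auto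
  also have "(?B\<^sup>2) powr (- ?d / 2) = (2 powr (- (?d / 2) * real j))\<^sup>2"
    by (simp add: powr_powr powr_add[symmetric] power2_eq_square mult_ac flip: powr_realpow[of 2 j])
  also have "exp (- pi * (2 / (2 * ?B\<^sup>2)) * (norm \<xi>)\<^sup>2) = (exp (- pi * (1 / 2) * (norm \<xi> / 2 ^ j)\<^sup>2))\<^sup>2"
    by (simp add: power2_eq_square exp_add[symmetric])
  finally show "(norm (fourier (chirp ?B) \<xi>))\<^sup>2 \<le> (2 powr (- (?d / 2) * real j) * exp (- pi * (1 / 2) * (norm \<xi> / 2 ^ j)\<^sup>2))\<^sup>2"
    by (simp only: power_mult_distrib)
qed simp


lemma powr_add_le:
  fixes a b Q :: real
  assumes "0 \<le> a" "0 \<le> b" "0 \<le> Q"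
  shows "(a + b) powr Q \<le> 2 powr Q * (a powr Q + b powr Q)"
proof -
  have "(a + b) powr Q \<le> (2 * max a b) powr Q"
    using assms by (intro powr_mono2) auto
  also have "\<dots> = 2 powr Q * max a b powr Q"
    by (rule powr_mult)
  also have "max a b powr Q \<le> a powr Q + b powr Q"
    by (auto simp: max_def)
  finally show ?thesis
    by simp
qed

lemma Lp_norm_real:
  assumes "1 \<le> P" "Lp_norm (ennreal P) f < top"
  obtains x where "0 \<le> x" "Lp_norm (ennreal P) f = ennreal x"
    "(\<integral>\<^sup>+x. ennreal (norm (f x) powr P) \<partial>lborel) = ennreal (x powr P)"
proof -
  obtain i where i: "0 \<le> i" "(\<integral>\<^sup>+x. ennreal (norm (f x) powr P) \<partial>lborel) = ennreal i"
    using assms Lp_norm_less_top_iff[of P f] by (cases "\<integral>\<^sup>+x. ennreal (norm (f x) powr P) \<partial>lborel") auto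
  obtain x where x: "0 \<le> x" "Lp_norm (ennreal P) f = ennreal x"
    using assms(2) by (cases "Lp_norm (ennreal P) f") auto
  have "i \<le> x powr P"
    using Lp_norm_le_iff[OF assms(1) x(1), of f] i x by simp
  moreover have "x \<le> i powr (1 / P)"
    using Lp_norm_le_iff[OF assms(1), of "i powr (1 / P)" f] i x assms by (simp add: powr_powr)
  then have "x powr P \<le> (i powr (1 / P)) powr P"
    using x assms by (intro powr_mono2) auto
  ultimately have "i = x powr P"
    using i assms by (simp add: powr_powr)
  then show ?thesis
    using that x i by simp
qed

section \<open>Necessity of the condition for q < 2 < p\<close>

context uncertainty
begin

text \<open>Summing Q-th powers over all sign choices lets Khinchine's inequality act pointwise in
  x, on the left side and on the spatial term alike. Both have order N^(Q/2), so the spatial term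
  must first be made a small fraction by a dilation independent of N. The frequency term, of order
  N^(Q/p) for every choice of signs, then cannot keep up.\<close>

lemma beta_random:
  assumes q2: "q < 2" and p2: "2 < p"
  shows "d * (1 / 2 - recip p) < \<beta>"
proof (rule ccontr)
  assume neg: "\<not> ?thesis"
  have rp: "recip p < 1 / 2"
  proof -
    have "recip p \<noteq> recip 2"
      using recip_inj[of p 2] p p2 by auto
    then show ?thesis
      using recip_antimono[OF _ less_imp_le[OF p2]] recip_ennreal[of 2] by simp
  qed
  obtain Q where Q: "1 \<le> Q" "Q < 2" "q = ennreal Q"
    using q2 by - (rule exponent_cases[OF q], auto)
  define c where "c = d / 2"
  have c: "0 < c" "\<beta> \<le> c - d * recip p"
    using d_pos neg by (auto simp: c_def algebra_simps)
  obtain K where K: "0 \<le> K" "\<And>N. 1 \<le> N \<Longrightarrow>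
    Lp_norm p (\<lambda>\<xi>::'a. complex_of_real (lacunary c (1 / 2) N \<xi>) * complex_of_real (norm \<xi> powr \<beta>)) \<le> ennreal (K * real N powr recip p)"
    using Lp_norm_lacunary[OF p c(1), of "1 / 2" \<beta>, where 'a = 'a] \<beta> c(2) d by auto
  define H where "H N T x = (\<Sum>j=1..N. rsign T j * chirp (2 ^ j) x)" for N T and x :: 'a
  define S where "S N T x = norm (\<Sum>j=1..N. rsign T j * chi (2 ^ j * (norm x)\<^sup>2 / 2))" for N T and x :: 'a
  have [measurable]: "S N T \<in> borel_measurable borel" for N T
    unfolding S_def by measurable
  have Hint: "integrable lborel (H N T)" for N T
    unfolding H_def by (intro Bochner_Integration.integrable_sum integrable_mult_right integrable_chirp)
  have [measurable]: "H N T \<in> borel_measurable borel" for N T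
    using Hint[of N T] by simp
  have norm_H: "norm (H N T x) = norm (gauss 1 x) * S N T x" for N T x
  proof -
    have "H N T x = gauss 1 x * (\<Sum>j=1..N. rsign T j * chi (2 ^ j * (norm x)\<^sup>2 / 2))"
      by (simp add: H_def chirp_def sum_distrib_left mult_ac)
    then show ?thesis
      by (simp add: norm_mult S_def)
  qed
  have fH: "norm (fourier (H N T) \<xi>) \<le> lacunary c (1 / 2) N \<xi>" for N T \<xi>
  proof -
    have "fourier (H N T) \<xi> = (LINT x|lborel. (\<Sum>j=1..N. rsign T j * (chirp (2 ^ j) x * chi (x \<bullet> \<xi>))))"
      by (subst fourier_eq) (simp_all add: H_def sum_distrib_right mult.assoc)
    also have "\<dots> = (\<Sum>j=1..N. rsign T j * fourier (chirp (2 ^ j)) \<xi>)"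
      by (subst Bochner_Integration.integral_sum) (auto simp: fourier_eq intro!: integrable_mult_right integrable_mult_chi integrable_chirp)
    finally have "norm (fourier (H N T) \<xi>) \<le> (\<Sum>j=1..N. norm (rsign T j * fourier (chirp (2 ^ j)) \<xi>))"
      by (simp only: norm_sum)
    also have "\<dots> \<le> lacunary c (1 / 2) N \<xi>"
      unfolding lacunary_def c_def d using norm_fourier_chirp_le[where \<xi> = \<xi>] by (intro sum_mono) (simp add: norm_mult)
    finally show ?thesis .
  qed
  have fH_norm: "Lp_norm p (\<lambda>\<xi>. fourier (H N T) \<xi> * complex_of_real (norm \<xi> powr \<beta>)) \<le> ennreal (K * real N powr recip p)" if N: "1 \<le> N" for N T
  proof -
    have "Lp_norm p (\<lambda>\<xi>. fourier (H N T) \<xi> * complex_of_real (norm \<xi> powr \<beta>))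
      \<le> Lp_norm p (\<lambda>\<xi>::'a. complex_of_real (lacunary c (1 / 2) N \<xi>) * complex_of_real (norm \<xi> powr \<beta>))"
      using order_trans[OF fH abs_ge_self] by (intro Lp_norm_mono p) (auto simp: norm_mult intro!: mult_right_mono)
    then show ?thesis
      using K(2)[OF N] by simp
  qed
  obtain G where G: "0 < G" "Lp_norm q (gauss 1 :: 'a \<Rightarrow> complex) = ennreal G"
    using Lp_norm_gauss[OF q, of 1] by auto
  define I0 where "I0 = G powr Q"
  have I0: "0 < I0" "(\<integral>\<^sup>+x. ennreal (norm (gauss 1 (x::'a)) powr Q) \<partial>lborel) = ennreal I0"
  proof -
    obtain x where "0 \<le> x" "Lp_norm (ennreal Q) (gauss 1 :: 'a \<Rightarrow> complex) = ennreal x"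
      "(\<integral>\<^sup>+x. ennreal (norm (gauss 1 (x::'a)) powr Q) \<partial>lborel) = ennreal (x powr Q)"
      using Lp_norm_real[OF Q(1), of "gauss 1 :: 'a \<Rightarrow> complex"] G Q by auto
    then show "0 < I0" "(\<integral>\<^sup>+x. ennreal (norm (gauss 1 (x::'a)) powr Q) \<partial>lborel) = ennreal I0"
      using G Q by (auto simp: I0_def)
  qed
  obtain A where A: "0 \<le> A" "(\<integral>\<^sup>+x. ennreal (norm (gauss 1 (x::'a) * complex_of_real (norm x powr \<alpha>)) powr Q) \<partial>lborel) = ennreal (A powr Q)"
    using Lp_norm_real[OF Q(1), of "\<lambda>x::'a. gauss 1 x * complex_of_real (norm x powr \<alpha>)"]
      Lp_norm_gauss_weight[OF q, of \<alpha> 1, where 'a = 'a] \<alpha> Q by auto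
  define I1 where "I1 = A powr Q"
  have I1: "0 \<le> I1"
    by (simp add: I1_def)
  \<comment> \<open>Z is chosen so that the averaged spatial term is at most N^(Q/2) I0 / 24, half
    of the lower bound N^(Q/2) I0 / 12 from Khinchine's inequality. The dilation l makes
    l^(-\<alpha> Q) = 1 / (Z + 1), positive also when Z = 0.\<close>
  define Z where "Z = 48 * (2 * C) powr Q * I1 / I0"
  have Z: "0 \<le> Z"
    using I0 I1 by (simp add: Z_def)
  define l where "l = (Z + 1) powr (1 / (\<alpha> * Q))"
  have l: "0 < l"
    using Z by (simp add: l_def)
  have lQ: "(l powr (- \<alpha>)) powr Q = 1 / (Z + 1)"
  proof -
    have "1 / (\<alpha> * Q) * (- \<alpha>) * Q = - 1"
      using \<alpha> Q by simp
    then show ?thesis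
      using Z by (simp only: l_def powr_powr) (simp add: powr_minus_divide)
  qed
  define \<gamma> where "\<gamma> = \<beta> - d * (1 - recip q - recip p)"
  define Y where "Y N = l powr \<gamma> * (K * real N powr recip p)" for N
  have Y: "0 \<le> Y N" for N
    using K by (simp add: Y_def)
  \<comment> \<open>The scaled inequality for one choice of signs, put into Q-th powers so that it
    can be summed over all choices.\<close>
  have single: "(\<integral>\<^sup>+x. ennreal (norm (H N T x) powr Q) \<partial>lborel)
    \<le> ennreal ((2 * C) powr Q / (Z + 1)) * (\<integral>\<^sup>+x. ennreal (norm (H N T x * complex_of_real (norm x powr \<alpha>)) powr Q) \<partial>lborel)
      + ennreal ((2 * C) powr Q * Y N powr Q)" if N: "1 \<le> N" for N T
  proof -
    \<comment> \<open>A crude bound by N Gaussians, whose only purpose is to show that the weighted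
      norm is a real number.\<close>
    have "Lp_norm q (\<lambda>x. H N T x * complex_of_real (norm x powr \<alpha>)) \<le> Lp_norm q (\<lambda>x::'a. complex_of_real (real N) * (gauss 1 x * complex_of_real (norm x powr \<alpha>)))"
    proof (rule Lp_norm_mono[OF q])
      fix x
      have "S N T x \<le> (\<Sum>j=1..N. norm (rsign T j * chi (2 ^ j * (norm x)\<^sup>2 / 2)))"
        unfolding S_def by (rule norm_sum)
      also have "\<dots> = real N"
        by (simp add: norm_mult)
      finally have "S N T x \<le> real N" .
      then have "norm (gauss 1 x) * S N T x * norm x powr \<alpha> \<le> norm (gauss 1 x) * real N * norm x powr \<alpha>"
        by (intro mult_right_mono mult_left_mono) auto
      then show "norm (H N T x * complex_of_real (norm x powr \<alpha>)) \<le> norm (complex_of_real (real N) * (gauss 1 x * complex_of_real (norm x powr \<alpha>)))"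
        by (simp add: norm_mult norm_H mult_ac)
    qed measurable
    also have "\<dots> = ennreal (norm (complex_of_real (real N))) * Lp_norm q (\<lambda>x::'a. gauss 1 x * complex_of_real (norm x powr \<alpha>))"
      by (intro Lp_norm_scale q) measurable
    also have "\<dots> < top"
      using Lp_norm_gauss_weight[OF q, of \<alpha> 1, where 'a = 'a] \<alpha> by (simp add: ennreal_mult_less_top)
    finally obtain x where x: "0 \<le> x" "Lp_norm q (\<lambda>x. H N T x * complex_of_real (norm x powr \<alpha>)) = ennreal x"
      "(\<integral>\<^sup>+x. ennreal (norm (H N T x * complex_of_real (norm x powr \<alpha>)) powr Q) \<partial>lborel) = ennreal (x powr Q)"
      using Lp_norm_real[OF Q(1), of "\<lambda>x. H N T x * complex_of_real (norm x powr \<alpha>)"] Q by auto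
    have "Lp_norm q (H N T) \<le> ennreal C * (ennreal (l powr (- \<alpha>)) * ennreal x + ennreal (l powr \<gamma>) * ennreal (K * real N powr recip p))"
      using scaled_inequality[OF Hint l, of N T] fH_norm[OF N, of T] unfolding x(2) \<gamma>_def[symmetric]
      by (elim order_trans) (intro mult_left_mono add_left_mono, auto)
    also have "\<dots> = ennreal (C * (l powr (- \<alpha>) * x + Y N))"
      using C x K by (simp add: ennreal_mult Y_def)
    finally have "(\<integral>\<^sup>+x. ennreal (norm (H N T x) powr Q) \<partial>lborel) \<le> ennreal ((C * (l powr (- \<alpha>) * x + Y N)) powr Q)"
      using Lp_norm_le_iff[OF Q(1), of "C * (l powr (- \<alpha>) * x + Y N)" "H N T"] Q C x Y[of N] by simp
    also have "(C * (l powr (- \<alpha>) * x + Y N)) powr Q \<le> (2 * C) powr Q * ((l powr (- \<alpha>) * x) powr Q + Y N powr Q)"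
    proof -
      have "(C * (l powr (- \<alpha>) * x + Y N)) powr Q = C powr Q * (l powr (- \<alpha>) * x + Y N) powr Q"
        by (rule powr_mult)
      also have "\<dots> \<le> C powr Q * (2 powr Q * ((l powr (- \<alpha>) * x) powr Q + Y N powr Q))"
        using x Y Q by (intro mult_left_mono powr_add_le) auto
      finally show ?thesis
        by (simp add: powr_mult mult_ac)
    qed
    also have "(l powr (- \<alpha>) * x) powr Q = x powr Q / (Z + 1)"
      by (simp add: powr_mult lQ)
    also have "(2 * C) powr Q * (x powr Q / (Z + 1) + Y N powr Q) = (2 * C) powr Q / (Z + 1) * x powr Q + (2 * C) powr Q * Y N powr Q"
      by (simp add: distrib_left)
    also have "ennreal \<dots> = ennreal ((2 * C) powr Q / (Z + 1)) * ennreal (x powr Q) + ennreal ((2 * C) powr Q * Y N powr Q)"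
      using Z by (simp add: ennreal_mult[symmetric])
    finally show ?thesis
      unfolding x(3) by (simp add: ennreal_leI)
  qed
  have main: "real N powr (Q / 2) * (I0 / 24) \<le> 0 + ((2 * C) powr Q * (l powr \<gamma> * K) powr Q) * real N powr (recip p * Q)" if N: "1 \<le> N" for N
  proof -
    let ?P = "Pow {1..N}"
    have Kh: "2 ^ N * real N powr (Q / 2) / 12 \<le> (\<Sum>T\<in>?P. S N T x powr Q)"
      "(\<Sum>T\<in>?P. S N T x powr Q) \<le> 2 ^ N * 2 * real N powr (Q / 2)" for x
      unfolding S_def using Q N by (intro Khinchine[of "\<lambda>j. chi (2 ^ j * (norm x)\<^sup>2 / 2)"]; simp)+
    have "(\<Sum>T\<in>?P. \<integral>\<^sup>+x. ennreal (norm (H N T x * complex_of_real (norm x powr \<alpha>)) powr Q) \<partial>lborel)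
      = (\<integral>\<^sup>+x. (\<Sum>T\<in>?P. ennreal (norm (H N T x * complex_of_real (norm x powr \<alpha>)) powr Q)) \<partial>lborel)"
      by (rule nn_integral_sum[symmetric]) measurable
    also have "\<dots> \<le> (\<integral>\<^sup>+x. ennreal (2 ^ N * 2 * real N powr (Q / 2)) * ennreal (norm (gauss 1 (x::'a) * complex_of_real (norm x powr \<alpha>)) powr Q) \<partial>lborel)"
    proof (rule nn_integral_mono)
      fix x :: 'a
      have "(\<Sum>T\<in>?P. norm (H N T x * complex_of_real (norm x powr \<alpha>)) powr Q)
        = (\<Sum>T\<in>?P. S N T x powr Q) * norm (gauss 1 x * complex_of_real (norm x powr \<alpha>)) powr Q"
        by (simp add: norm_mult norm_H powr_mult sum_distrib_right sum_distrib_left mult_ac)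
      also have "\<dots> \<le> 2 ^ N * 2 * real N powr (Q / 2) * norm (gauss 1 x * complex_of_real (norm x powr \<alpha>)) powr Q"
        by (intro mult_right_mono Kh) auto
      finally show "(\<Sum>T\<in>?P. ennreal (norm (H N T x * complex_of_real (norm x powr \<alpha>)) powr Q))
        \<le> ennreal (2 ^ N * 2 * real N powr (Q / 2)) * ennreal (norm (gauss 1 x * complex_of_real (norm x powr \<alpha>)) powr Q)"
        by (subst sum_ennreal) (auto simp: ennreal_mult[symmetric] intro!: ennreal_leI)
    qed
    also have "\<dots> = ennreal (2 ^ N * 2 * real N powr (Q / 2) * I1)"
      using A by (subst nn_integral_cmult) (auto simp: ennreal_mult I1_def)
    finally have weighted: "(\<Sum>T\<in>?P. \<integral>\<^sup>+x. ennreal (norm (H N T x * complex_of_real (norm x powr \<alpha>)) powr Q) \<partial>lborel)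
      \<le> ennreal (2 ^ N * 2 * real N powr (Q / 2) * I1)" .
    have "ennreal (2 ^ N * real N powr (Q / 2) / 12 * I0)
      = (\<integral>\<^sup>+x. ennreal (2 ^ N * real N powr (Q / 2) / 12) * ennreal (norm (gauss 1 (x::'a)) powr Q) \<partial>lborel)"
      using I0 by (subst nn_integral_cmult) (auto simp: ennreal_mult[symmetric])
    also have "\<dots> \<le> (\<integral>\<^sup>+x. (\<Sum>T\<in>?P. ennreal (norm (H N T x) powr Q)) \<partial>lborel)"
    proof (rule nn_integral_mono)
      fix x :: 'a
      have "2 ^ N * real N powr (Q / 2) / 12 * norm (gauss 1 x) powr Q \<le> (\<Sum>T\<in>?P. S N T x powr Q) * norm (gauss 1 x) powr Q"
        by (intro mult_right_mono Kh) auto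
      also have "\<dots> = (\<Sum>T\<in>?P. norm (H N T x) powr Q)"
        by (simp add: norm_H powr_mult sum_distrib_right sum_distrib_left mult.commute)
      finally show "ennreal (2 ^ N * real N powr (Q / 2) / 12) * ennreal (norm (gauss 1 x) powr Q) \<le> (\<Sum>T\<in>?P. ennreal (norm (H N T x) powr Q))"
        by (subst sum_ennreal) (auto simp: ennreal_mult[symmetric] intro!: ennreal_leI)
    qed
    also have "\<dots> = (\<Sum>T\<in>?P. \<integral>\<^sup>+x. ennreal (norm (H N T x) powr Q) \<partial>lborel)"
      by (rule nn_integral_sum) measurable
    also have "\<dots> \<le> (\<Sum>T\<in>?P. ennreal ((2 * C) powr Q / (Z + 1)) * (\<integral>\<^sup>+x. ennreal (norm (H N T x * complex_of_real (norm x powr \<alpha>)) powr Q) \<partial>lborel)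
      + ennreal ((2 * C) powr Q * Y N powr Q))"
      by (intro sum_mono single N)
    also have "\<dots> = ennreal ((2 * C) powr Q / (Z + 1)) * (\<Sum>T\<in>?P. \<integral>\<^sup>+x. ennreal (norm (H N T x * complex_of_real (norm x powr \<alpha>)) powr Q) \<partial>lborel)
      + of_nat (card ?P) * ennreal ((2 * C) powr Q * Y N powr Q)"
      by (simp add: sum.distrib sum_distrib_left)
    also have "\<dots> \<le> ennreal ((2 * C) powr Q / (Z + 1)) * ennreal (2 ^ N * 2 * real N powr (Q / 2) * I1) + of_nat (card ?P) * ennreal ((2 * C) powr Q * Y N powr Q)"
      by (intro add_right_mono mult_left_mono weighted) simp
    also have "ennreal ((2 * C) powr Q / (Z + 1)) * ennreal (2 ^ N * 2 * real N powr (Q / 2) * I1) + of_nat (card ?P) * ennreal ((2 * C) powr Q * Y N powr Q)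
      = ennreal ((2 * C) powr Q / (Z + 1) * (2 ^ N * 2 * real N powr (Q / 2) * I1) + 2 ^ N * ((2 * C) powr Q * Y N powr Q))"
      using Z I1 by (simp add: ennreal_mult[symmetric] card_Pow ennreal_of_nat_eq_real_of_nat ennreal_plus[symmetric] del: ennreal_plus)
    finally have "2 ^ N * real N powr (Q / 2) / 12 * I0
      \<le> (2 * C) powr Q / (Z + 1) * (2 ^ N * 2 * real N powr (Q / 2) * I1) + 2 ^ N * ((2 * C) powr Q * Y N powr Q)"
      using Z I1 by (subst (asm) ennreal_le_iff) auto
    then have "2 ^ N * (real N powr (Q / 2) / 12 * I0)
      \<le> 2 ^ N * ((2 * C) powr Q / (Z + 1) * (2 * real N powr (Q / 2) * I1) + (2 * C) powr Q * Y N powr Q)"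
      by (simp add: algebra_simps)
    then have le: "real N powr (Q / 2) / 12 * I0 \<le> (2 * C) powr Q / (Z + 1) * (2 * real N powr (Q / 2) * I1) + (2 * C) powr Q * Y N powr Q"
      by (subst (asm) mult_le_cancel_left_pos) auto
    have "(2 * C) powr Q / (Z + 1) * (2 * real N powr (Q / 2) * I1) = real N powr (Q / 2) * (I0 / 24) * (Z / (Z + 1))"
      using I0 by (simp add: Z_def)
    also have "\<dots> \<le> real N powr (Q / 2) * (I0 / 24) * 1"
      using Z I0 by (intro mult_left_mono) auto
    finally have "real N powr (Q / 2) * (I0 / 24) \<le> (2 * C) powr Q * Y N powr Q"
      using le by simp
    also have "Y N powr Q = (l powr \<gamma> * K) powr Q * real N powr (recip p * Q)"
      by (simp add: Y_def powr_mult powr_powr mult.assoc)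
    finally show ?thesis
      by (simp add: mult.assoc)
  qed
  show False
  proof (rule powr_growth_contradiction[OF main])
    show "0 \<le> recip p * Q"
      using recip_nonneg[of p] Q by simp
    show "recip p * Q < Q / 2"
      using rp Q by simp
  qed (use I0 in auto)
qed

end

section \<open>Borel representatives and the equivalence\<close>

lemma borel_representative:
  fixes f :: "'a::euclidean_space \<Rightarrow> complex"
  assumes f: "integrable lebesgue f"
  obtains g where "integrable lborel g" "AE x in lebesgue. f x = g x" "g \<in> borel_measurable lebesgue"
proof -
  have "(\<lambda>x. Re (f x)) \<in> borel_measurable lebesgue"
    using f by auto
  then obtain u where u: "u \<in> borel_measurable lborel" "AE x in lborel. Re (f x) = u x"
    using completion_ex_borel_measurable_real by blast
  have "(\<lambda>x. Im (f x)) \<in> borel_measurable lebesgue"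
    using f by auto
  then obtain v where v: "v \<in> borel_measurable lborel" "AE x in lborel. Im (f x) = v x"
    using completion_ex_borel_measurable_real by blast
  define g where "g x = Complex (u x) (v x)" for x
  have "g = (\<lambda>x. complex_of_real (u x) + \<i> * complex_of_real (v x))"
    by (simp add: fun_eq_iff g_def Complex_eq)
  then have g: "g \<in> borel_measurable lborel"
    using u v by simp
  then have gl: "g \<in> borel_measurable lebesgue"
    by (rule measurable_completion)
  have "AE x in lborel. f x = g x"
    using u(2) v(2) by eventually_elim (simp add: g_def complex_eq_iff)
  then have ae: "AE x in lebesgue. f x = g x"
    by (rule AE_completion)
  have "integrable lebesgue g"
    using f gl ae by (subst integrable_cong_AE[of g lebesgue f]) (auto elim!: eventually_mono)
  then have "integrable lborel g"
    using g by (simp add: integrable_completion)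
  then show ?thesis
    using that ae gl by blast
qed

theorem theorem1p1:
  fixes p q :: ennreal and \<alpha> \<beta> d :: real
  assumes d: "d = real DIM('a::euclidean_space)"
    and p: "1 \<le> p" and q: "1 \<le> q"
    and \<alpha>: "0 < \<alpha>" and \<beta>: "0 < \<beta>"
  shows "(\<exists>C::real. 0 < C \<and>
           (\<forall>f :: 'a \<Rightarrow> complex. integrable lebesgue f \<longrightarrow>
              Lp_norm q f \<le> ennreal C *
                (Lp_norm q (\<lambda>x. f x * complex_of_real (norm x powr \<alpha>))
                 + Lp_norm p (\<lambda>\<xi>. fourier f \<xi> * complex_of_real (norm \<xi> powr \<beta>)))))
     \<longleftrightarrow>
       ((p \<le> q \<and> q < \<infinity> \<and> \<beta> = d * (1 - recip q - recip p)) \<or>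
        \<beta> > d * (1 - recip q - recip p))
       \<and>
       (q \<ge> 2 \<or>
        (p \<le> 2 \<and> q \<le> 2) \<or>
        (q < 2 \<and> 2 < p \<and> \<beta> > d * (1/2 - recip p)))"
  (is "?L \<longleftrightarrow> ?R1 \<and> ?R2")
proof
  assume ?L
  then obtain C where C: "0 < C" and ineq: "\<And>f :: 'a \<Rightarrow> complex. integrable lebesgue f \<Longrightarrow>
      Lp_norm q f \<le> ennreal C * (Lp_norm q (\<lambda>x. f x * complex_of_real (norm x powr \<alpha>))
        + Lp_norm p (\<lambda>\<xi>. fourier f \<xi> * complex_of_real (norm \<xi> powr \<beta>)))"
    by blast
  interpret uncertainty p q \<alpha> \<beta> C d "TYPE('a)"
  proof
    fix f :: "'a \<Rightarrow> complex"
    assume "integrable lborel f"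
    then have "integrable lebesgue f"
      by (simp add: integrable_completion)
    then show "Lp_norm q f \<le> ennreal C * (Lp_norm q (\<lambda>x. f x * complex_of_real (norm x powr \<alpha>))
        + Lp_norm p (\<lambda>\<xi>. fourier f \<xi> * complex_of_real (norm \<xi> powr \<beta>)))"
      by (rule ineq)
  qed (fact p q \<alpha> \<beta> C d)+
  show "?R1 \<and> ?R2"
    using beta_ge beta_critical beta_random by (auto simp: not_le le_less)
next
  assume R: "?R1 \<and> ?R2"
  have "\<exists>C>0. \<forall>f::'a \<Rightarrow> complex. integrable lborel f \<longrightarrow>
    Lp_norm q f \<le> ennreal C * (Lp_norm q (\<lambda>x. f x * complex_of_real (norm x powr \<alpha>))
      + Lp_norm p (\<lambda>\<xi>. fourier f \<xi> * complex_of_real (norm \<xi> powr \<beta>)))"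
  proof (cases "d * (1 - recip q - recip p) < \<beta>")
    case True
    define t where "t = min (1 / 2) (min (recip q) (1 - recip p))"
    have t: "0 \<le> t" "t \<le> 1 / 2" "t \<le> recip q" "t \<le> 1 - recip p"
      using recip_nonneg[of q] recip_le_1[OF p] unfolding t_def by linarith+
    have r2: "recip 2 = 1 / 2"
      using recip_ennreal[of 2] by simp
    have d0: "0 < d"
      by (simp add: d)
    \<comment> \<open>According to which term attains the minimum, the left side is 0, or the bound
      of the strict case, or d (1/2 - 1/p). The last occurs only for q < 2 < p, where the second
      group of conditions supplies the inequality.\<close>
    have "d * (1 - t - recip p) < \<beta>"
    proof -
      consider "t = 1 - recip p" | "t = recip q" | "t = 1 / 2" "1 / 2 < recip q" "recip p < 1 / 2"
        unfolding t_def by linarith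
      then show ?thesis
      proof cases
        case 3
        then have "q < 2" "2 < p"
          using recip_le_iff[of q 2] recip_le_iff[of 2 q] recip_le_iff[of p 2] p q r2 by (auto simp: not_le[symmetric])
        then show ?thesis
          using R unfolding 3(1) by auto
      qed (use True \<beta> in auto)
    qed
    then show ?thesis
      using uncertainty_strict[OF p q \<alpha> \<beta> t, where 'a = 'a] d by simp
  next
    case False
    then have e: "p \<le> q" "q < \<infinity>" "\<beta> = d * (1 - recip q - recip p)"
      using R by auto
    \<comment> \<open>For p \<le> q < 2 both reciprocals exceed 1/2, and the equation for \<beta>
      would make it nonpositive.\<close>
    have "2 \<le> q"
    proof (rule ccontr)
      assume "\<not> 2 \<le> q"
      then have "\<not> recip q \<le> recip 2"
        using recip_le_iff[of 2 q] q by simp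
      moreover have "recip q \<le> recip p"
        using recip_antimono[OF p e(1)] .
      ultimately have "1 - recip q - recip p \<le> 0"
        using recip_ennreal[of 2] by simp
      then have "\<beta> \<le> 0"
        unfolding e(3) d by (intro mult_nonneg_nonpos) auto
      then show False
        using \<beta> by simp
    qed
    then obtain C where C: "0 < C" "\<And>f::'a \<Rightarrow> complex. integrable lborel f \<Longrightarrow>
      Lp_norm q f \<le> ennreal C * Lp_norm p (\<lambda>\<xi>. fourier f \<xi> * complex_of_real (norm \<xi> powr \<beta>))"
      using Pitt_inequality[OF p _ less_imp_le[OF \<beta>], of q, where 'a = 'a] e d by auto
    show ?thesis
    proof (intro exI[of _ C] conjI allI impI C(1))
      fix f :: "'a \<Rightarrow> complex"
      assume "integrable lborel f"
      then have "Lp_norm q f \<le> ennreal C * Lp_norm p (\<lambda>\<xi>. fourier f \<xi> * complex_of_real (norm \<xi> powr \<beta>))"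
        by (rule C(2))
      also have "\<dots> \<le> ennreal C * (Lp_norm q (\<lambda>x. f x * complex_of_real (norm x powr \<alpha>))
        + Lp_norm p (\<lambda>\<xi>. fourier f \<xi> * complex_of_real (norm \<xi> powr \<beta>)))"
        by (intro mult_left_mono add_increasing) auto
      finally show "Lp_norm q f \<le> ennreal C * (Lp_norm q (\<lambda>x. f x * complex_of_real (norm x powr \<alpha>))
        + Lp_norm p (\<lambda>\<xi>. fourier f \<xi> * complex_of_real (norm \<xi> powr \<beta>)))" .
    qed
  qed
  then obtain C where C: "0 < C" "\<And>f::'a \<Rightarrow> complex. integrable lborel f \<Longrightarrow>
    Lp_norm q f \<le> ennreal C * (Lp_norm q (\<lambda>x. f x * complex_of_real (norm x powr \<alpha>))
      + Lp_norm p (\<lambda>\<xi>. fourier f \<xi> * complex_of_real (norm \<xi> powr \<beta>)))"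
    by blast
  show ?L
  proof (intro exI[of _ C] conjI allI impI C(1))
    fix f :: "'a \<Rightarrow> complex"
    assume f: "integrable lebesgue f"
    obtain g where g: "integrable lborel g" "AE x in lebesgue. f x = g x" "g \<in> borel_measurable lebesgue"
      by (rule borel_representative[OF f])
    have fm: "f \<in> borel_measurable lebesgue"
      using f by simp
    have w: "(\<lambda>x::'a. complex_of_real (norm x powr \<alpha>)) \<in> borel_measurable lebesgue"
      by (intro measurable_completion) measurable
    have chi_m: "(\<lambda>x::'a. chi (x \<bullet> \<xi>)) \<in> borel_measurable lebesgue" for \<xi>
      by (intro measurable_completion) measurable
    have 1: "Lp_norm q f = Lp_norm q g"
      by (rule Lp_norm_AE_cong_lebesgue[OF g(2) fm g(3)])
    have 2: "Lp_norm q (\<lambda>x. f x * complex_of_real (norm x powr \<alpha>)) = Lp_norm q (\<lambda>x. g x * complex_of_real (norm x powr \<alpha>))"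
    proof (rule Lp_norm_AE_cong_lebesgue)
      show "AE x in lebesgue. f x * complex_of_real (norm x powr \<alpha>) = g x * complex_of_real (norm x powr \<alpha>)"
        using g(2) by eventually_elim simp
    qed (intro borel_measurable_times fm g(3) w)+
    \<comment> \<open>The transforms agree at every \<xi>, not merely almost everywhere, since each
      is an integral; the frequency term can therefore be rewritten outright.\<close>
    have 3: "fourier f \<xi> = fourier g \<xi>" for \<xi>
      unfolding fourier_def chi_def[symmetric]
    proof (rule integral_cong_AE)
      show "AE x in lebesgue. f x * chi (x \<bullet> \<xi>) = g x * chi (x \<bullet> \<xi>)"
        using g(2) by eventually_elim simp
    qed (intro borel_measurable_times fm g(3) chi_m)+
    show "Lp_norm q f \<le> ennreal C * (Lp_norm q (\<lambda>x. f x * complex_of_real (norm x powr \<alpha>))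
      + Lp_norm p (\<lambda>\<xi>. fourier f \<xi> * complex_of_real (norm \<xi> powr \<beta>)))"
      unfolding 1 2 3 by (rule C(2)[OF g(1)])
  qed
qed

end
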